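(* Let $(\mathbf Y_t)_{t\ge0}$ be the state process of the COGARCH$(p,q)$ process with parameters $B$, $\mathbf a$ and $\alpha_0$ and driving Lévy process $L$ with nontrivial Lévy measure $\nu_L$. Suppose that all the eigenvalues of $B$ are distinct and that there is some $r\in[1,\infty]$ such that $$\int_{\mathbb R}\log\bigl(1+\|S^{-1}\mathbf e\mathbf a'S\|_r\,y^2\bigr)\,d\nu_L(y)<-\lambda(B)$$ for some matrix $S\in\mathbb C^{q\times q}$ such that $S^{-1}BS$ is diagonal. Then $\mathbf Y_t$ converges in distribution to a finite random vector $\mathbf Y_\infty$ as $t\to\infty$. It follows that if $\mathbf Y_0\stackrel{d}{=}\mathbf Y_\infty$, then $(\mathbf Y_t)_{t\ge0}$ and $(V_t)_{t\ge0}$ are strictly stationary.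
   Context: Setting: $q\ge p\ge1$ are integers, $\alpha_0>0$, $\alpha_1,\dots,\alpha_p,\beta_1,\dots,\beta_q\in\mathbb R$, $\alpha_p\ne0$, $\beta_q\neq0$, $\alpha_{p+1}=\dots=\alpha_q=0$; $B$ is the $q\times q$ companion matrix with ones on the superdiagonal, last row $(-\beta_q,-\beta_{q-1},\dots,-\beta_1)$ and zeros elsewhere ($B=-\beta_1$ if $q=1$); $\mathbf a=(\alpha_1,\dots,\alpha_q)'$, $\mathbf e=(0,\dots,0,1)'\in\mathbb R^q$; a prime denotes transpose. $L=(L_t)_{t\ge0}$ is a real-valued Lévy process with Lévy measure $\nu_L\neq0$, $\Delta L_t=L_t-L_{t-}$ and $[L,L]^{(d)}_t=\sum_{0<s\le t}(\Delta L_s)^2$. The state process $\mathbf Y$ is the unique càdlàg solution of $d\mathbf Y_t=B\mathbf Y_{t-}\,dt+\mathbf e(\alpha_0+\mathbf a'\mathbf Y_{t-})\,d[L,L]^{(d)}_t$, $t>0$, with $\mathbb R^q$-valued initial value $\mathbf Y_0$ independent of $L$. The volatility process is $V_t=\alpha_0+\mathbf a'\mathbf Y_{t-}$ for $t>0$, $V_0=\alpha_0+\mathbf a'\mathbf Y_0$ (it need not be nonnegative here). $\lambda(B)$ is the maximum of the real parts of the eigenvalues of $B$. $\|\cdot\|_r$ denotes the $L^r$-norm on $\mathbb C^q$ and also the associated natural (operator) matrix norm. *)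

theory Defs
  imports "HOL-Probability.Probability"
begin

section \<open>Matrices and norms\<close>

text \<open>
  Vectors in \<open>\<real>\<^sup>q\<close> are elements of \<open>real ^ 'q\<close>, with \<open>q = CARD('q)\<close>. The linear order on
  the finite index type supplies the numbering of the coordinates: \<open>pos\<close> is the order
  isomorphism from \<open>'q\<close> onto \<open>{1..q}\<close>.
\<close>

definition pos :: "'q::{finite,linorder} \<Rightarrow> nat" where
  "pos i = card {j. j \<le> i}"

definition companion :: "(nat \<Rightarrow> real) \<Rightarrow> real ^ 'q::{finite,linorder} ^ 'q::{finite,linorder}" where
  "companion \<beta> = (\<chi> i j.
     if pos i = CARD('q) then - \<beta> (CARD('q) + 1 - pos j)
     else if pos j = pos i + 1 then 1 else 0)"

definition param_vec :: "(nat \<Rightarrow> real) \<Rightarrow> real ^ 'q::{finite,linorder}" where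
  "param_vec \<alpha> = (\<chi> i. \<alpha> (pos i))"

definition last_unit :: "real ^ 'q::{finite,linorder}" where
  "last_unit = (\<chi> i. if pos i = CARD('q) then 1 else 0)"

definition outer :: "real ^ 'm \<Rightarrow> real ^ 'n \<Rightarrow> real ^ 'n ^ 'm" where
  "outer u v = (\<chi> i j. u $ i * v $ j)"

definition cmat :: "real ^ 'n ^ 'm \<Rightarrow> complex ^ 'n ^ 'm" where
  "cmat A = (\<chi> i j. complex_of_real (A $ i $ j))"

definition diagonal_mat :: "complex ^ 'n ^ 'n \<Rightarrow> bool" where
  "diagonal_mat A \<longleftrightarrow> (\<forall>i j. i \<noteq> j \<longrightarrow> A $ i $ j = 0)"

definition eigenvalues :: "real ^ 'n ^ 'n \<Rightarrow> complex set" where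
  "eigenvalues A = {z. \<exists>v. v \<noteq> 0 \<and> cmat A *v v = z *s v}"

definition spectral_abscissa :: "real ^ 'n ^ 'n \<Rightarrow> real" where
  "spectral_abscissa A = Max (Re ` eigenvalues A)"

definition lr_norm :: "ereal \<Rightarrow> complex ^ 'n \<Rightarrow> real" where
  "lr_norm r x =
     (if r = \<infinity> then Max (range (\<lambda>i. cmod (x $ i)))
      else (\<Sum>i\<in>UNIV. cmod (x $ i) powr real_of_ereal r) powr (1 / real_of_ereal r))"

definition lr_opnorm :: "ereal \<Rightarrow> complex ^ 'n ^ 'n \<Rightarrow> real" where
  "lr_opnorm r A = (SUP x\<in>{x. x \<noteq> 0}. lr_norm r (A *v x) / lr_norm r x)"


section \<open>Levy processes and their jumps\<close>

text \<open>Processes are functions on \<open>real\<close> of which only the values at times \<open>t \<ge> 0\<close> matter.\<close>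

definition left_lim :: "(real \<Rightarrow> 'w \<Rightarrow> 'b::t2_space) \<Rightarrow> real \<Rightarrow> 'w \<Rightarrow> 'b" where
  "left_lim X t \<omega> = Lim (at_left t) (\<lambda>s. X s \<omega>)"

definition jump :: "(real \<Rightarrow> 'w \<Rightarrow> real) \<Rightarrow> real \<Rightarrow> 'w \<Rightarrow> real" where
  "jump X t \<omega> = X t \<omega> - left_lim X t \<omega>"

definition cadlag :: "(real \<Rightarrow> 'b::topological_space) \<Rightarrow> bool" where
  "cadlag x \<longleftrightarrow> (\<forall>t\<ge>0. (x \<longlongrightarrow> x t) (at_right t)) \<and> (\<forall>t>0. \<exists>l. (x \<longlongrightarrow> l) (at_left t))"

definition levy_process :: "'w measure \<Rightarrow> (real \<Rightarrow> 'w \<Rightarrow> real) \<Rightarrow> bool" where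
  "levy_process M L \<longleftrightarrow>
     prob_space M \<and>
     (\<forall>t\<ge>0. L t \<in> borel_measurable M) \<and>
     (AE \<omega> in M. L 0 \<omega> = 0) \<and>
     (\<forall>(n::nat) t. 0 \<le> t 0 \<and> (\<forall>i<n. t i < t (Suc i)) \<longrightarrow>
        prob_space.indep_vars M (\<lambda>_. borel) (\<lambda>i \<omega>. L (t (Suc i)) \<omega> - L (t i) \<omega>) {..<n}) \<and>
     (\<forall>s\<ge>0. \<forall>t\<ge>0.
        distr M borel (\<lambda>\<omega>. L (s + t) \<omega> - L s \<omega>) = distr M borel (\<lambda>\<omega>. L t \<omega> - L 0 \<omega>)) \<and>
     (\<forall>t\<ge>0. \<forall>\<epsilon>>0.
        ((\<lambda>s. measure M {\<omega> \<in> space M. \<bar>L s \<omega> - L t \<omega>\<bar> > \<epsilon>}) \<longlongrightarrow> 0) (at t within {0..})) \<and>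
     (AE \<omega> in M. cadlag (\<lambda>t. L t \<omega>))"

text \<open>
  The Levy measure of a Borel set \<open>A\<close> is the expected number of nonzero jumps with size in
  \<open>A\<close> up to time 1; in particular it does not charge \<open>{0}\<close>.
\<close>

definition is_levy_measure :: "'w measure \<Rightarrow> (real \<Rightarrow> 'w \<Rightarrow> real) \<Rightarrow> real measure \<Rightarrow> bool" where
  "is_levy_measure M L \<nu> \<longleftrightarrow>
     sets \<nu> = sets borel \<and>
     (\<forall>A\<in>sets borel. emeasure \<nu> A =
        (\<integral>\<^sup>+\<omega>. emeasure (count_space UNIV)
                {s \<in> {0<..1}. jump L s \<omega> \<noteq> 0 \<and> jump L s \<omega> \<in> A} \<partial>M))"

definition disc_qv :: "(real \<Rightarrow> 'w \<Rightarrow> real) \<Rightarrow> real \<Rightarrow> 'w \<Rightarrow> real" where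
  "disc_qv L t \<omega> = (\<Sum>\<^sub>\<infinity>s\<in>{0<..t}. (jump L s \<omega>)\<^sup>2)"


section \<open>State and volatility process\<close>

definition indep_of_process ::
  "'w measure \<Rightarrow> ('w \<Rightarrow> 'b::topological_space) \<Rightarrow> (real \<Rightarrow> 'w \<Rightarrow> real) \<Rightarrow> bool" where
  "indep_of_process M Z L \<longleftrightarrow>
     prob_space.indep_set M
       (sets (vimage_algebra (space M) Z borel))
       (sets (vimage_algebra (space M) (\<lambda>\<omega>. \<lambda>t\<in>{0..}. L t \<omega>) (\<Pi>\<^sub>M t\<in>{0..}. borel)))"

text \<open>
  The stochastic differential equation in integrated form. The integrator \<open>[L,L]\<^sup>d\<close> has
  nondecreasing right-continuous paths, so the integral with respect to it is the pathwise
  Lebesgue-Stieltjes integral over \<open>(0,t]\<close>. Every path of \<open>Y\<close>, not merely almost every path,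
  is required to be cadlag: \<open>M\<close> need not be complete, and otherwise the left limits of \<open>Y\<close>,
  hence the volatility process, might fail to be measurable.
\<close>

definition state_process ::
  "'w measure \<Rightarrow> (real \<Rightarrow> 'w \<Rightarrow> real) \<Rightarrow> real ^ 'q::{finite,linorder} ^ 'q::{finite,linorder} \<Rightarrow> real ^ 'q::{finite,linorder} \<Rightarrow> real
     \<Rightarrow> (real \<Rightarrow> 'w \<Rightarrow> real ^ 'q::{finite,linorder}) \<Rightarrow> bool" where
  "state_process M L B a \<alpha>\<^sub>0 Y \<longleftrightarrow>
     (\<forall>t\<ge>0. Y t \<in> borel_measurable M) \<and>
     (\<forall>\<omega>\<in>space M. cadlag (\<lambda>t. Y t \<omega>)) \<and>
     indep_of_process M (Y 0) L \<and>
     (AE \<omega> in M. \<forall>t\<ge>0.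
        Y t \<omega> = Y 0 \<omega>
          + (LBINT s:{0<..t}. B *v left_lim Y s \<omega>)
          + (LINT s:{0<..t}|interval_measure (\<lambda>u. disc_qv L u \<omega>).
               (\<alpha>\<^sub>0 + a \<bullet> left_lim Y s \<omega>) *\<^sub>R last_unit))"

definition volatility ::
  "real ^ 'q \<Rightarrow> real \<Rightarrow> (real \<Rightarrow> 'w \<Rightarrow> real ^ 'q) \<Rightarrow> real \<Rightarrow> 'w \<Rightarrow> real" where
  "volatility a \<alpha>\<^sub>0 Y t \<omega> = \<alpha>\<^sub>0 + a \<bullet> (if t = 0 then Y 0 \<omega> else left_lim Y t \<omega>)"


section \<open>Convergence in distribution and stationarity\<close>

text \<open>The limit is given by its law \<open>\<mu>\<close>.\<close>

definition converges_in_distribution ::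
  "'w measure \<Rightarrow> (real \<Rightarrow> 'w \<Rightarrow> 'b::metric_space) \<Rightarrow> 'b measure \<Rightarrow> bool" where
  "converges_in_distribution M X \<mu> \<longleftrightarrow>
     (\<forall>f::'b \<Rightarrow> real. continuous_on UNIV f \<and> bounded (range f) \<longrightarrow>
        ((\<lambda>t. integral\<^sup>L M (\<lambda>\<omega>. f (X t \<omega>))) \<longlongrightarrow> integral\<^sup>L \<mu> f) at_top)"

definition strictly_stationary ::
  "'w measure \<Rightarrow> (real \<Rightarrow> 'w \<Rightarrow> 'b::topological_space) \<Rightarrow> bool" where
  "strictly_stationary M X \<longleftrightarrow>
     (\<forall>t\<ge>0. X t \<in> borel_measurable M) \<and>
     (\<forall>I h. finite I \<and> I \<subseteq> {0..} \<and> 0 \<le> h \<longrightarrow>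
        distr M (\<Pi>\<^sub>M t\<in>I. borel) (\<lambda>\<omega>. \<lambda>t\<in>I. X (t + h) \<omega>) =
        distr M (\<Pi>\<^sub>M t\<in>I. borel) (\<lambda>\<omega>. \<lambda>t\<in>I. X t \<omega>))"

end

theory Submission
  imports Defs
begin

text \<open>
  Every solution of the state equation is the limit of its Euler scheme, and this scheme is a
  functional of the increments of \<open>L\<close> alone: the jumps are recovered from increments over dyadic
  grids after a truncation that discards the continuous part. Hence \<open>Y\<close> is a time-homogeneous
  Markov process driven by random affine maps. In the norm \<open>\<parallel>S\<^sup>-\<^sup>1 y\<parallel>\<^sub>r\<close> the map over a unit interval
  contracts distances by \<open>exp (\<lambda>(B) + G)\<close>, where \<open>G\<close> sums \<open>ln (1 + K (\<Delta>L)\<^sup>2)\<close> over the jumps in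
  that interval; the moment condition says that the mean of \<open>\<lambda>(B) + G\<close> is negative. Composing
  independent copies of these maps backwards, with the newest one innermost, therefore converges
  almost surely, at a geometric rate. The law of the limit is the limit law of \<open>Y\<close>, and it is
  invariant because the transition operators preserve bounded continuous functions. Finally
  \<open>V\<^sub>t = \<alpha>\<^sub>0 + a \<bullet> Y\<^sub>t\<close> almost surely for each fixed \<open>t\<close>, since \<open>L\<close> has no fixed jumps.
\<close>

section \<open>Jumps of cadlag paths along dyadic partitions\<close>

text \<open>Two obstacles shape the argument. \<open>M\<close> is an arbitrary probability space,
  not necessarily complete, and solutions are given only for particular starting values. Jump sums
  and the random maps are therefore written as countable limits of grid values, measurable on the
  whole path space, and every solution is identified with such a limit afterwards, outside one null
  set common to all times. Moreover, the moment condition controls \<open>ln (1 + K * y^2)\<close>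
  only; squared jumps need not have an expectation. It acts through
  \<open>1 + c * (u + v) <= (1 + c * u) * (1 + c * v)\<close>: finite logarithmic sums force
  summability of the squared jumps and bound the product of the Euler step factors uniformly in the
  mesh. For the backward compositions it is enough that a random walk with negative drift is bounded
  above: the drift is raised by half its gap beforehand, which turns boundedness into linear decay.
  In continuous time the integer part of t counts the composed maps, and the fractional part goes
  into the starting value, which stays bounded along a cadlag path.\<close>

definition ljump :: "(real \<Rightarrow> real) \<Rightarrow> real \<Rightarrow> real" where
  "ljump x r = x r - Lim (at_left r) x"

lemma jump_eq_ljump: "jump L s \<omega> = ljump (\<lambda>t. L t \<omega>) s"
  by (simp add: jump_def ljump_def left_lim_def)

lemma cadlag_left_lim:
  fixes x :: "real \<Rightarrow> 'b::t2_space"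
  assumes "cadlag x" "r > 0"
  shows "(x \<longlongrightarrow> Lim (at_left r) x) (at_left r)"
  using assms tendsto_Lim[of "at_left r" x] unfolding cadlag_def
  by (metis trivial_limit_at_left_real)

text \<open>Right continuity makes the oscillation on [r, r + \<gamma>) small, the left limit the
  one on (r - \<gamma>, r). No pair of points straddles \<open>r\<close>, so a jump at
  \<open>r\<close> does no harm. For \<open>r = 0\<close> the second clause is vacuous.\<close>

lemma cadlag_local_aux:
  fixes x :: "real \<Rightarrow> real"
  assumes x: "cadlag x" and r: "0 \<le> r" and \<eta>: "\<eta> > 0"
  shows "\<exists>\<gamma>>0. (\<forall>p q. r \<le> p \<and> p < r + \<gamma> \<and> r \<le> q \<and> q < r + \<gamma> \<longrightarrow> \<bar>x p - x q\<bar> < \<eta>) \<and>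
     (\<forall>p q. 0 \<le> p \<and> r - \<gamma> < p \<and> p < r \<and> 0 \<le> q \<and> r - \<gamma> < q \<and> q < r \<longrightarrow> \<bar>x p - x q\<bar> < \<eta>)"
proof -
  have "(x \<longlongrightarrow> x r) (at_right r)" using x r by (simp add: cadlag_def)
  then have "eventually (\<lambda>q. dist (x q) (x r) < \<eta> / 2) (at_right r)"
    using \<eta> by (intro tendstoD) auto
  then obtain b where b: "b > r" "\<And>q. r < q \<Longrightarrow> q < b \<Longrightarrow> \<bar>x q - x r\<bar> < \<eta> / 2"
    unfolding eventually_at_right_field dist_real_def by blast
  have R: "\<bar>x q - x r\<bar> < \<eta> / 2" if "r \<le> q" "q < b" for q
    using b(2)[of q] that \<eta> by (cases "q = r") auto
  have "\<exists>a<r. \<exists>l. \<forall>q. 0 \<le> q \<and> a < q \<and> q < r \<longrightarrow> \<bar>x q - l\<bar> < \<eta> / 2"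
  proof (cases "r = 0")
    case True then show ?thesis by (intro exI[of _ "-1"]) auto
  next
    case False
    then have "(x \<longlongrightarrow> Lim (at_left r) x) (at_left r)" using x r by (intro cadlag_left_lim) auto
    then have "eventually (\<lambda>q. dist (x q) (Lim (at_left r) x) < \<eta> / 2) (at_left r)"
      using \<eta> by (intro tendstoD) auto
    then show ?thesis unfolding eventually_at_left_field dist_real_def by blast
  qed
  then obtain a l where a: "a < r" "\<And>q. 0 \<le> q \<Longrightarrow> a < q \<Longrightarrow> q < r \<Longrightarrow> \<bar>x q - l\<bar> < \<eta> / 2" by blast
  show ?thesis
  proof (intro exI[of _ "min (b - r) (r - a)"] conjI allI impI)
    fix p q assume *: "r \<le> p \<and> p < r + min (b - r) (r - a) \<and> r \<le> q \<and> q < r + min (b - r) (r - a)"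
    then have "\<bar>x p - x r\<bar> < \<eta> / 2" "\<bar>x q - x r\<bar> < \<eta> / 2" using R[of p] R[of q] by linarith+
    then show "\<bar>x p - x q\<bar> < \<eta>" by linarith
  next
    fix p q assume *: "0 \<le> p \<and> r - min (b - r) (r - a) < p \<and> p < r \<and> 0 \<le> q \<and> r - min (b - r) (r - a) < q \<and> q < r"
    then have "\<bar>x p - l\<bar> < \<eta> / 2" "\<bar>x q - l\<bar> < \<eta> / 2" using a(2)[of p] a(2)[of q] by linarith+
    then show "\<bar>x p - x q\<bar> < \<eta>" by linarith
  qed (use a b in auto)
qed

lemma ljump_le_osc:
  fixes x :: "real \<Rightarrow> real"
  assumes x: "cadlag x" and p: "p < r" "0 \<le> p"
    and osc: "\<And>q. p < q \<Longrightarrow> q < r \<Longrightarrow> \<bar>x r - x q\<bar> \<le> \<eta>"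
  shows "\<bar>ljump x r\<bar> \<le> \<eta>"
proof -
  have "(x \<longlongrightarrow> Lim (at_left r) x) (at_left r)" using x p by (intro cadlag_left_lim) auto
  then have "((\<lambda>q. \<bar>x r - x q\<bar>) \<longlongrightarrow> \<bar>x r - Lim (at_left r) x\<bar>) (at_left r)"
    by (intro tendsto_intros)
  moreover have "eventually (\<lambda>q. \<bar>x r - x q\<bar> \<le> \<eta>) (at_left r)"
    unfolding eventually_at_left_field using osc p by blast
  ultimately show ?thesis unfolding ljump_def
    by (rule tendsto_upperbound) simp
qed

text \<open>The Lebesgue number of the cover by the intervals of \<open>cadlag_local_aux\<close>
  gives one \<delta> for the whole compact interval. A cell shorter than \<delta> fits into one such
  interval, whose center is the only place in it where a jump above \<eta> can occur.\<close>

lemma cadlag_local: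
  fixes x :: "real \<Rightarrow> real"
  assumes x: "cadlag x" and s: "0 \<le> s" and \<eta>: "\<eta> > 0"
  obtains \<delta> where "\<delta> > 0"
    "\<And>p q. s \<le> p \<Longrightarrow> p < q \<Longrightarrow> q \<le> t \<Longrightarrow> q - p < \<delta> \<Longrightarrow>
       \<exists>r\<in>{p<..q}. \<bar>x q - x p - ljump x r\<bar> \<le> 2 * \<eta> \<and> (\<forall>r'\<in>{p<..q} - {r}. \<bar>ljump x r'\<bar> \<le> \<eta>)"
proof -
  obtain \<gamma> where \<gamma>: "\<And>r. 0 \<le> r \<Longrightarrow> \<gamma> r > (0::real)"
    "\<And>r p q. 0 \<le> r \<Longrightarrow> r \<le> p \<Longrightarrow> p < r + \<gamma> r \<Longrightarrow> r \<le> q \<Longrightarrow> q < r + \<gamma> r \<Longrightarrow> \<bar>x p - x q\<bar> < \<eta>"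
    "\<And>r p q. 0 \<le> r \<Longrightarrow> 0 \<le> p \<Longrightarrow> r - \<gamma> r < p \<Longrightarrow> p < r \<Longrightarrow> 0 \<le> q \<Longrightarrow> r - \<gamma> r < q \<Longrightarrow> q < r \<Longrightarrow> \<bar>x p - x q\<bar> < \<eta>"
  proof -
    let ?P = "\<lambda>r \<gamma>. (\<forall>p q. r \<le> p \<and> p < r + \<gamma> \<and> r \<le> q \<and> q < r + \<gamma> \<longrightarrow> \<bar>x p - x q\<bar> < \<eta>) \<and>
     (\<forall>p q. 0 \<le> p \<and> r - \<gamma> < p \<and> p < r \<and> 0 \<le> q \<and> r - \<gamma> < q \<and> q < r \<longrightarrow> \<bar>x p - x q\<bar> < \<eta>)"
    have "\<forall>r. \<exists>\<gamma>. 0 \<le> r \<longrightarrow> 0 < \<gamma> \<and> ?P r \<gamma>" using cadlag_local_aux[OF x _ \<eta>] by blast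
    then obtain \<gamma> where "\<forall>r. 0 \<le> r \<longrightarrow> 0 < \<gamma> r \<and> ?P r (\<gamma> r)" unfolding choice_iff by blast
    then show ?thesis by (intro that[of \<gamma>]; meson)
  qed
  show thesis
  proof (cases "s \<le> t")
    case False
    show ?thesis by (rule that[of 1]) (use False in auto)
  next
    case True
    obtain \<delta> where \<delta>: "\<delta> > 0" "\<And>T. T \<subseteq> {s..t} \<Longrightarrow> diameter T < \<delta> \<Longrightarrow> \<exists>B\<in>(\<lambda>r. ball r (\<gamma> r)) ` {s..t}. T \<subseteq> B"
    proof (rule Lebesgue_number_lemma[of "{s..t}" "(\<lambda>r. ball r (\<gamma> r)) ` {s..t}"])
      show "{s..t} \<subseteq> \<Union> ((\<lambda>r. ball r (\<gamma> r)) ` {s..t})"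
      proof
        fix r assume "r \<in> {s..t}"
        moreover from this have "r \<in> ball r (\<gamma> r)" using \<gamma>(1)[of r] s by simp
        ultimately show "r \<in> \<Union> ((\<lambda>r. ball r (\<gamma> r)) ` {s..t})" by blast
      qed
    qed (use True in auto)
    show ?thesis
    proof (rule that[OF \<delta>(1)])
      fix p q assume pq: "s \<le> p" "p < q" "q \<le> t" "q - p < \<delta>"
      have "diameter {p..q} < \<delta>"
        using pq diameter_closed_interval[of p q] by simp
      then obtain r where r: "r \<in> {s..t}" "{p..q} \<subseteq> ball r (\<gamma> r)"
        using \<delta>(2)[of "{p..q}"] pq by auto
      have in1: "\<bar>u - r\<bar> < \<gamma> r" if "p \<le> u" "u \<le> q" for u
        using r(2) that by (auto simp: subset_iff dist_real_def)
      have r0: "0 \<le> r" using r s by auto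
      have R: "\<bar>x u - x v\<bar> < \<eta>" if "p \<le> u" "u \<le> q" "p \<le> v" "v \<le> q" "r \<le> u" "r \<le> v" for u v
        using that in1[of u] in1[of v] r0 by (intro \<gamma>(2)[of r u v]) auto
      have Lf: "\<bar>x u - x v\<bar> < \<eta>" if "p \<le> u" "u \<le> q" "p \<le> v" "v \<le> q" "u < r" "v < r" for u v
        using that in1[of u] in1[of v] r0 pq s by (intro \<gamma>(3)[of r u v]) auto
      have J: "\<bar>ljump x u\<bar> \<le> \<eta>" if "p < u" "u \<le> q" "u \<noteq> r" for u
      proof (cases "u < r")
        case True
        show ?thesis
          by (rule ljump_le_osc[OF x, of p]) (use that True pq s Lf[of u] in \<open>auto intro!: less_imp_le\<close>)
      next
        case False
        then have "r < u" using that by simp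
        show ?thesis
          by (rule ljump_le_osc[OF x, of "max p r"]) (use that \<open>r < u\<close> pq s R[of u] in \<open>auto intro!: less_imp_le\<close>)
      qed
      show "\<exists>r\<in>{p<..q}. \<bar>x q - x p - ljump x r\<bar> \<le> 2 * \<eta> \<and> (\<forall>r'\<in>{p<..q} - {r}. \<bar>ljump x r'\<bar> \<le> \<eta>)"
      proof (cases "r \<in> {p<..q}")
        case False
        \<comment> \<open>If the center lies outside the cell, the path oscillates by less than
          \<eta> on the whole cell. The right endpoint \<open>q\<close> then serves as the
          distinguished point, its own jump being at most \<eta>.\<close>
        then have "\<bar>x q - x p\<bar> < \<eta>" using pq R[of q p] Lf[of q p] by fastforce
        moreover have "\<bar>ljump x q\<bar> \<le> \<eta>" using J[of q] pq False by auto
        ultimately have "\<bar>x q - x p - ljump x q\<bar> \<le> 2 * \<eta>" by linarith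
        then show ?thesis using J False pq by (intro bexI[of _ q]) auto
      next
        case True
        have "\<bar>x r - Lim (at_left r) x - (x r - x p)\<bar> \<le> \<eta>"
        proof -
          have "(x \<longlongrightarrow> Lim (at_left r) x) (at_left r)" using x pq s True by (intro cadlag_left_lim) auto
          then have "((\<lambda>u. \<bar>x u - x p\<bar>) \<longlongrightarrow> \<bar>Lim (at_left r) x - x p\<bar>) (at_left r)"
            by (intro tendsto_intros)
          moreover have "eventually (\<lambda>u. \<bar>x u - x p\<bar> \<le> \<eta>) (at_left r)"
            unfolding eventually_at_left_field using True Lf[of _ p] by (intro exI[of _ p]) (auto intro!: less_imp_le)
          ultimately have "\<bar>Lim (at_left r) x - x p\<bar> \<le> \<eta>"
            by (rule tendsto_upperbound) simp
          then show ?thesis by linarith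
        qed
        moreover have "\<bar>x q - x r\<bar> < \<eta>" using R[of q r] True by auto
        ultimately have "\<bar>x q - x p - ljump x r\<bar> \<le> 2 * \<eta>" unfolding ljump_def by linarith
        then show ?thesis using J True by (intro bexI[of _ r]) auto
      qed
    qed
  qed
qed


section \<open>Dyadic grids and the position of a point in them\<close>

definition grid :: "real \<Rightarrow> real \<Rightarrow> nat \<Rightarrow> nat \<Rightarrow> real" where
  "grid s t n i = s + real i * ((t - s) / 2 ^ n)"

lemma grid_0 [simp]: "grid s t n 0 = s" and grid_end [simp]: "grid s t n (2 ^ n) = t"
  by (simp_all add: grid_def)

lemma grid_diff: "grid s t n (Suc i) - grid s t n i = (t - s) / 2 ^ n"
  by (simp add: grid_def field_simps)

lemma grid_mono: "s \<le> t \<Longrightarrow> i \<le> j \<Longrightarrow> grid s t n i \<le> grid s t n j"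
  by (simp add: grid_def mult_right_mono divide_right_mono)

lemma grid_bounds: "s \<le> t \<Longrightarrow> i \<le> 2 ^ n \<Longrightarrow> s \<le> grid s t n i \<and> grid s t n i \<le> t"
  using grid_mono[of s t 0 i n] grid_mono[of s t i "2 ^ n" n] by simp

lemma grid_less: "s < t \<Longrightarrow> grid s t n i < grid s t n (Suc i)"
proof -
  assume "s < t"
  then have "0 < (t - s) / 2 ^ n" by (intro divide_pos_pos) auto
  then show ?thesis using grid_diff[of s t n i] by linarith
qed

lemma grid_refine: "grid s t (Suc n) (2 * i) = grid s t n i"
  by (simp add: grid_def field_simps)

lemma grid_shift: "r + grid s t n i = grid (r + s) (r + t) n i"
  by (simp add: grid_def)

lemma mesh_tendsto_0: "(\<lambda>n. c / 2 ^ n) \<longlonglongrightarrow> (0::real)"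
  using LIMSEQ_divide_realpow_zero[of 2 c] by simp

lemma grid_index_ex:
  assumes "s < r" "r \<le> t"
  shows "\<exists>i<2 ^ n. grid s t n i < r \<and> r \<le> grid s t n (Suc i)"
proof -
  define i where "i = (LEAST i. r \<le> grid s t n i)"
  have ex: "r \<le> grid s t n (2 ^ n)" using assms by simp
  then have 1: "r \<le> grid s t n i" and 2: "i \<le> 2 ^ n" unfolding i_def by (rule LeastI, rule Least_le)
  have "i \<noteq> 0" using 1 assms by (intro notI) simp
  then obtain j where j: "i = Suc j" by (cases i) auto
  have "\<not> r \<le> grid s t n j" using not_less_Least[of j "\<lambda>i. r \<le> grid s t n i"] j unfolding i_def by auto
  then show ?thesis using 1 2 j by (intro exI[of _ j]) auto
qed

lemma grid_index_unique:
  assumes "s \<le> t" "grid s t n i < r" "r \<le> grid s t n (Suc i)" "grid s t n j < r" "r \<le> grid s t n (Suc j)"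
  shows "i = j"
proof (rule ccontr)
  assume "i \<noteq> j"
  then consider "Suc i \<le> j" | "Suc j \<le> i" by linarith
  then show False using grid_mono[OF assms(1), of "Suc i" j n] grid_mono[OF assms(1), of "Suc j" i n] assms by cases auto
qed

text \<open>Cells are open on the left and closed on the right. The left endpoint of the cell of
  \<open>r\<close> is strictly below \<open>r\<close> and yields left limits, while the right
  endpoint may equal \<open>r\<close> and yields the value at \<open>r\<close>.\<close>

definition grid_index :: "real \<Rightarrow> real \<Rightarrow> nat \<Rightarrow> real \<Rightarrow> nat" where
  "grid_index s t n r = (SOME i. i < 2 ^ n \<and> grid s t n i < r \<and> r \<le> grid s t n (Suc i))"

lemma grid_index:
  assumes "s < r" "r \<le> t"
  shows "grid_index s t n r < 2 ^ n" "grid s t n (grid_index s t n r) < r" "r \<le> grid s t n (Suc (grid_index s t n r))"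
  using someI_ex[OF grid_index_ex[OF assms, of n]] unfolding grid_index_def by auto

lemma grid_index_eq:
  assumes "s \<le> t" "grid s t n i < r" "r \<le> grid s t n (Suc i)" "i < 2 ^ n"
  shows "grid_index s t n r = i"
proof -
  have "s < r" using grid_bounds[of s t i n] assms by auto
  moreover have "r \<le> t" using grid_bounds[of s t "Suc i" n] assms by auto
  ultimately show ?thesis using grid_index[of s r t n] grid_index_unique[OF assms(1)] assms by blast
qed

lemma grid_index_tendsto:
  assumes "s < r" "r \<le> t"
  shows "(\<lambda>n. grid s t n (grid_index s t n r)) \<longlonglongrightarrow> r"
    and "(\<lambda>n. grid s t n (Suc (grid_index s t n r))) \<longlonglongrightarrow> r"
proof -
  have *: "(\<lambda>n. r - (t - s) / 2 ^ n) \<longlonglongrightarrow> r - 0" "(\<lambda>n. r + (t - s) / 2 ^ n) \<longlonglongrightarrow> r + 0"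
    by (intro tendsto_intros mesh_tendsto_0)+
  show "(\<lambda>n. grid s t n (grid_index s t n r)) \<longlonglongrightarrow> r"
    by (rule tendsto_sandwich[OF _ _ *(1)[simplified] tendsto_const])
      (use grid_index[OF assms] grid_diff[of s t] in \<open>auto intro!: always_eventually less_imp_le simp: algebra_simps\<close>)
  show "(\<lambda>n. grid s t n (Suc (grid_index s t n r))) \<longlonglongrightarrow> r"
  proof (rule tendsto_sandwich[OF _ _ tendsto_const *(2)[simplified]])
    have "grid s t n (Suc (grid_index s t n r)) \<le> r + (t - s) / 2 ^ n" for n
      using grid_index[OF assms, of n] grid_diff[of s t n "grid_index s t n r"] by linarith
    then show "eventually (\<lambda>n. grid s t n (Suc (grid_index s t n r)) \<le> r + (t - s) / 2 ^ n) sequentially" by simp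
  qed (use grid_index[OF assms] in auto)
qed

lemma cadlag_grid_left:
  fixes x :: "real \<Rightarrow> 'b::t2_space"
  assumes "cadlag x" "0 \<le> s" "s < r" "r \<le> t"
  shows "(\<lambda>n. x (grid s t n (grid_index s t n r))) \<longlonglongrightarrow> Lim (at_left r) x"
proof -
  have "filterlim (\<lambda>n. grid s t n (grid_index s t n r)) (at_left r) sequentially"
    unfolding filterlim_at using grid_index_tendsto(1)[of s r t] grid_index(2)[of s r t] assms
    by (auto intro!: always_eventually simp: less_imp_neq)
  then show ?thesis
    using cadlag_left_lim[OF assms(1), of r] assms by (auto intro: filterlim_compose)
qed

lemma cadlag_grid_right:
  fixes x :: "real \<Rightarrow> 'b::t2_space"
  assumes "cadlag x" "0 \<le> s" "s < r" "r \<le> t"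
  shows "(\<lambda>n. x (grid s t n (Suc (grid_index s t n r)))) \<longlonglongrightarrow> x r"
proof -
  have "continuous (at r within {r..}) x"
    using assms unfolding continuous_within cadlag_def by (auto simp: at_within_Ici_at_right)
  then show ?thesis
    by (rule continuous_within_tendsto_compose)
      (use grid_index_tendsto(2)[of s r t] grid_index(3)[of s r t] assms in \<open>auto intro!: always_eventually\<close>)
qed

text \<open>On a fine grid every cell contains at most one jump above \<epsilon>/8, so distinct
  jumps above \<epsilon>/2 lie in distinct cells. A cell without such a jump has an increment of
  size at most \<epsilon>/2 + \<epsilon>/4, where \<open>f\<close> vanishes. The grid sum thus
  reduces to a sum over a fixed finite set of jumps, and it converges term by term.\<close>

lemma cadlag_sum_jumps:
  fixes x :: "real \<Rightarrow> real"
  assumes x: "cadlag x" and s: "0 \<le> s" "s \<le> t" and \<epsilon>: "\<epsilon> > 0"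
    and f: "continuous_on UNIV f" "\<And>y. \<bar>y\<bar> \<le> \<epsilon> \<Longrightarrow> f y = (0::real)"
  shows "finite {r\<in>{s<..t}. \<bar>ljump x r\<bar> > \<epsilon> / 2}"
    and "(\<lambda>n. \<Sum>i<2 ^ n. f (x (grid s t n (Suc i)) - x (grid s t n i)))
       \<longlonglongrightarrow> (\<Sum>r\<in>{r\<in>{s<..t}. \<bar>ljump x r\<bar> > \<epsilon> / 2}. f (ljump x r))"
proof -
  define J where "J = {r\<in>{s<..t}. \<bar>ljump x r\<bar> > \<epsilon> / 2}"
  obtain \<delta> where \<delta>: "\<delta> > 0" 
    "\<And>p q. s \<le> p \<Longrightarrow> p < q \<Longrightarrow> q \<le> t \<Longrightarrow> q - p < \<delta> \<Longrightarrow>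
       \<exists>r\<in>{p<..q}. \<bar>x q - x p - ljump x r\<bar> \<le> 2 * (\<epsilon> / 8) \<and> (\<forall>r'\<in>{p<..q} - {r}. \<bar>ljump x r'\<bar> \<le> \<epsilon> / 8)"
    using cadlag_local[OF x s(1), of "\<epsilon> / 8" t] \<epsilon> by auto
  have "eventually (\<lambda>n. (t - s) / 2 ^ n < \<delta>) sequentially"
    using order_tendstoD(2)[OF mesh_tendsto_0 \<delta>(1)] .
  then obtain N where N: "\<And>n. n \<ge> N \<Longrightarrow> (t - s) / 2 ^ n < \<delta>" by (auto simp: eventually_sequentially)
  let ?g = "grid s t" and ?ix = "grid_index s t"
  have 1: "inj_on (?ix n) J" if n: "n \<ge> N" for n
  proof (rule inj_onI, rule ccontr)
    fix a b assume ab: "a \<in> J" "b \<in> J" "?ix n a = ?ix n b" "a \<noteq> b"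
    then have st: "s < t" "s < a" "a \<le> t" "s < b" "b \<le> t" by (auto simp: J_def)
    define i where "i = ?ix n a"
    have i: "i < 2 ^ n" "?g n i < a" "a \<le> ?g n (Suc i)" "?g n i < b" "b \<le> ?g n (Suc i)"
      using grid_index[of s a t n] grid_index[of s b t n] st ab(3) unfolding i_def by auto
    have "\<exists>r\<in>{?g n i<..?g n (Suc i)}. \<bar>x (?g n (Suc i)) - x (?g n i) - ljump x r\<bar> \<le> 2 * (\<epsilon> / 8) \<and> (\<forall>r'\<in>{?g n i<..?g n (Suc i)} - {r}. \<bar>ljump x r'\<bar> \<le> \<epsilon> / 8)"
      using i st grid_bounds[of s t i n] grid_bounds[of s t "Suc i" n] grid_diff[of s t n i] N[OF n] grid_less[of s t n i]
      by (intro \<delta>(2)) auto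
    then obtain r where "\<forall>r'\<in>{?g n i<..?g n (Suc i)} - {r}. \<bar>ljump x r'\<bar> \<le> \<epsilon> / 8" by blast
    then have "\<bar>ljump x a\<bar> \<le> \<epsilon> / 8 \<or> \<bar>ljump x b\<bar> \<le> \<epsilon> / 8" using i ab(4) by (cases "a = r") auto
    then show False using ab \<epsilon> by (auto simp: J_def)
  qed
  have ixlt: "?ix n ` J \<subseteq> {..<2 ^ n}" for n using grid_index(1)[of s _ t n] by (auto simp: J_def)
  \<comment> \<open>The cell index embeds the jumps into a finite set of indices.\<close>
  show fin: "finite {r\<in>{s<..t}. \<bar>ljump x r\<bar> > \<epsilon> / 2}"
    using 1[of N] ixlt[of N] finite_imageD[of "?ix N" J] finite_subset unfolding J_def by blast
  have 2: "(\<Sum>i<2 ^ n. f (x (?g n (Suc i)) - x (?g n i))) = (\<Sum>r\<in>J. f (x (?g n (Suc (?ix n r))) - x (?g n (?ix n r))))"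
    if n: "n \<ge> N" for n
  proof (cases "s = t")
    case True
    then have "J = {}" by (auto simp: J_def)
    moreover have "f 0 = 0" using f(2)[of 0] \<epsilon> by simp
    ultimately show ?thesis using True by (simp add: grid_def)
  next
    case False
    then have st: "s < t" using s by simp
    have "f (x (?g n (Suc i)) - x (?g n i)) = 0" if i: "i \<in> {..<2 ^ n} - ?ix n ` J" for i
    proof -
      have "\<exists>r\<in>{?g n i<..?g n (Suc i)}. \<bar>x (?g n (Suc i)) - x (?g n i) - ljump x r\<bar> \<le> 2 * (\<epsilon> / 8) \<and> (\<forall>r'\<in>{?g n i<..?g n (Suc i)} - {r}. \<bar>ljump x r'\<bar> \<le> \<epsilon> / 8)"
        using i st grid_bounds[of s t i n] grid_bounds[of s t "Suc i" n] grid_diff[of s t n i] N[OF n] grid_less[of s t n i]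
        by (intro \<delta>(2)) auto
      then obtain r where r: "r\<in>{?g n i<..?g n (Suc i)}" "\<bar>x (?g n (Suc i)) - x (?g n i) - ljump x r\<bar> \<le> 2 * (\<epsilon> / 8)" by blast
      have "?ix n r = i" using r i st by (intro grid_index_eq) auto
      then have "r \<notin> J" using i by auto
      moreover have "s < r" "r \<le> t" using r i grid_bounds[of s t i n] grid_bounds[of s t "Suc i" n] st by auto
      ultimately have "\<bar>ljump x r\<bar> \<le> \<epsilon> / 2" by (auto simp: J_def)
      then show ?thesis using r \<epsilon> by (intro f(2)) linarith
    qed
    then have "(\<Sum>i<2 ^ n. f (x (?g n (Suc i)) - x (?g n i))) = (\<Sum>i\<in>?ix n ` J. f (x (?g n (Suc i)) - x (?g n i)))"
      using ixlt[of n] by (intro sum.mono_neutral_right) auto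
    also have "\<dots> = (\<Sum>r\<in>J. f (x (?g n (Suc (?ix n r))) - x (?g n (?ix n r))))"
      by (subst sum.reindex[OF 1[OF n]]) simp
    finally show ?thesis .
  qed
  have "(\<lambda>n. \<Sum>r\<in>J. f (x (?g n (Suc (?ix n r))) - x (?g n (?ix n r)))) \<longlonglongrightarrow> (\<Sum>r\<in>J. f (x r - Lim (at_left r) x))"
  proof (intro tendsto_sum)
    fix r assume "r \<in> J"
    then have "s < r" "r \<le> t" by (auto simp: J_def)
    then have "(\<lambda>n. x (?g n (Suc (?ix n r))) - x (?g n (?ix n r))) \<longlonglongrightarrow> x r - Lim (at_left r) x"
      using x s by (intro tendsto_diff cadlag_grid_left cadlag_grid_right) auto
    moreover have "isCont f (x r - Lim (at_left r) x)"
      using f(1) by (simp add: continuous_on_eq_continuous_at)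
    ultimately show "(\<lambda>n. f (x (?g n (Suc (?ix n r))) - x (?g n (?ix n r)))) \<longlonglongrightarrow> f (x r - Lim (at_left r) x)"
      by (rule isCont_tendsto_compose[rotated])
  qed
  then show "(\<lambda>n. \<Sum>i<2 ^ n. f (x (grid s t n (Suc i)) - x (grid s t n i)))
       \<longlonglongrightarrow> (\<Sum>r\<in>{r\<in>{s<..t}. \<bar>ljump x r\<bar> > \<epsilon> / 2}. f (ljump x r))"
    unfolding ljump_def[symmetric] J_def[symmetric]
    by (rule Lim_transform_eventually) (use 2 in \<open>auto simp: eventually_sequentially intro!: exI[of _ N]\<close>)
qed

section \<open>Sums over jumps as functionals of the path\<close>

text \<open>The product sigma-algebra that also appears in \<open>indep_of_process\<close>; a
  probability on it is determined by finitely many coordinates at a time.\<close>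

definition paths :: "(real \<Rightarrow> real) measure" where
  "paths = (\<Pi>\<^sub>M u\<in>{0..}. borel)"

text \<open>
  The truncation \<open>\<bar>z\<bar> - 1 / (k + 1)\<close> removes the increments over intervals without large jumps, so
  that the limit over the grids for fixed \<open>k\<close> does not see the continuous part of the path.
\<close>

definition jsum :: "(real \<Rightarrow> real) \<Rightarrow> (real \<Rightarrow> real) \<Rightarrow> real \<Rightarrow> real \<Rightarrow> ennreal" where
  "jsum \<phi> x s t = (SUP k::nat. liminf (\<lambda>n. \<Sum>i<2 ^ n.
     ennreal (\<phi> (max 0 (\<bar>x (grid s t n (Suc i)) - x (grid s t n i)\<bar> - 1 / real (Suc k))))))"

text \<open>On good paths this is the increment of the discrete quadratic variation over (s, t], but
  it is defined for every path and measurable; an infinite \<open>jsum\<close> is sent to 0.\<close>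

definition qvar :: "(real \<Rightarrow> real) \<Rightarrow> real \<Rightarrow> real \<Rightarrow> real" where
  "qvar x s t = enn2real (jsum (\<lambda>z. z\<^sup>2) x s t)"

lemma measurable_path_eval: "0 \<le> u \<Longrightarrow> (\<lambda>x. x u) \<in> borel_measurable paths"
  unfolding paths_def by measurable

lemma grid_nonneg: "0 \<le> s \<Longrightarrow> s \<le> t \<Longrightarrow> 0 \<le> grid s t n i"
  by (simp add: grid_def)

lemma measurable_jsum:
  assumes "0 \<le> s" "s \<le> t" "continuous_on UNIV \<phi>"
  shows "(\<lambda>x. jsum \<phi> x s t) \<in> borel_measurable paths"
proof -
  have [measurable]: "\<phi> \<in> borel_measurable borel" using assms by (intro borel_measurable_continuous_onI)
  have [measurable]: "(\<lambda>x. x (grid s t n i)) \<in> borel_measurable paths" for n i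
    using assms by (intro measurable_path_eval grid_nonneg)
  show ?thesis unfolding jsum_def by measurable
qed

lemma measurable_qvar [measurable]:
  assumes "0 \<le> s" "s \<le> t"
  shows "(\<lambda>x. qvar x s t) \<in> borel_measurable paths"
proof -
  have [measurable]: "(\<lambda>x. jsum (\<lambda>z. z\<^sup>2) x s t) \<in> borel_measurable paths"
    by (rule measurable_jsum[OF assms]) (intro continuous_intros)
  show ?thesis unfolding qvar_def by measurable
qed

text \<open>Only increments between grid points of [s, t] enter. Hence shifted paths have shifted
  jump sums, and the sum does not see the path after \<open>t\<close>.\<close>

lemma jsum_cong:
  assumes "\<And>n i. i \<le> 2 ^ n \<Longrightarrow> x (grid s t n i) = y (grid s' t' n i) + c"
  shows "jsum \<phi> x s t = jsum \<phi> y s' t'"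
  unfolding jsum_def by (simp add: assms)

text \<open>For fixed \<open>k\<close> the truncated function vanishes near 0, so
  \<open>cadlag_sum_jumps\<close> applies and the liminf is a limit. The truncated functions
  increase with \<open>k\<close>, and monotone convergence removes the truncation. Both sides may be
  infinite.\<close>

lemma jsum_eq:
  assumes x: "cadlag x" and s: "0 \<le> s" "s \<le> t"
    and \<phi>: "continuous_on UNIV \<phi>" "\<And>a b. 0 \<le> a \<Longrightarrow> a \<le> b \<Longrightarrow> \<phi> a \<le> \<phi> b" "\<phi> 0 = 0"
  shows "jsum \<phi> x s t = (\<integral>\<^sup>+r. ennreal (\<phi> \<bar>ljump x r\<bar>) \<partial>count_space {s<..t})"
proof -
  define f where "f k y = \<phi> (max 0 (\<bar>y\<bar> - 1 / real (Suc k)))" for k :: nat and y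
  have \<phi>0: "0 \<le> \<phi> a" if "0 \<le> a" for a using \<phi>(2)[of 0 a] \<phi>(3) that by simp
  have f0: "0 \<le> f k y" for k y unfolding f_def by (intro \<phi>0) simp
  have fc: "continuous_on UNIV (f k)" for k
    unfolding f_def by (intro continuous_on_compose2[OF \<phi>(1)] continuous_intros) auto
  have fz: "f k y = 0" if "\<bar>y\<bar> \<le> 1 / real (Suc k)" for k y
    using that \<phi>(3) by (simp add: f_def max_def)
  have fmono: "f k y \<le> f l y" if "k \<le> l" for k l y
  proof -
    have "1 / real (Suc l) \<le> 1 / real (Suc k)" using that by (intro divide_left_mono) auto
    then show ?thesis unfolding f_def by (intro \<phi>(2)) auto
  qed
  have lim: "liminf (\<lambda>n. \<Sum>i<2 ^ n. ennreal (f k (x (grid s t n (Suc i)) - x (grid s t n i))))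
     = (\<integral>\<^sup>+r. ennreal (f k (ljump x r)) \<partial>count_space {s<..t})" for k
  proof -
    let ?\<epsilon> = "1 / real (Suc k)"
    let ?J = "{r\<in>{s<..t}. \<bar>ljump x r\<bar> > ?\<epsilon> / 2}"
    have *: "finite ?J" "(\<lambda>n. \<Sum>i<2 ^ n. f k (x (grid s t n (Suc i)) - x (grid s t n i)))
       \<longlonglongrightarrow> (\<Sum>r\<in>?J. f k (ljump x r))"
      using cadlag_sum_jumps[OF x s _ fc[of k] fz, of ?\<epsilon>] by simp_all
    have "(\<lambda>n. \<Sum>i<2 ^ n. ennreal (f k (x (grid s t n (Suc i)) - x (grid s t n i))))
       \<longlonglongrightarrow> ennreal (\<Sum>r\<in>?J. f k (ljump x r))"
      using tendsto_ennrealI[OF *(2)] by (simp add: sum_ennreal f0)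
    then have "liminf (\<lambda>n. \<Sum>i<2 ^ n. ennreal (f k (x (grid s t n (Suc i)) - x (grid s t n i))))
        = ennreal (\<Sum>r\<in>?J. f k (ljump x r))"
      by (intro lim_imp_Liminf) auto
    also have "\<dots> = (\<Sum>r\<in>?J. ennreal (f k (ljump x r)))" by (simp add: sum_ennreal f0)
    also have "\<dots> = (\<integral>\<^sup>+r. ennreal (f k (ljump x r)) \<partial>count_space {s<..t})"
    proof (rule nn_integral_count_space'[symmetric, OF *(1)])
      fix r assume "r \<in> {s<..t}" "r \<notin> ?J"
      then have "\<bar>ljump x r\<bar> \<le> ?\<epsilon> / 2" by auto
      then have "\<bar>ljump x r\<bar> \<le> ?\<epsilon>" by (rule order_trans) (simp add: field_simps)
      then show "ennreal (f k (ljump x r)) = 0" by (simp add: fz)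
    qed auto
    finally show ?thesis .
  qed
  have sup: "(SUP k. ennreal (f k y)) = ennreal (\<phi> \<bar>y\<bar>)" for y
  proof (rule LIMSEQ_unique)
    show "(\<lambda>k. ennreal (f k y)) \<longlonglongrightarrow> (SUP k. ennreal (f k y))"
      by (intro LIMSEQ_SUP incseq_SucI ennreal_leI fmono) auto
    have "(\<lambda>k. max 0 (\<bar>y\<bar> - 1 / real (Suc k))) \<longlonglongrightarrow> max 0 (\<bar>y\<bar> - 0)"
      by (intro tendsto_intros LIMSEQ_Suc[OF lim_1_over_n])
    moreover have "isCont \<phi> (max 0 (\<bar>y\<bar> - 0))" using \<phi>(1) by (simp add: continuous_on_eq_continuous_at)
    ultimately have "(\<lambda>k. \<phi> (max 0 (\<bar>y\<bar> - 1 / real (Suc k)))) \<longlonglongrightarrow> \<phi> (max 0 (\<bar>y\<bar> - 0))"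
      by (rule isCont_tendsto_compose[rotated])
    then show "(\<lambda>k. ennreal (f k y)) \<longlonglongrightarrow> ennreal (\<phi> \<bar>y\<bar>)"
      unfolding f_def by (intro tendsto_ennrealI) simp
  qed
  have "jsum \<phi> x s t = (SUP k. \<integral>\<^sup>+r. ennreal (f k (ljump x r)) \<partial>count_space {s<..t})"
    unfolding lim[symmetric] by (simp add: jsum_def f_def)
  also have "\<dots> = (\<integral>\<^sup>+r. (SUP k. ennreal (f k (ljump x r))) \<partial>count_space {s<..t})"
    by (intro nn_integral_monotone_convergence_SUP[symmetric] incseq_SucI le_funI ennreal_leI fmono) auto
  finally show ?thesis unfolding sup .
qed

section \<open>Squared jumps of a path and their accumulation in time\<close>

definition sq_jumps :: "(real \<Rightarrow> real) \<Rightarrow> real \<Rightarrow> real" where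
  "sq_jumps x t = (\<Sum>\<^sub>\<infinity>r\<in>{0<..t}. (ljump x r)\<^sup>2)"

lemma disc_qv_eq: "disc_qv L t \<omega> = sq_jumps (\<lambda>t. L t \<omega>) t"
  by (simp add: disc_qv_def sq_jumps_def jump_eq_ljump)

text \<open>\<open>infsum\<close> is 0 on families that are not summable, so \<open>sq_jumps\<close>
  has its intended meaning only together with this summability.\<close>

definition good_path :: "(real \<Rightarrow> real) \<Rightarrow> bool" where
  "good_path x \<longleftrightarrow> cadlag x \<and> (\<forall>t. (\<lambda>r. (ljump x r)\<^sup>2) summable_on {0<..t})"

lemma nn_integral_count_space_infsum:
  fixes f :: "'a \<Rightarrow> real"
  assumes "f summable_on A" "\<And>a. a \<in> A \<Longrightarrow> 0 \<le> f a"
  shows "(\<integral>\<^sup>+a. ennreal (f a) \<partial>count_space A) = ennreal (infsum f A)"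
proof -
  have abs: "(\<lambda>a. norm (f a)) summable_on A"
    using assms summable_on_cong[of A "\<lambda>a. norm (f a)" f] by simp
  then have "integrable (count_space A) f"
    using abs_summable_equivalent[of f A] by (simp add: Infinite_Set_Sum.abs_summable_on_def)
  then have "(\<integral>\<^sup>+a. ennreal (f a) \<partial>count_space A) = ennreal (\<integral>a. f a \<partial>count_space A)"
    using assms by (intro nn_integral_eq_integral) (auto simp: AE_count_space)
  also have "(\<integral>a. f a \<partial>count_space A) = infsum f A"
    using infsetsum_infsum[OF abs_summable_equivalent[THEN iffD1, OF abs]] by (simp add: infsetsum_def)
  finally show ?thesis .
qed

lemma nn_integral_count_space_mono:
  "A \<subseteq> B \<Longrightarrow> (\<integral>\<^sup>+a. f a \<partial>count_space A) \<le> (\<integral>\<^sup>+a. f a \<partial>count_space B)"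
proof -
  assume "A \<subseteq> B"
  have *: "(\<integral>\<^sup>+a. f a \<partial>count_space X) = (\<integral>\<^sup>+a. f a * indicator X a \<partial>count_space UNIV)" for X
    by (cases "X = UNIV") (auto simp: nn_integral_count_space_indicator)
  show ?thesis unfolding *
    using \<open>A \<subseteq> B\<close> by (intro nn_integral_mono) (auto split: split_indicator)
qed

lemma nn_integral_count_space_Un:
  fixes f :: "'a \<Rightarrow> ennreal"
  assumes "A \<inter> B = {}"
  shows "(\<integral>\<^sup>+a. f a \<partial>count_space (A \<union> B)) = (\<integral>\<^sup>+a. f a \<partial>count_space A) + (\<integral>\<^sup>+a. f a \<partial>count_space B)"
proof -
  have *: "(\<integral>\<^sup>+a. f a \<partial>count_space X) = (\<integral>\<^sup>+a. f a * indicator X a \<partial>count_space UNIV)" for X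
    by (cases "X = UNIV") (auto simp: nn_integral_count_space_indicator)
  show ?thesis unfolding *
    using assms by (subst nn_integral_add[symmetric]) (auto intro!: nn_integral_cong split: split_indicator)
qed

text \<open>Induction with \<open>1 + c * (u + v) <= (1 + c * u) * (1 + c * v)\<close> for
  nonnegative \<open>u\<close> and \<open>v\<close>.\<close>

lemma ln_sum_subadditive:
  assumes "finite F" "\<And>a. a \<in> F \<Longrightarrow> 0 \<le> w a" "0 \<le> (c::real)"
  shows "ln (1 + c * sum w F) \<le> (\<Sum>a\<in>F. ln (1 + c * w a))"
  using assms
proof (induction F rule: finite_induct)
  case (insert b F)
  have nn: "0 \<le> c * w b" "0 \<le> c * sum w F" using insert.prems by (auto intro!: mult_nonneg_nonneg sum_nonneg)
  have "ln (1 + c * sum w (insert b F)) \<le> ln ((1 + c * w b) * (1 + c * sum w F))"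
    using nn insert.hyps mult_nonneg_nonneg[OF nn] by (intro ln_mono) (auto simp: algebra_simps)
  also have "\<dots> = ln (1 + c * w b) + ln (1 + c * sum w F)"
    using nn by (intro ln_mult_pos) auto
  also have "\<dots> \<le> (\<Sum>a\<in>insert b F. ln (1 + c * w a))"
    using insert by simp
  finally show ?case .
qed simp

text \<open>The bound on the logarithms limits every finite sum of \<open>w\<close> to
  \<open>(exp b - 1) / c\<close>. Summability and the estimate for the infinite sum both follow from
  this uniform bound.\<close>

lemma ln_infsum_subadditive:
  fixes w :: "'a \<Rightarrow> real"
  assumes w: "\<And>a. a \<in> A \<Longrightarrow> 0 \<le> w a" and c: "0 < c" and b: "0 \<le> b"
    and int: "(\<integral>\<^sup>+a. ennreal (ln (1 + c * w a)) \<partial>count_space A) \<le> ennreal b"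
  shows "w summable_on A" "ln (1 + c * infsum w A) \<le> b"
proof -
  have fin: "sum w F \<le> (exp b - 1) / c" if F: "finite F" "F \<subseteq> A" for F
  proof -
    have nn: "0 \<le> w a" if "a \<in> F" for a using w F that by auto
    have "ennreal (\<Sum>a\<in>F. ln (1 + c * w a)) = (\<Sum>a\<in>F. ennreal (ln (1 + c * w a)))"
      using nn c by (intro sum_ennreal[symmetric]) auto
    also have "\<dots> = (\<integral>\<^sup>+a. ennreal (ln (1 + c * w a)) \<partial>count_space F)"
      using F by (simp add: nn_integral_count_space_finite)
    also have "\<dots> \<le> ennreal b" using nn_integral_count_space_mono[OF F(2)] int order_trans by blast
    finally have "(\<Sum>a\<in>F. ln (1 + c * w a)) \<le> b" using b by simp
    then have "ln (1 + c * sum w F) \<le> b" using ln_sum_subadditive[of F w c] nn F c by simp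
    moreover have "0 < 1 + c * sum w F" using nn c by (intro add_pos_nonneg) (auto intro!: mult_nonneg_nonneg sum_nonneg)
    ultimately have "1 + c * sum w F \<le> exp b" by (metis exp_ln exp_le_cancel_iff)
    then show ?thesis using c by (simp add: field_simps)
  qed
  show sm: "w summable_on A"
    by (rule nonneg_bdd_above_summable_on) (use w fin in \<open>auto intro!: bdd_aboveI2\<close>)
  have "infsum w A \<le> (exp b - 1) / c"
    by (rule infsum_le_finite_sums[OF sm]) (use fin in auto)
  then have "1 + c * infsum w A \<le> exp b" using c by (simp add: field_simps)
  moreover have "0 < 1 + c * infsum w A" using w c by (intro add_pos_nonneg) (auto intro!: mult_nonneg_nonneg infsum_nonneg)
  ultimately show "ln (1 + c * infsum w A) \<le> b" by (metis ln_exp ln_mono)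
qed

lemma good_pathD:
  assumes "good_path x"
  shows "cadlag x" "(\<lambda>r. (ljump x r)\<^sup>2) summable_on {0<..t}"
    "0 \<le> s \<Longrightarrow> (\<lambda>r. (ljump x r)\<^sup>2) summable_on {s<..t}"
proof -
  show "cadlag x" and 1: "(\<lambda>r. (ljump x r)\<^sup>2) summable_on {0<..t}" using assms by (auto simp: good_path_def)
  show "0 \<le> s \<Longrightarrow> (\<lambda>r. (ljump x r)\<^sup>2) summable_on {s<..t}"
    by (rule summable_on_subset_banach[OF 1]) auto
qed

lemma sq_jumps_diff:
  assumes x: "good_path x" and s: "0 \<le> s" "s \<le> t"
  shows "sq_jumps x t - sq_jumps x s = (\<Sum>\<^sub>\<infinity>r\<in>{s<..t}. (ljump x r)\<^sup>2)"
proof -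
  have "{0<..t} = {0<..s} \<union> {s<..t}" using s by auto
  then have "sq_jumps x t = sq_jumps x s + (\<Sum>\<^sub>\<infinity>r\<in>{s<..t}. (ljump x r)\<^sup>2)"
    unfolding sq_jumps_def using good_pathD[OF x] s by (auto intro!: infsum_Un_disjoint)
  then show ?thesis by simp
qed

lemma sq_jumps_neg: "t \<le> 0 \<Longrightarrow> sq_jumps x t = 0"
  by (simp add: sq_jumps_def)

lemma sq_jumps_mono:
  assumes x: "good_path x" and "s \<le> t"
  shows "sq_jumps x s \<le> sq_jumps x t"
  unfolding sq_jumps_def
  by (rule infsum_mono2) (use good_pathD[OF x] assms in auto)

lemma jsum_square_eq:
  assumes x: "good_path x" and s: "0 \<le> s" "s \<le> t"
  shows "jsum (\<lambda>z. z\<^sup>2) x s t = ennreal (sq_jumps x t - sq_jumps x s)"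
proof -
  have "jsum (\<lambda>z. z\<^sup>2) x s t = (\<integral>\<^sup>+r. ennreal (\<bar>ljump x r\<bar>\<^sup>2) \<partial>count_space {s<..t})"
    using good_pathD(1)[OF x] s by (intro jsum_eq continuous_intros) (auto intro: power_mono)
  also have "\<dots> = ennreal (\<Sum>\<^sub>\<infinity>r\<in>{s<..t}. (ljump x r)\<^sup>2)"
    using good_pathD(3)[OF x s(1)] by (subst nn_integral_count_space_infsum) auto
  finally show ?thesis by (simp add: sq_jumps_diff[OF x s])
qed

lemma qvar_eq:
  assumes x: "good_path x" and s: "0 \<le> s" "s \<le> t"
  shows "qvar x s t = sq_jumps x t - sq_jumps x s"
  using sq_jumps_mono[OF x s(2)] by (simp add: qvar_def jsum_square_eq[OF assms])

text \<open>Outside a large finite set all partial families have small sums, uniformly in the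
  family. This is the source of the one-sided limits of the accumulated squared jumps.\<close>

lemma small_tail:
  fixes w :: "'a \<Rightarrow> real"
  assumes w: "w summable_on A" "\<And>a. a \<in> A \<Longrightarrow> 0 \<le> w a" and \<epsilon>: "0 < \<epsilon>"
  obtains F where "finite F" "F \<subseteq> A" "\<And>B. B \<subseteq> A - F \<Longrightarrow> infsum w B < \<epsilon>"
proof -
  have "eventually (\<lambda>F. dist (sum w F) (infsum w A) < \<epsilon>) (finite_subsets_at_top A)"
    using infsum_tendsto[OF w(1)] \<epsilon> by (rule tendstoD)
  then obtain F where F: "finite F" "F \<subseteq> A" "dist (sum w F) (infsum w A) < \<epsilon>"
    unfolding eventually_finite_subsets_at_top by blast
  show ?thesis
  proof (rule that[OF F(1,2)])
    fix B assume B: "B \<subseteq> A - F"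
    have sB: "w summable_on B" by (rule summable_on_subset_banach[OF w(1)]) (use B in auto)
    have "infsum w F + infsum w B = infsum w (F \<union> B)"
      using F B sB by (intro infsum_Un_disjoint[symmetric]) auto
    also have "\<dots> \<le> infsum w A"
      by (rule infsum_mono2) (use w F B sB in \<open>auto intro!: summable_on_Un_disjoint\<close>)
    finally show "infsum w B < \<epsilon>" using F by (simp add: dist_real_def)
  qed
qed

lemma sq_jumps_right_cont:
  assumes x: "good_path x"
  shows "continuous (at_right t) (sq_jumps x)"
proof (cases "t < 0")
  case True
  have "eventually (\<lambda>s. sq_jumps x s = 0) (at_right t)"
    unfolding eventually_at_right_field using True sq_jumps_neg by (intro exI[of _ 0]) auto
  then show ?thesis unfolding continuous_within using True sq_jumps_neg[of t x]
    by (simp add: tendsto_cong)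
next
  case False
  show ?thesis unfolding continuous_within
  proof (rule tendstoI)
    fix \<epsilon> :: real assume "0 < \<epsilon>"
    obtain F where F: "finite F" "F \<subseteq> {t<..t+1}" "\<And>B. B \<subseteq> {t<..t+1} - F \<Longrightarrow> (\<Sum>\<^sub>\<infinity>r\<in>B. (ljump x r)\<^sup>2) < \<epsilon>"
      using small_tail[OF good_pathD(3)[OF x, of t "t + 1"] _ \<open>0 < \<epsilon>\<close>] False by auto
    \<comment> \<open>Strictly between \<open>t\<close> and \<open>b\<close> there is no point of
      the finite exceptional set; \<open>t + 1\<close> covers the case that this set is
      empty.\<close>
    define b where "b = Min (insert (t + 1) F)"
    have b: "t < b" "b \<le> t + 1" "\<And>r. r \<in> F \<Longrightarrow> b \<le> r" using F by (auto simp: b_def)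
    show "eventually (\<lambda>s. dist (sq_jumps x s) (sq_jumps x t) < \<epsilon>) (at_right t)"
      unfolding eventually_at_right_field
    proof (intro exI[of _ b] conjI allI impI)
      fix s assume s: "t < s" "s < b"
      have "(\<Sum>\<^sub>\<infinity>r\<in>{t<..s}. (ljump x r)\<^sup>2) < \<epsilon>" using F(3)[of "{t<..s}"] s b by fastforce
      then show "dist (sq_jumps x s) (sq_jumps x t) < \<epsilon>"
        using sq_jumps_diff[OF x, of t s] sq_jumps_mono[OF x, of t s] False s by (simp add: dist_real_def)
    qed (rule b)
  qed
qed

lemma sq_jumps_left_lim:
  assumes x: "good_path x" and t: "0 < t"
  shows "(sq_jumps x \<longlongrightarrow> sq_jumps x t - (ljump x t)\<^sup>2) (at_left t)"
proof (rule tendstoI)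
  fix \<epsilon> :: real assume "0 < \<epsilon>"
  obtain F where F: "finite F" "F \<subseteq> {0<..t}" "\<And>B. B \<subseteq> {0<..t} - F \<Longrightarrow> (\<Sum>\<^sub>\<infinity>r\<in>B. (ljump x r)\<^sup>2) < \<epsilon>"
    using small_tail[OF good_pathD(2)[OF x, of t] _ \<open>0 < \<epsilon>\<close>] by auto
  \<comment> \<open>The point \<open>t\<close> may belong to \<open>F\<close> and is taken out,
    since its term is exactly the gap between the left limit and the value at
    \<open>t\<close>.\<close>
  define b where "b = Max (insert 0 (F - {t}))"
  have b: "b < t" "0 \<le> b" "\<And>r. r \<in> F - {t} \<Longrightarrow> r \<le> b" 
  proof -
    have "finite (insert 0 (F - {t}))" using F by simp
    then have "b \<in> insert 0 (F - {t})" unfolding b_def by (intro Max_in) auto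
    then show "b < t" using F t by (force simp: less_le)
  qed (use F in \<open>auto simp: b_def\<close>)
  show "eventually (\<lambda>s. dist (sq_jumps x s) (sq_jumps x t - (ljump x t)\<^sup>2) < \<epsilon>) (at_left t)"
    unfolding eventually_at_left_field
  proof (intro exI[of _ b] conjI allI impI)
    fix s assume s: "b < s" "s < t"
    have sm: "(\<lambda>r. (ljump x r)\<^sup>2) summable_on {s<..<t}"
      by (rule summable_on_subset_banach[OF good_pathD(2)[OF x, of t]]) (use s b in auto)
    have "(\<Sum>\<^sub>\<infinity>r\<in>{s<..<t}. (ljump x r)\<^sup>2) < \<epsilon>" by (rule F(3)) (use s b in fastforce)
    moreover have "{s<..t} = {s<..<t} \<union> {t}" using s by auto
    then have "(\<Sum>\<^sub>\<infinity>r\<in>{s<..t}. (ljump x r)\<^sup>2) = (\<Sum>\<^sub>\<infinity>r\<in>{s<..<t}. (ljump x r)\<^sup>2) + (ljump x t)\<^sup>2"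
      using infsum_Un_disjoint[OF sm, of "{t}"] by simp
    moreover have "0 \<le> (\<Sum>\<^sub>\<infinity>r\<in>{s<..<t}. (ljump x r)\<^sup>2)" by (rule infsum_nonneg) simp
    ultimately show "dist (sq_jumps x s) (sq_jumps x t - (ljump x t)\<^sup>2) < \<epsilon>"
      using sq_jumps_diff[OF x, of s t] s b by (simp add: dist_real_def)
  qed (rule b)
qed

lemma continuous_ln_square: "0 < c \<Longrightarrow> continuous_on UNIV (\<lambda>z::real. ln (1 + c * z\<^sup>2))"
  by (intro continuous_intros) (smt (verit) mult_nonneg_nonneg zero_le_power2)

lemma jsum_ln_eq:
  assumes "cadlag x" "0 \<le> s" "s \<le> t" "0 < c"
  shows "jsum (\<lambda>z. ln (1 + c * z\<^sup>2)) x s t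
    = (\<integral>\<^sup>+r. ennreal (ln (1 + c * (ljump x r)\<^sup>2)) \<partial>count_space {s<..t})"
proof -
  have "jsum (\<lambda>z. ln (1 + c * z\<^sup>2)) x s t = (\<integral>\<^sup>+r. ennreal (ln (1 + c * \<bar>ljump x r\<bar>\<^sup>2)) \<partial>count_space {s<..t})"
  proof (rule jsum_eq[OF assms(1-3) continuous_ln_square[OF assms(4)]])
    fix a b :: real assume "0 \<le> a" "a \<le> b"
    then have "a\<^sup>2 \<le> b\<^sup>2" by (intro power_mono)
    then show "ln (1 + c * a\<^sup>2) \<le> ln (1 + c * b\<^sup>2)"
      using assms(4) by (intro ln_mono) (auto intro!: add_pos_nonneg)
  qed simp
  then show ?thesis by simp
qed

text \<open>Subadditivity bounds each cell by the logarithmic sum over the jumps inside it, and the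
  cells are disjoint. The bound does not depend on \<open>n\<close>, so it survives the limit of the
  Euler schemes.\<close>

lemma sum_ln_qvar_le:
  assumes x: "good_path x" and s: "0 \<le> s" "s \<le> t" and c: "0 < c"
    and fin: "jsum (\<lambda>z. ln (1 + c * z\<^sup>2)) x s t < \<infinity>"
  shows "(\<Sum>i<2 ^ n. ln (1 + c * qvar x (grid s t n i) (grid s t n (Suc i))))
    \<le> enn2real (jsum (\<lambda>z. ln (1 + c * z\<^sup>2)) x s t)"
proof -
  let ?W = "\<lambda>A. \<integral>\<^sup>+r. ennreal (ln (1 + c * (ljump x r)\<^sup>2)) \<partial>count_space A"
  let ?g = "grid s t n"
  have nn: "0 \<le> ln (1 + c * qvar x (?g i) (?g (Suc i)))" for i
    using c by (intro ln_ge_zero) (simp add: qvar_def)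
  have tot: "?W {s<..t} < \<infinity>" using fin jsum_ln_eq[OF good_pathD(1)[OF x] s c] by simp
  have "(\<Sum>i<j. ennreal (ln (1 + c * qvar x (?g i) (?g (Suc i))))) \<le> ?W {s<..?g j}" if "j \<le> 2 ^ n" for j
    using that
  proof (induction j)
    case (Suc j)
    have g: "s \<le> ?g j" "?g j \<le> ?g (Suc j)" "?g (Suc j) \<le> t"
      using grid_bounds[OF s(2), of j n] grid_bounds[OF s(2), of "Suc j" n] grid_mono[OF s(2), of j "Suc j" n] Suc.prems by auto
    have lt: "?W {?g j<..?g (Suc j)} < \<infinity>"
      by (rule le_less_trans[OF nn_integral_count_space_mono tot]) (use g in auto)
    have "ln (1 + c * (\<Sum>\<^sub>\<infinity>r\<in>{?g j<..?g (Suc j)}. (ljump x r)\<^sup>2)) \<le> enn2real (?W {?g j<..?g (Suc j)})"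
      by (rule ln_infsum_subadditive(2)) (use c lt in auto)
    moreover have "(\<Sum>\<^sub>\<infinity>r\<in>{?g j<..?g (Suc j)}. (ljump x r)\<^sup>2) = qvar x (?g j) (?g (Suc j))"
      using g s by (simp add: qvar_eq[OF x] sq_jumps_diff[OF x])
    ultimately have "ennreal (ln (1 + c * qvar x (?g j) (?g (Suc j)))) \<le> ?W {?g j<..?g (Suc j)}"
      using lt by (metis ennreal_enn2real ennreal_leI infinity_ennreal_def)
    moreover have "{s<..?g (Suc j)} = {s<..?g j} \<union> {?g j<..?g (Suc j)}" using g by auto
    then have "?W {s<..?g (Suc j)} = ?W {s<..?g j} + ?W {?g j<..?g (Suc j)}"
      by (simp add: nn_integral_count_space_Un)
    ultimately show ?case using Suc by (simp add: add_mono)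
  qed simp
  from this[of "2 ^ n"] have "ennreal (\<Sum>i<2 ^ n. ln (1 + c * qvar x (?g i) (?g (Suc i)))) \<le> ?W {s<..t}"
    using nn by (simp add: sum_ennreal)
  then have "enn2real (ennreal (\<Sum>i<2 ^ n. ln (1 + c * qvar x (?g i) (?g (Suc i))))) \<le> enn2real (?W {s<..t})"
    using tot by (intro enn2real_mono) auto
  then show ?thesis using nn by (simp add: sum_nonneg jsum_ln_eq[OF good_pathD(1)[OF x] s c])
qed

text \<open>Finite logarithmic sums over unit intervals suffice; there are countably many of them,
  so the hypothesis can be checked almost surely.\<close>

lemma good_pathI:
  assumes x: "cadlag x" and c: "0 < c"
    and fin: "\<And>k::nat. jsum (\<lambda>z. ln (1 + c * z\<^sup>2)) x (real k) (real k + 1) < \<infinity>"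
  shows "good_path x"
  unfolding good_path_def
proof (intro conjI x allI)
  fix t
  have 1: "(\<lambda>r. (ljump x r)\<^sup>2) summable_on {real k<..real k + 1}" for k
    by (rule ln_infsum_subadditive(1)[where c = c and b = "enn2real (jsum (\<lambda>z. ln (1 + c * z\<^sup>2)) x (real k) (real k + 1))"])
      (use fin[of k] c in \<open>auto simp: jsum_ln_eq[OF x _ _ c]\<close>)
  have "(\<lambda>r. (ljump x r)\<^sup>2) summable_on {0<..real n}" for n
  proof (induction n)
    case (Suc n)
    have "{0<..real (Suc n)} = {0<..real n} \<union> {real n<..real n + 1}" by auto
    moreover have "(\<lambda>r. (ljump x r)\<^sup>2) summable_on ({0<..real n} \<union> {real n<..real n + 1})"
      using Suc 1[of n] by (intro summable_on_Un_disjoint) auto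
    ultimately show ?case by simp
  qed simp
  from this[of "nat \<lceil>t\<rceil>"] show "(\<lambda>r. (ljump x r)\<^sup>2) summable_on {0<..t}"
    by (rule summable_on_subset_banach) (auto intro: order_trans[OF _ real_nat_ceiling_ge])
qed

section \<open>The Euler scheme\<close>

primrec euler :: "('e \<Rightarrow> 'e) \<Rightarrow> ('e \<Rightarrow> 'e) \<Rightarrow> real \<Rightarrow> (nat \<Rightarrow> real) \<Rightarrow> 'e::real_normed_vector \<Rightarrow> nat \<Rightarrow> 'e" where
  "euler f g h d y 0 = y"
| "euler f g h d y (Suc i) = euler f g h d y i + (h *\<^sub>R f (euler f g h d y i) + d i *\<^sub>R g (euler f g h d y i))"

text \<open>The integrator enters as a function \<open>d u v\<close> of two times, its increment
  over (u, v], so that both \<open>qvar x\<close> and the differences of an increasing function can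
  be inserted.\<close>

definition euler_grid ::
  "('e \<Rightarrow> 'e) \<Rightarrow> ('e \<Rightarrow> 'e) \<Rightarrow> (real \<Rightarrow> real \<Rightarrow> real) \<Rightarrow> real \<Rightarrow> real \<Rightarrow> nat \<Rightarrow> 'e::real_normed_vector \<Rightarrow> 'e" where
  "euler_grid f g d s t n y =
     euler f g ((t - s) / 2 ^ n) (\<lambda>i. d (grid s t n i) (grid s t n (Suc i))) y (2 ^ n)"

lemma prod_le_exp_sum:
  fixes q :: "nat \<Rightarrow> real"
  assumes "\<And>i. 0 \<le> q i"
  shows "(\<Prod>i<n. 1 + q i) \<le> exp (\<Sum>i<n. q i)"
  unfolding exp_sum[OF finite_lessThan]
  by (rule prod_mono) (use assms in \<open>auto simp: add_nonneg_nonneg\<close>)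

locale lipschitz_coeffs =
  fixes f g :: "'e::banach \<Rightarrow> 'e" and b :: real
  assumes b: "0 \<le> b"
    and f_lip: "\<And>y z. norm (f y - f z) \<le> b * norm (y - z)"
    and g_lip: "\<And>y z. norm (g y - g z) \<le> b * norm (y - z)"
    and f_growth: "\<And>y. norm (f y) \<le> b * (norm y + 1)"
    and g_growth: "\<And>y. norm (g y) \<le> b * (norm y + 1)"
begin

lemma comb_lip:
  assumes "0 \<le> h" "0 \<le> k"
  shows "norm ((h *\<^sub>R f y + k *\<^sub>R g y) - (h *\<^sub>R f z + k *\<^sub>R g z)) \<le> b * (h + k) * norm (y - z)"
proof -
  have "(h *\<^sub>R f y + k *\<^sub>R g y) - (h *\<^sub>R f z + k *\<^sub>R g z) = h *\<^sub>R (f y - f z) + k *\<^sub>R (g y - g z)"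
    by (simp add: algebra_simps)
  also have "norm \<dots> \<le> h * norm (f y - f z) + k * norm (g y - g z)"
    using norm_triangle_ineq[of "h *\<^sub>R (f y - f z)" "k *\<^sub>R (g y - g z)"] assms by simp
  also have "\<dots> \<le> h * (b * norm (y - z)) + k * (b * norm (y - z))"
    using assms by (intro add_mono mult_left_mono f_lip g_lip)
  finally show ?thesis by (simp add: algebra_simps)
qed

lemma comb_growth:
  assumes "0 \<le> h" "0 \<le> k"
  shows "norm (h *\<^sub>R f y + k *\<^sub>R g y) \<le> b * (h + k) * (norm y + 1)"
proof -
  have "norm (h *\<^sub>R f y + k *\<^sub>R g y) \<le> h * norm (f y) + k * norm (g y)"
    using norm_triangle_ineq[of "h *\<^sub>R f y" "k *\<^sub>R g y"] assms by simp
  also have "\<dots> \<le> h * (b * (norm y + 1)) + k * (b * (norm y + 1))"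
    using assms by (intro add_mono mult_left_mono f_growth g_growth)
  finally show ?thesis by (simp add: algebra_simps)
qed

lemma step_lip:
  assumes "0 \<le> h" "0 \<le> k"
  shows "norm ((y + (h *\<^sub>R f y + k *\<^sub>R g y)) - (z + (h *\<^sub>R f z + k *\<^sub>R g z))) \<le> (1 + b * (h + k)) * norm (y - z)"
proof -
  have "(y + (h *\<^sub>R f y + k *\<^sub>R g y)) - (z + (h *\<^sub>R f z + k *\<^sub>R g z))
      = (y - z) + ((h *\<^sub>R f y + k *\<^sub>R g y) - (h *\<^sub>R f z + k *\<^sub>R g z))" by simp
  also have "norm \<dots> \<le> norm (y - z) + b * (h + k) * norm (y - z)"
    using norm_triangle_ineq comb_lip[OF assms] by (meson add_left_mono order_trans)
  finally show ?thesis by (simp add: algebra_simps)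
qed

lemma euler_lip:
  assumes "0 \<le> h" "\<And>i. 0 \<le> d i"
  shows "norm (euler f g h d y n - euler f g h d z n) \<le> (\<Prod>i<n. 1 + b * (h + d i)) * norm (y - z)"
proof (induction n)
  case (Suc n)
  have "norm (euler f g h d y (Suc n) - euler f g h d z (Suc n))
      \<le> (1 + b * (h + d n)) * norm (euler f g h d y n - euler f g h d z n)"
    unfolding euler.simps by (rule step_lip[OF assms])
  also have "\<dots> \<le> (1 + b * (h + d n)) * ((\<Prod>i<n. 1 + b * (h + d i)) * norm (y - z))"
    using b assms Suc by (intro mult_left_mono) auto
  finally show ?case by (simp add: algebra_simps)
qed simp

text \<open>Adding 1 to the norm makes the affine growth bound multiplicative, with the same step
  factors as in \<open>euler_lip\<close>.\<close>

lemma euler_growth: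
  assumes "0 \<le> h" "\<And>i. 0 \<le> d i"
  shows "norm (euler f g h d y n) + 1 \<le> (\<Prod>i<n. 1 + b * (h + d i)) * (norm y + 1)"
proof (induction n)
  case (Suc n)
  let ?w = "euler f g h d y n"
  have "norm (euler f g h d y (Suc n)) + 1 \<le> norm ?w + b * (h + d n) * (norm ?w + 1) + 1"
    unfolding euler.simps using norm_triangle_ineq comb_growth[OF assms] by (meson add_left_mono add_right_mono order_trans)
  also have "\<dots> = (1 + b * (h + d n)) * (norm ?w + 1)" by (simp add: algebra_simps)
  also have "\<dots> \<le> (1 + b * (h + d n)) * ((\<Prod>i<n. 1 + b * (h + d i)) * (norm y + 1))"
    using b assms Suc by (intro mult_left_mono) auto
  finally show ?case by (simp add: algebra_simps)
qed simp

text \<open>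
  The scalar products on the right increase under refinement and are bounded, so this estimate
  makes the Euler schemes a Cauchy sequence, without any solution being known to exist.
\<close>

lemma euler_refine:
  assumes h: "0 \<le> h" and "\<And>i. 0 \<le> d' i" "\<And>i. i < n \<Longrightarrow> d i = d' (2 * i) + d' (Suc (2 * i))"
  shows "norm (euler f g (h / 2) d' y (2 * n) - euler f g h d y n)
    \<le> ((\<Prod>i<2 * n. 1 + b * (h / 2 + d' i)) - (\<Prod>i<n. 1 + b * (h + d i))) * (norm y + 1)"
  using assms(2-)
proof (induction n)
  case (Suc n)
  note d = Suc.prems(1) Suc.prems(2)[of n, simplified]
  define u where "u = euler f g (h / 2) d' y (2 * n)"
  define v where "v = euler f g h d y n"
  define P where "P = (\<Prod>i<2 * n. 1 + b * (h / 2 + d' i))"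
  define Q where "Q = (\<Prod>i<n. 1 + b * (h + d i))"
  define k1 k2 where "k1 = d' (2 * n)" and "k2 = d' (Suc (2 * n))"
  define N1 where "N1 = (h / 2) *\<^sub>R f u + k1 *\<^sub>R g u"
  define N2 where "N2 w = (h / 2) *\<^sub>R f w + k2 *\<^sub>R g w" for w
  define N where "N w = h *\<^sub>R f w + d n *\<^sub>R g w" for w
  define q1 q2 where "q1 = b * (h / 2 + k1)" and "q2 = b * (h / 2 + k2)"
  have k: "0 \<le> k1" "0 \<le> k2" "d n = k1 + k2" using d by (auto simp: k1_def k2_def)
  have q: "0 \<le> q1" "0 \<le> q2" using k h b by (auto simp: q1_def q2_def)
  have IH: "norm (u - v) \<le> (P - Q) * (norm y + 1)" using Suc unfolding u_def v_def P_def Q_def by simp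
  have gr: "norm u + 1 \<le> P * (norm y + 1)" unfolding u_def P_def by (rule euler_growth) (use h d in auto)
  \<comment> \<open>Two half steps from \<open>u\<close> differ from one full step from
    \<open>u\<close> only because the second half step is taken at \<open>u + N1\<close> instead of
    \<open>u\<close>.\<close>
  have eq: "euler f g (h / 2) d' y (2 * Suc n) - euler f g h d y (Suc n) = ((u + N u) - (v + N v)) + (N2 (u + N1) - N2 u)"
  proof -
    have "h *\<^sub>R f u = (h / 2) *\<^sub>R f u + (h / 2) *\<^sub>R f u" by (simp flip: scaleR_add_left)
    then have "N u = N1 + N2 u" unfolding N_def N1_def N2_def k(3) by (simp add: scaleR_add_left)
    moreover have "euler f g (h / 2) d' y (2 * Suc n) = (u + N1) + N2 (u + N1)"
      unfolding u_def N1_def N2_def k1_def k2_def by simp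
    moreover have "euler f g h d y (Suc n) = v + N v" unfolding v_def N_def by simp
    ultimately show ?thesis by simp
  qed
  have "norm ((u + N u) - (v + N v)) \<le> (1 + (q1 + q2)) * norm (u - v)"
    using step_lip[of h "d n" u v] h k unfolding N_def q1_def q2_def by (simp add: algebra_simps)
  also have "\<dots> \<le> (1 + (q1 + q2)) * ((P - Q) * (norm y + 1))" using q IH by (intro mult_left_mono) auto
  finally have 1: "norm ((u + N u) - (v + N v)) \<le> (1 + (q1 + q2)) * (P - Q) * (norm y + 1)" by simp
  have "norm (N2 (u + N1) - N2 u) \<le> q2 * norm N1"
    using comb_lip[of "h / 2" k2 "u + N1" u] h k unfolding N2_def q2_def by simp
  also have "norm N1 \<le> q1 * (norm u + 1)"
    using comb_growth[of "h / 2" k1 u] h k unfolding N1_def q1_def by simp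
  also have "q1 * (norm u + 1) \<le> q1 * (P * (norm y + 1))" using q gr by (intro mult_left_mono)
  finally have 2: "norm (N2 (u + N1) - N2 u) \<le> q2 * q1 * P * (norm y + 1)" using q by (simp add: mult_left_mono)
  have "norm (euler f g (h / 2) d' y (2 * Suc n) - euler f g h d y (Suc n))
      \<le> (1 + (q1 + q2)) * (P - Q) * (norm y + 1) + q2 * q1 * P * (norm y + 1)"
    unfolding eq using norm_triangle_ineq 1 2 by (meson add_mono order_trans)
  \<comment> \<open>The correction \<open>q2 * q1 * P\<close> is exactly the cross term of
    \<open>(1 + q1) * (1 + q2)\<close>, so the error bound closes as a difference of two
    products.\<close>
  also have "\<dots> = (P * (1 + q1) * (1 + q2) - Q * (1 + (q1 + q2))) * (norm y + 1)"
    by (simp add: algebra_simps)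
  also have "P * (1 + q1) * (1 + q2) = (\<Prod>i<2 * Suc n. 1 + b * (h / 2 + d' i))"
    unfolding P_def q1_def q2_def k1_def k2_def by (simp add: algebra_simps)
  also have "Q * (1 + (q1 + q2)) = (\<Prod>i<Suc n. 1 + b * (h + d i))"
    unfolding Q_def q1_def q2_def k1_def k2_def by (simp add: d(2) algebra_simps)
  finally show ?case .
qed simp

lemma grid_prod_le:
  assumes st: "s \<le> t" and d: "\<And>u v. 0 \<le> d u v"
    and sum: "(\<Sum>i<2 ^ n. d (grid s t n i) (grid s t n (Suc i))) \<le> c"
  shows "(\<Prod>i<2 ^ n. 1 + b * ((t - s) / 2 ^ n + d (grid s t n i) (grid s t n (Suc i)))) \<le> exp (b * ((t - s) + c))"
proof -
  let ?q = "\<lambda>i. b * ((t - s) / 2 ^ n + d (grid s t n i) (grid s t n (Suc i)))"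
  have "(\<Prod>i<2 ^ n. 1 + ?q i) \<le> exp (\<Sum>i<2 ^ n. ?q i)"
    by (rule prod_le_exp_sum) (use d st b in \<open>auto intro!: add_nonneg_nonneg mult_nonneg_nonneg\<close>)
  also have "(\<Sum>i<2 ^ n. ?q i) = b * ((t - s) + (\<Sum>i<2 ^ n. d (grid s t n i) (grid s t n (Suc i))))"
    by (simp add: sum_distrib_left[symmetric] sum.distrib)
  also have "exp \<dots> \<le> exp (b * ((t - s) + c))"
    using b sum by (simp add: mult_left_mono)
  finally show ?thesis .
qed

end

definition additive_on :: "real \<Rightarrow> real \<Rightarrow> (real \<Rightarrow> real \<Rightarrow> real) \<Rightarrow> bool" where
  "additive_on s t d \<longleftrightarrow> (\<forall>u v. 0 \<le> d u v) \<and>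
     (\<forall>u v w. s \<le> u \<and> u \<le> v \<and> v \<le> w \<and> w \<le> t \<longrightarrow> d u w = d u v + d v w)"

lemma additive_on_sum_grid:
  assumes "additive_on s t d" "s \<le> t"
  shows "(\<Sum>i<2 ^ n. d (grid s t n i) (grid s t n (Suc i))) = d s t"
proof -
  have "(\<Sum>i<j. d (grid s t n i) (grid s t n (Suc i))) = d s (grid s t n j)" if "j \<le> 2 ^ n" for j
    using that
  proof (induction j)
    case 0
    \<comment> \<open>Additivity on a degenerate interval forces \<open>d s s = 0\<close>.\<close>
    have "d s s = d s s + d s s" using assms unfolding additive_on_def by (metis order_refl)
    then show ?case by simp
  next
    case (Suc j)
    have "d s (grid s t n (Suc j)) = d s (grid s t n j) + d (grid s t n j) (grid s t n (Suc j))"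
      using assms grid_bounds[OF assms(2), of j n] grid_bounds[OF assms(2), of "Suc j" n] grid_mono[OF assms(2), of j "Suc j" n] Suc.prems
      unfolding additive_on_def by auto
    then show ?case using Suc by simp
  qed
  from this[of "2 ^ n"] show ?thesis by simp
qed

context lipschitz_coeffs
begin

lemma euler_grid_lip:
  assumes "additive_on s t d" "s \<le> t"
  shows "norm (euler_grid f g d s t n y - euler_grid f g d s t n z) \<le> exp (b * ((t - s) + d s t)) * norm (y - z)"
proof -
  have d: "\<And>u v. 0 \<le> d u v" using assms by (auto simp: additive_on_def)
  have "norm (euler_grid f g d s t n y - euler_grid f g d s t n z)
     \<le> (\<Prod>i<2 ^ n. 1 + b * ((t - s) / 2 ^ n + d (grid s t n i) (grid s t n (Suc i)))) * norm (y - z)"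
    unfolding euler_grid_def by (rule euler_lip) (use assms d in auto)
  also have "\<dots> \<le> exp (b * ((t - s) + d s t)) * norm (y - z)"
    by (intro mult_right_mono grid_prod_le) (use assms d additive_on_sum_grid[OF assms] in auto)
  finally show ?thesis .
qed

end

text \<open>Successive schemes differ by at most the increments of the products \<open>p n\<close>,
  up to the factor \<open>norm y + 1\<close>. As \<open>p\<close> is increasing and bounded, these
  increments form a convergent telescoping series.\<close>

lemma (in lipschitz_coeffs) euler_grid_cauchy:
  assumes d: "additive_on s t d" and st: "s \<le> t"
  shows "summable (\<lambda>n. norm (euler_grid f g d s t (Suc n) y - euler_grid f g d s t n y))"
proof -
  have d0: "\<And>u v. 0 \<le> d u v" using d by (auto simp: additive_on_def)
  define p where "p n = (\<Prod>i<2 ^ n. 1 + b * ((t - s) / 2 ^ n + d (grid s t n i) (grid s t n (Suc i))))" for n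
  have step: "norm (euler_grid f g d s t (Suc n) y - euler_grid f g d s t n y) \<le> (p (Suc n) - p n) * (norm y + 1)" for n
  proof -
    have "norm (euler f g (((t - s) / 2 ^ n) / 2) (\<lambda>i. d (grid s t (Suc n) i) (grid s t (Suc n) (Suc i))) y (2 * 2 ^ n)
         - euler f g ((t - s) / 2 ^ n) (\<lambda>i. d (grid s t n i) (grid s t n (Suc i))) y (2 ^ n))
       \<le> ((\<Prod>i<2 * 2 ^ n. 1 + b * (((t - s) / 2 ^ n) / 2 + d (grid s t (Suc n) i) (grid s t (Suc n) (Suc i)))) -
          (\<Prod>i<2 ^ n. 1 + b * ((t - s) / 2 ^ n + d (grid s t n i) (grid s t n (Suc i))))) * (norm y + 1)"
    proof (rule euler_refine)
      fix i :: nat assume i: "i < 2 ^ n"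
      have e: "grid s t n i = grid s t (Suc n) (2 * i)" "grid s t n (Suc i) = grid s t (Suc n) (Suc (Suc (2 * i)))"
        using grid_refine[of s t n i] grid_refine[of s t n "Suc i"] by simp_all
      have "s \<le> grid s t (Suc n) (2 * i)" "grid s t (Suc n) (2 * i) \<le> grid s t (Suc n) (Suc (2 * i))"
        "grid s t (Suc n) (Suc (2 * i)) \<le> grid s t (Suc n) (Suc (Suc (2 * i)))" "grid s t (Suc n) (Suc (Suc (2 * i))) \<le> t"
        using grid_bounds[OF st, of "2 * i" "Suc n"] grid_bounds[OF st, of "Suc (Suc (2 * i))" "Suc n"] i
          grid_mono[OF st, of "2 * i" "Suc (2 * i)" "Suc n"] grid_mono[OF st, of "Suc (2 * i)" "Suc (Suc (2 * i))" "Suc n"]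
        by auto
      then show "d (grid s t n i) (grid s t n (Suc i)) = d (grid s t (Suc n) (2 * i)) (grid s t (Suc n) (Suc (2 * i)))
        + d (grid s t (Suc n) (Suc (2 * i))) (grid s t (Suc n) (Suc (Suc (2 * i))))"
        using d unfolding additive_on_def e by blast
    qed (use st d0 in auto)
    then show ?thesis unfolding p_def euler_grid_def by (simp add: mult.commute[of _ "2::real"])
  qed
  have "incseq p"
  proof (rule incseq_SucI)
    fix n
    \<comment> \<open>Monotonicity of \<open>p\<close> is read off from \<open>step\<close>, whose
      left side is a norm.\<close>
    have "0 \<le> (p (Suc n) - p n) * (norm y + 1)" using step[of n] norm_ge_zero order_trans by blast
    moreover have "0 < norm y + 1" using norm_ge_zero[of y] by linarith
    ultimately show "p n \<le> p (Suc n)" by (simp add: zero_le_mult_iff)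
  qed
  moreover have "p n \<le> exp (b * ((t - s) + d s t))" for n
    unfolding p_def by (rule grid_prod_le) (use st d0 additive_on_sum_grid[OF d st] in auto)
  ultimately have "convergent p" using incseq_convergent by (metis convergent_def)
  then obtain l where "p \<longlonglongrightarrow> l" unfolding convergent_def by blast
  then have "summable (\<lambda>n. (p (Suc n) - p n) * (norm y + 1))"
    by (intro summable_mult2 telescope_summable)
  then show ?thesis
    by (rule summable_comparison_test'[where N = 0]) (use step in auto)
qed

lemma (in lipschitz_coeffs) euler_grid_convergent:
  assumes "additive_on s t d" "s \<le> t"
  shows "convergent (\<lambda>n. euler_grid f g d s t n y)"
proof -
  let ?E = "\<lambda>n. euler_grid f g d s t n y"
  have "Cauchy ?E"
  proof (rule CauchyI)
    fix e :: real assume "0 < e"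
    then obtain N where N: "\<And>m n. N \<le> m \<Longrightarrow> norm (\<Sum>k=m..<n. norm (?E (Suc k) - ?E k)) < e"
      using euler_grid_cauchy[OF assms, of y] unfolding summable_Cauchy by blast
    have *: "norm (?E n - ?E m) < e" if "N \<le> m" "m \<le> n" for m n
    proof -
      have "norm (?E n - ?E m) = norm (\<Sum>k=m..<n. ?E (Suc k) - ?E k)"
        using that by (subst sum_Suc_diff') auto
      also have "\<dots> \<le> (\<Sum>k=m..<n. norm (?E (Suc k) - ?E k))" by (rule norm_sum)
      also have "\<dots> < e" using N[of m n] that by simp
      finally show ?thesis .
    qed
    show "\<exists>M. \<forall>m\<ge>M. \<forall>n\<ge>M. norm (?E m - ?E n) < e"
      using * by (intro exI[of _ N]) (metis linear norm_minus_commute)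
  qed
  then show ?thesis by (rule Cauchy_convergent)
qed

section \<open>Left limits of cadlag integrands\<close>

text \<open>One-sided limits bound the path near each point, and finitely many such neighbourhoods
  cover [0, t].\<close>

lemma cadlag_bounded:
  fixes y :: "real \<Rightarrow> 'b::real_normed_vector"
  assumes y: "cadlag y"
  obtains K where "\<And>r. 0 \<le> r \<Longrightarrow> r \<le> t \<Longrightarrow> norm (y r) \<le> K"
proof -
  have loc: "\<exists>U K. open U \<and> r \<in> U \<and> (\<forall>q\<in>U. 0 \<le> q \<longrightarrow> norm (y q) \<le> K)" if r: "0 \<le> r" for r
  proof -
    have "(y \<longlongrightarrow> y r) (at_right r)" using y r by (simp add: cadlag_def)
    then have "eventually (\<lambda>q. dist (y q) (y r) < 1) (at_right r)" by (rule tendstoD) simp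
    then obtain v where v: "r < v" "\<And>q. r < q \<Longrightarrow> q < v \<Longrightarrow> norm (y q - y r) < 1"
      unfolding eventually_at_right_field dist_norm by blast
    have "\<exists>u<r. \<exists>l. \<forall>q. 0 \<le> q \<and> u < q \<and> q < r \<longrightarrow> norm (y q - l) < 1"
    proof (cases "r = 0")
      case True then show ?thesis by (intro exI[of _ "-1"]) auto
    next
      case False
      then have "(y \<longlongrightarrow> Lim (at_left r) y) (at_left r)" using y r by (intro cadlag_left_lim) auto
      then have "eventually (\<lambda>q. dist (y q) (Lim (at_left r) y) < 1) (at_left r)" by (rule tendstoD) simp
      then show ?thesis unfolding eventually_at_left_field dist_norm by blast
    qed
    then obtain u l where u: "u < r" "\<And>q. 0 \<le> q \<Longrightarrow> u < q \<Longrightarrow> q < r \<Longrightarrow> norm (y q - l) < 1" by blast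
    have "norm (y q) \<le> norm (y r) + norm l + 1" if "u < q" "q < v" "0 \<le> q" for q
    proof -
      have tri: "norm (y q) \<le> norm c + norm (y q - c)" for c
        using norm_triangle_ineq[of c "y q - c"] by simp
      consider "q = r" | "r < q" | "q < r" by linarith
      then show ?thesis
      proof cases
        case 1 then show ?thesis by simp
      next
        case 2 then show ?thesis using v(2)[of q] tri[of "y r"] norm_ge_zero[of l] that by linarith
      next
        case 3 then show ?thesis using u(2)[of q] tri[of l] norm_ge_zero[of "y r"] that by linarith
      qed
    qed
    then show ?thesis using u(1) v(1) by (intro exI[of _ "{u<..<v}"] exI) auto
  qed
  then obtain U K where U: "\<And>r. 0 \<le> r \<Longrightarrow> open (U r)" "\<And>r. 0 \<le> r \<Longrightarrow> r \<in> U r"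
    and K: "\<And>r q. 0 \<le> r \<Longrightarrow> q \<in> U r \<Longrightarrow> 0 \<le> q \<Longrightarrow> norm (y q) \<le> (K r :: real)"
  proof -
    have "\<forall>r. \<exists>U K. 0 \<le> r \<longrightarrow> open U \<and> r \<in> U \<and> (\<forall>q\<in>U. 0 \<le> q \<longrightarrow> norm (y q) \<le> K)" using loc by blast
    then obtain U K where "\<forall>r. 0 \<le> r \<longrightarrow> open (U r) \<and> r \<in> U r \<and> (\<forall>q\<in>U r. 0 \<le> q \<longrightarrow> norm (y q) \<le> K r)"
      unfolding choice_iff by blast
    then show ?thesis by (intro that[of U K]) blast+
  qed
  obtain F where F: "F \<subseteq> {0..t}" "finite F" "{0..t} \<subseteq> (\<Union>r\<in>F. U r)"
    by (rule compactE_image[of "{0..t}" "{0..t}" U]) (use U in auto)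
  show thesis
  proof (rule that)
    fix r assume "0 \<le> r" "r \<le> t"
    then obtain q where q: "q \<in> F" "r \<in> U q" using F by auto
    then have "norm (y r) \<le> K q" using K[of q r] F \<open>0 \<le> r\<close> by auto
    also have "\<dots> \<le> Max (K ` F)" using F q by auto
    finally show "norm (y r) \<le> Max (K ` F)" .
  qed
qed

lemma cadlag_left_lim_bounded:
  fixes y :: "real \<Rightarrow> 'b::real_normed_vector"
  assumes y: "cadlag y" and K: "\<And>r. 0 \<le> r \<Longrightarrow> r \<le> t \<Longrightarrow> norm (y r) \<le> K" and r: "0 < r" "r \<le> t"
  shows "norm (Lim (at_left r) y) \<le> K"
proof -
  have "((\<lambda>q. norm (y q)) \<longlongrightarrow> norm (Lim (at_left r) y)) (at_left r)"
    using y r by (intro tendsto_norm cadlag_left_lim)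
  moreover have "eventually (\<lambda>q. norm (y q) \<le> K) (at_left r)"
    unfolding eventually_at_left_field using r K by (intro exI[of _ 0]) auto
  ultimately show ?thesis by (rule tendsto_upperbound) simp
qed

text \<open>The value at the left end of the cell containing \<open>r\<close>. This is where the
  Euler scheme freezes its coefficients, and for cadlag \<open>y\<close> it tends to the left limit
  at \<open>r\<close>.\<close>

abbreviation grid_step :: "(real \<Rightarrow> 'b) \<Rightarrow> real \<Rightarrow> real \<Rightarrow> nat \<Rightarrow> real \<Rightarrow> 'b" where
  "grid_step y s t n r \<equiv> y (grid s t n (grid_index s t n r))"

lemma grid_cells: 
  assumes "s \<le> t"
  shows "{s<..t} = (\<Union>i<2 ^ n. {grid s t n i<..grid s t n (Suc i)})"
proof (intro set_eqI iffI)
  fix r assume "r \<in> {s<..t}"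
  then show "r \<in> (\<Union>i<2 ^ n. {grid s t n i<..grid s t n (Suc i)})"
    using grid_index[of s r t n] by (intro UN_I[of "grid_index s t n r"]) auto
next
  fix r assume "r \<in> (\<Union>i<2 ^ n. {grid s t n i<..grid s t n (Suc i)})"
  then obtain i where "i < 2 ^ n" "grid s t n i < r" "r \<le> grid s t n (Suc i)" by auto
  then show "r \<in> {s<..t}" using grid_bounds[OF assms, of i n] grid_bounds[OF assms, of "Suc i" n] by simp
qed

text \<open>Rewriting as a finite sum of indicators gives measurability and integrability, although
  \<open>grid_index\<close> is defined by choice.\<close>

lemma indicator_grid_step:
  fixes y :: "real \<Rightarrow> 'b::real_vector"
  assumes "s \<le> t"
  shows "indicator {s<..t} r *\<^sub>R grid_step y s t n r
    = (\<Sum>i<2 ^ n. indicator {grid s t n i<..grid s t n (Suc i)} r *\<^sub>R y (grid s t n i))"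
proof (cases "r \<in> {s<..t}")
  case True
  let ?i = "grid_index s t n r"
  have i: "?i < 2 ^ n" "grid s t n ?i < r" "r \<le> grid s t n (Suc ?i)" using grid_index[of s r t n] True by auto
  have "(\<Sum>i<2 ^ n. indicator {grid s t n i<..grid s t n (Suc i)} r *\<^sub>R y (grid s t n i))
      = (\<Sum>i<2 ^ n. if i = ?i then y (grid s t n i) else 0)"
  proof (rule sum.cong[OF refl])
    fix j
    show "indicator {grid s t n j<..grid s t n (Suc j)} r *\<^sub>R y (grid s t n j) = (if j = ?i then y (grid s t n j) else 0)"
    proof (cases "j = ?i")
      case True
      then show ?thesis using i by simp
    next
      case False
      then have "r \<notin> {grid s t n j<..grid s t n (Suc j)}"
        using grid_index_unique[OF assms, of n j r ?i] i(2,3) by auto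
      then show ?thesis using False by simp
    qed
  qed
  then show ?thesis using True i(1) by simp
next
  case False
  then have "r \<notin> {grid s t n i<..grid s t n (Suc i)}" if "i < 2 ^ n" for i
    using grid_cells[OF assms, of n] that by blast
  then show ?thesis using False by simp
qed

lemma grid_step_measurable:
  fixes y :: "real \<Rightarrow> 'b::euclidean_space"
  assumes "s \<le> t" "sets \<mu> = sets borel"
  shows "(\<lambda>r. indicator {s<..t} r *\<^sub>R grid_step y s t n r) \<in> borel_measurable \<mu>"
  unfolding indicator_grid_step[OF assms(1)] measurable_cong_sets[OF assms(2) refl] by measurable

lemma left_lim_measurable:
  fixes y :: "real \<Rightarrow> 'b::euclidean_space"
  assumes "cadlag y" "0 \<le> s" "s \<le> t" and \<mu>: "sets \<mu> = sets borel"
  shows "(\<lambda>r. indicator {s<..t} r *\<^sub>R Lim (at_left r) y) \<in> borel_measurable \<mu>"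
proof (rule borel_measurable_LIMSEQ_metric)
  show "(\<lambda>r. indicator {s<..t} r *\<^sub>R grid_step y s t n r) \<in> borel_measurable \<mu>" for n
    by (rule grid_step_measurable[OF assms(3) \<mu>])
  show "(\<lambda>n. indicator {s<..t} r *\<^sub>R grid_step y s t n r) \<longlonglongrightarrow> indicator {s<..t} r *\<^sub>R Lim (at_left r) y" for r
    using cadlag_grid_left[OF assms(1,2), of r t] by (auto simp: indicator_def)
qed

text \<open>The measure is left open because the state equation contains one integral against
  Lebesgue measure and one against a Stieltjes measure.\<close>

locale cadlag_interval =
  fixes y :: "real \<Rightarrow> 'b::euclidean_space" and s t :: real and \<mu> :: "real measure"
  assumes cad: "cadlag y" and s: "0 \<le> s" "s \<le> t" and sets_\<mu>: "sets \<mu> = sets borel"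
    and fin: "emeasure \<mu> {s<..t} < \<infinity>"
begin

lemma integrable_left_lim:
  assumes \<phi>: "continuous_on UNIV \<phi>"
  shows "set_integrable \<mu> {s<..t} (\<lambda>r. \<phi> (Lim (at_left r) y) :: 'b)"
proof -
  obtain K where K: "\<And>r. 0 \<le> r \<Longrightarrow> r \<le> t \<Longrightarrow> norm (y r) \<le> K" using cadlag_bounded[OF cad] by blast
  have "compact (\<phi> ` cball 0 K)" by (rule compact_continuous_image) (use \<phi> in \<open>auto intro: continuous_on_subset\<close>)
  then obtain C where "\<forall>z\<in>\<phi> ` cball 0 K. norm z \<le> C"
    using compact_imp_bounded[of "\<phi> ` cball 0 K"] unfolding bounded_iff by blast
  then have C: "norm (\<phi> z) \<le> C" if "norm z \<le> K" for z using that by simp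
  have [measurable]: "\<phi> \<in> borel_measurable borel" using \<phi> by (rule borel_measurable_continuous_onI)
  have [measurable]: "(\<lambda>r. indicator {s<..t} r *\<^sub>R Lim (at_left r) y) \<in> borel_measurable \<mu>"
    by (rule left_lim_measurable[OF cad s sets_\<mu>])
  have [measurable]: "{s<..t} \<in> sets \<mu>" by (simp add: sets_\<mu>)
  have m: "(\<lambda>r. indicator {s<..t} r *\<^sub>R \<phi> (Lim (at_left r) y)) \<in> borel_measurable \<mu>"
  proof -
    \<comment> \<open>Measurability is known for the left limit only after cutting it off outside
      the interval, so the indicator is placed inside \<phi> as well.\<close>
    have "(\<lambda>r. indicator {s<..t} r *\<^sub>R \<phi> (indicator {s<..t} r *\<^sub>R Lim (at_left r) y)) \<in> borel_measurable \<mu>"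
      by measurable
    moreover have "(\<lambda>r. indicator {s<..t} r *\<^sub>R \<phi> (indicator {s<..t} r *\<^sub>R Lim (at_left r) y)) = (\<lambda>r. indicator {s<..t} r *\<^sub>R \<phi> (Lim (at_left r) y))"
      by (auto simp: indicator_def)
    ultimately show ?thesis by simp
  qed
  show ?thesis unfolding set_integrable_def
  proof (rule Bochner_Integration.integrable_bound[of _ "\<lambda>r. indicator {s<..t} r *\<^sub>R C"])
    show "integrable \<mu> (\<lambda>r. indicator {s<..t} r *\<^sub>R C)"
      using fin by (intro integrable_scaleR_left integrable_real_indicator) auto
    show "AE r in \<mu>. norm (indicator {s<..t} r *\<^sub>R \<phi> (Lim (at_left r) y)) \<le> norm (indicator {s<..t} r *\<^sub>R C)"
      using C cadlag_left_lim_bounded[OF cad K] s by (auto simp: indicator_def intro!: AE_I2 order_trans[OF _ abs_ge_self])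
  qed (rule m)
qed

text \<open>Dominated convergence, the path being bounded on [0, t]. This quantity is the total
  consistency error of the Euler scheme on the n-th grid.\<close>

lemma grid_step_L1:
  "(\<lambda>n. \<integral>r\<in>{s<..t}. norm (Lim (at_left r) y - grid_step y s t n r) \<partial>\<mu>) \<longlonglongrightarrow> 0"
proof -
  obtain K where K: "\<And>r. 0 \<le> r \<Longrightarrow> r \<le> t \<Longrightarrow> norm (y r) \<le> K" using cadlag_bounded[OF cad] by blast
  have [measurable]: "(\<lambda>r. indicator {s<..t} r *\<^sub>R Lim (at_left r) y) \<in> borel_measurable \<mu>"
    by (rule left_lim_measurable[OF cad s sets_\<mu>])
  have [measurable]: "(\<lambda>r. indicator {s<..t} r *\<^sub>R grid_step y s t n r) \<in> borel_measurable \<mu>" for n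
    by (rule grid_step_measurable[OF s(2) sets_\<mu>])
  have [measurable]: "{s<..t} \<in> sets \<mu>" by (simp add: sets_\<mu>)
  have eq: "indicator {s<..t} r *\<^sub>R norm (Lim (at_left r) y - grid_step y s t n r)
     = norm (indicator {s<..t} r *\<^sub>R Lim (at_left r) y - indicator {s<..t} r *\<^sub>R grid_step y s t n r)" for r n
    by (auto simp: indicator_def)
  have "(\<lambda>n. \<integral>r. indicator {s<..t} r *\<^sub>R norm (Lim (at_left r) y - grid_step y s t n r) \<partial>\<mu>) \<longlonglongrightarrow> (\<integral>r. 0 \<partial>\<mu>)"
  proof (rule integral_dominated_convergence[where w = "\<lambda>r. indicator {s<..t} r *\<^sub>R (2 * K)"])
    show "integrable \<mu> (\<lambda>r. indicator {s<..t} r *\<^sub>R (2 * K))"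
      using fin by (intro integrable_scaleR_left integrable_real_indicator) auto
    show "AE r in \<mu>. (\<lambda>n. indicator {s<..t} r *\<^sub>R norm (Lim (at_left r) y - grid_step y s t n r)) \<longlonglongrightarrow> 0"
    proof (rule AE_I2)
      fix r
      show "(\<lambda>n. indicator {s<..t} r *\<^sub>R norm (Lim (at_left r) y - grid_step y s t n r)) \<longlonglongrightarrow> 0"
      proof (cases "r \<in> {s<..t}")
        case True
        then have "(\<lambda>n. norm (Lim (at_left r) y - grid_step y s t n r)) \<longlonglongrightarrow> norm (Lim (at_left r) y - Lim (at_left r) y)"
          using cadlag_grid_left[OF cad s(1), of r t] by (intro tendsto_intros) auto
        then show ?thesis using True by simp
      qed simp
    qed
    show "AE r in \<mu>. norm (indicator {s<..t} r *\<^sub>R norm (Lim (at_left r) y - grid_step y s t n r)) \<le> indicator {s<..t} r *\<^sub>R (2 * K)" for n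
    proof (rule AE_I2)
      fix r
      show "norm (indicator {s<..t} r *\<^sub>R norm (Lim (at_left r) y - grid_step y s t n r)) \<le> indicator {s<..t} r *\<^sub>R (2 * K)"
      proof (cases "r \<in> {s<..t}")
        case True
        have "norm (Lim (at_left r) y) \<le> K" using cadlag_left_lim_bounded[OF cad K] s True by auto
        moreover have "norm (grid_step y s t n r) \<le> K"
          using grid_index(1)[of s r t n] True grid_bounds[OF s(2), of "grid_index s t n r" n] s by (intro K) auto
        ultimately show ?thesis
          using True norm_triangle_ineq4[of "Lim (at_left r) y" "grid_step y s t n r"] by simp
      qed simp
    qed
  qed (unfold eq, measurable)
  then show ?thesis by (simp add: set_lebesgue_integral_def)
qed

end

section \<open>Integral equations with an increasing integrator\<close>

lemma set_integral_const_real: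
  fixes c :: "'b::euclidean_space"
  assumes "A \<in> sets \<mu>" "emeasure \<mu> A < \<infinity>"
  shows "(LINT r:A|\<mu>. c) = measure \<mu> A *\<^sub>R c" "set_integrable \<mu> A (\<lambda>r. c)"
proof -
  show "set_integrable \<mu> A (\<lambda>r. c)"
    unfolding set_integrable_def using assms by (intro integrable_scaleR_left integrable_real_indicator) 
  show "(LINT r:A|\<mu>. c) = measure \<mu> A *\<^sub>R c"
    unfolding set_lebesgue_integral_def using assms
    by (subst integral_scaleR_left) (auto intro: integrable_real_indicator simp: sets.Int_space_eq2)
qed

lemma lipschitz_imp_continuous:
  fixes \<phi> :: "'a::real_normed_vector \<Rightarrow> 'b::real_normed_vector"
  assumes "\<And>z w. norm (\<phi> z - \<phi> w) \<le> b * norm (z - w)"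
  shows "continuous_on UNIV \<phi>"
proof -
  have "0 \<le> max b 0" by simp
  moreover have "norm (\<phi> z - \<phi> w) \<le> max b 0 * norm (z - w)" for z w
    by (rule order_trans[OF assms]) (simp add: mult_right_mono)
  ultimately have "(max b 0)-lipschitz_on UNIV \<phi>" by (intro lipschitz_onI) (auto simp: dist_norm)
  then show ?thesis by (rule lipschitz_on_continuous_on)
qed

context cadlag_interval
begin

lemma Ioc_sets: "{u<..v} \<in> sets \<mu>" by (simp add: sets_\<mu>)

lemma integral_left_lim_estimate:
  fixes \<phi> :: "'b \<Rightarrow> 'b"
  assumes lip: "\<And>z w. norm (\<phi> z - \<phi> w) \<le> b * norm (z - w)"
  shows "norm ((LINT r:{s<..t}|\<mu>. \<phi> (Lim (at_left r) y)) - measure \<mu> {s<..t} *\<^sub>R \<phi> c)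
    \<le> b * (LINT r:{s<..t}|\<mu>. norm (Lim (at_left r) y - c))"
proof -
  have \<phi>: "continuous_on UNIV \<phi>" by (rule lipschitz_imp_continuous[OF lip])
  note i = integrable_left_lim[OF \<phi>]
  have ic: "set_integrable \<mu> {s<..t} (\<lambda>r. Lim (at_left r) y - c)"
    using integrable_left_lim[of "\<lambda>z. z - c"] by (simp add: continuous_on_diff)
  have icn: "set_integrable \<mu> {s<..t} (\<lambda>r. norm (Lim (at_left r) y - c))"
    using ic by (simp add: set_integrable_norm)
  have "(LINT r:{s<..t}|\<mu>. \<phi> (Lim (at_left r) y)) - measure \<mu> {s<..t} *\<^sub>R \<phi> c
      = (LINT r:{s<..t}|\<mu>. \<phi> (Lim (at_left r) y) - \<phi> c)"
    using set_integral_const_real[OF Ioc_sets fin, of "\<phi> c"] i by (simp add: set_integral_diff)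
  also have "norm \<dots> \<le> (LINT r:{s<..t}|\<mu>. norm (\<phi> (Lim (at_left r) y) - \<phi> c))"
    by (intro set_integral_norm_bound set_integral_diff(1) i set_integral_const_real Ioc_sets fin)
  also have "\<dots> \<le> (LINT r:{s<..t}|\<mu>. b * norm (Lim (at_left r) y - c))"
    by (intro set_integral_mono set_integrable_norm set_integral_diff(1) i set_integral_const_real Ioc_sets fin set_integrable_mult_right icn lip)
  also have "\<dots> = b * (LINT r:{s<..t}|\<mu>. norm (Lim (at_left r) y - c))" by simp
  finally show ?thesis .
qed

lemma integrable_norm_grid_step:
  "set_integrable \<mu> {s<..t} (\<lambda>r. norm (Lim (at_left r) y - grid_step y s t n r))"
proof -
  have "set_integrable \<mu> {s<..t} (\<lambda>r. grid_step y s t n r)"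
    unfolding set_integrable_def indicator_grid_step[OF s(2)]
  proof (intro Bochner_Integration.integrable_sum integrable_scaleR_left integrable_real_indicator)
    fix i assume "i \<in> {..<2 ^ n :: nat}"
    then have "{grid s t n i<..grid s t n (Suc i)} \<subseteq> {s<..t}" using grid_cells[OF s(2), of n] by blast
    then show "emeasure \<mu> {grid s t n i<..grid s t n (Suc i)} < \<infinity>"
      using fin emeasure_mono[OF _ Ioc_sets] by (metis le_less_trans)
  qed (rule Ioc_sets)
  then show ?thesis
    using integrable_left_lim[of "\<lambda>z. z"] by (intro set_integrable_norm set_integral_diff(1)) auto
qed

lemma sum_cells:
  "(\<Sum>i<2 ^ n. LINT r:{grid s t n i<..grid s t n (Suc i)}|\<mu>. norm (Lim (at_left r) y - y (grid s t n i)))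
    = (LINT r:{s<..t}|\<mu>. norm (Lim (at_left r) y - grid_step y s t n r))"
proof -
  have "(LINT r:{s<..t}|\<mu>. norm (Lim (at_left r) y - grid_step y s t n r))
    = (\<Sum>i<2 ^ n. LINT r:{grid s t n i<..grid s t n (Suc i)}|\<mu>. norm (Lim (at_left r) y - grid_step y s t n r))"
    unfolding grid_cells[OF s(2), of n]
  proof (rule set_integral_finite_Union)
    show "disjoint_family_on (\<lambda>i. {grid s t n i<..grid s t n (Suc i)}) {..<2 ^ n}"
      unfolding disjoint_family_on_def
    proof (intro ballI impI equals0I)
      fix i j r assume "i \<noteq> j" "r \<in> {grid s t n i<..grid s t n (Suc i)} \<inter> {grid s t n j<..grid s t n (Suc j)}"
      then show False using grid_index_unique[OF s(2), of n i r j] by simp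
    qed
    fix i assume "i \<in> {..<2 ^ n :: nat}"
    then have "{grid s t n i<..grid s t n (Suc i)} \<subseteq> {s<..t}" using grid_cells[OF s(2), of n] by blast
    then show "set_integrable \<mu> {grid s t n i<..grid s t n (Suc i)} (\<lambda>r. norm (Lim (at_left r) y - grid_step y s t n r))"
      by (rule set_integrable_subset[OF integrable_norm_grid_step Ioc_sets])
  qed (auto simp: Ioc_sets)
  also have "\<dots> = (\<Sum>i<2 ^ n. LINT r:{grid s t n i<..grid s t n (Suc i)}|\<mu>. norm (Lim (at_left r) y - y (grid s t n i)))"
    by (intro sum.cong set_lebesgue_integral_cong Ioc_sets) (auto simp: grid_index_eq[OF s(2)])
  finally show ?thesis ..
qed

end

text \<open>The state equation along a single path, with \<open>D\<close> in the role of the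
  accumulated squared jumps. Monotonicity and right continuity ensure that
  \<open>interval_measure D\<close> gives (u, v] the mass \<open>D v - D u\<close>.\<close>

locale integral_equation = lipschitz_coeffs f g b
  for f g :: "'e::euclidean_space \<Rightarrow> 'e" and b +
  fixes y :: "real \<Rightarrow> 'e" and D :: "real \<Rightarrow> real"
  assumes cad: "cadlag y"
    and D_mono: "\<And>u v. u \<le> v \<Longrightarrow> D u \<le> D v"
    and D_right: "\<And>u. continuous (at_right u) D"
    and sol: "\<And>v. 0 \<le> v \<Longrightarrow> y v = y 0 + (LBINT r:{0<..v}. f (Lim (at_left r) y))
      + (LINT r:{0<..v}|interval_measure D. g (Lim (at_left r) y))"
begin

lemma measure_D: "u \<le> v \<Longrightarrow> measure (interval_measure D) {u<..v} = D v - D u"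
  by (rule measure_interval_measure_Ioc) (auto intro: D_mono D_right)

lemma cadlag_interval_D: "0 \<le> u \<Longrightarrow> u \<le> v \<Longrightarrow> cadlag_interval y u v (interval_measure D)"
  using cad emeasure_interval_measure_Ioc[of u v D] D_mono D_right by unfold_locales auto

lemma cadlag_interval_lborel: "0 \<le> u \<Longrightarrow> u \<le> v \<Longrightarrow> cadlag_interval y u v lborel"
  using cad by unfold_locales auto

lemma f_cont: "continuous_on UNIV f" and g_cont: "continuous_on UNIV g"
  by (rule lipschitz_imp_continuous[OF f_lip]) (rule lipschitz_imp_continuous[OF g_lip])

lemma increment:
  assumes "0 \<le> u" "u \<le> v"
  shows "y v - y u = (LBINT r:{u<..v}. f (Lim (at_left r) y)) + (LINT r:{u<..v}|interval_measure D. g (Lim (at_left r) y))"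
proof -
  have eq: "{0<..v} = {0<..u} \<union> {u<..v}" using assms by auto
  have "(LBINT r:{0<..v}. f (Lim (at_left r) y)) = (LBINT r:{0<..u}. f (Lim (at_left r) y)) + (LBINT r:{u<..v}. f (Lim (at_left r) y))"
    unfolding eq using assms f_cont
    by (intro set_integral_Un cadlag_interval.integrable_left_lim cadlag_interval_lborel) auto
  moreover have "(LINT r:{0<..v}|interval_measure D. g (Lim (at_left r) y)) = (LINT r:{0<..u}|interval_measure D. g (Lim (at_left r) y)) + (LINT r:{u<..v}|interval_measure D. g (Lim (at_left r) y))"
    unfolding eq using assms g_cont
    by (intro set_integral_Un cadlag_interval.integrable_left_lim cadlag_interval_D) auto
  ultimately show ?thesis using sol[of u] sol[of v] assms by simp
qed

text \<open>Both integrands are frozen at an arbitrary vector \<open>c\<close>. With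
  \<open>c = y u\<close> this is the local error of the Euler scheme; with \<open>c = 0\<close> it
  bounds the increments of the solution near a fixed time.\<close>

lemma local_error:
  assumes "0 \<le> u" "u \<le> v"
  shows "norm (y v - (y u + ((v - u) *\<^sub>R f c + (D v - D u) *\<^sub>R g c)))
    \<le> b * ((LBINT r:{u<..v}. norm (Lim (at_left r) y - c)) + (LINT r:{u<..v}|interval_measure D. norm (Lim (at_left r) y - c)))"
proof -
  have "y v - (y u + ((v - u) *\<^sub>R f c + (D v - D u) *\<^sub>R g c))
    = ((LBINT r:{u<..v}. f (Lim (at_left r) y)) - measure lborel {u<..v} *\<^sub>R f c)
    + ((LINT r:{u<..v}|interval_measure D. g (Lim (at_left r) y)) - measure (interval_measure D) {u<..v} *\<^sub>R g c)"
  proof -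
    have "measure lborel {u<..v} = v - u" "measure (interval_measure D) {u<..v} = D v - D u"
      using assms by (simp_all add: measure_D)
    moreover have "y v = y u + ((LBINT r:{u<..v}. f (Lim (at_left r) y)) + (LINT r:{u<..v}|interval_measure D. g (Lim (at_left r) y)))"
      using increment[OF assms] by (simp add: algebra_simps)
    ultimately show ?thesis by simp
  qed
  also have "norm \<dots> \<le> b * (LBINT r:{u<..v}. norm (Lim (at_left r) y - c)) + b * (LINT r:{u<..v}|interval_measure D. norm (Lim (at_left r) y - c))"
    by (intro order_trans[OF norm_triangle_ineq] add_mono cadlag_interval.integral_left_lim_estimate
       cadlag_interval_lborel cadlag_interval_D assms f_lip g_lip)
  finally show ?thesis by (simp add: algebra_simps)
qed

text \<open>Consistency and stability. The local errors add up to the L1 distance between the left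
  limits and their step approximations, which tends to 0, and propagating them to time
  \<open>t\<close> costs at most the factor \<open>T\<close>, which is independent of the
  mesh.\<close>

lemma solution_euler_limit:
  assumes st: "0 \<le> s" "s \<le> t"
  shows "(\<lambda>n. euler_grid f g (\<lambda>u v. D v - D u) s t n (y s)) \<longlonglongrightarrow> y t"
proof -
  define R where "R n i = b * ((LBINT r:{grid s t n i<..grid s t n (Suc i)}. norm (Lim (at_left r) y - y (grid s t n i)))
    + (LINT r:{grid s t n i<..grid s t n (Suc i)}|interval_measure D. norm (Lim (at_left r) y - y (grid s t n i))))" for n i
  define T where "T = exp (b * ((t - s) + (D t - D s)))"
  have gm: "0 \<le> grid s t n i" "grid s t n i \<le> grid s t n (Suc i)" for n i
    using grid_nonneg[OF st] grid_mono[OF st(2), of i "Suc i" n] by auto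
  have R0: "0 \<le> R n i" for n i
    using local_error[OF gm, of n i] norm_ge_zero order_trans unfolding R_def by blast
  have tele: "(\<Sum>i<2 ^ n. D (grid s t n (Suc i)) - D (grid s t n i)) = D t - D s" for n
    using sum_lessThan_telescope[of "\<lambda>i. D (grid s t n i)" "2 ^ n"] by simp
  have bound: "norm (y t - euler_grid f g (\<lambda>u v. D v - D u) s t n (y s)) \<le> T * (\<Sum>i<2 ^ n. R n i)" for n
  proof -
    define h where "h = (t - s) / 2 ^ n"
    define d where "d i = D (grid s t n (Suc i)) - D (grid s t n i)" for i
    define E where "E = euler f g h d (y s)"
    define P where "P j = (\<Prod>i<j. 1 + b * (h + d i))" for j
    have hd: "0 \<le> h" "0 \<le> d i" for i using st D_mono[OF gm(2), of n i] by (simp_all add: h_def d_def)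
    have q0: "0 \<le> b * (h + d i)" for i using hd(1) hd(2)[of i] b by simp
    have P1: "1 \<le> P j" for j unfolding P_def by (rule prod_ge_1) (simp add: q0)
    have PSuc: "P (Suc j) = (1 + b * (h + d j)) * P j" for j by (simp add: P_def)
    \<comment> \<open>Discrete Gronwall estimate. Since \<open>P\<close> is at least 1, the new
      error can be given the same factor \<open>P (Suc j)\<close> as the propagated ones.\<close>
    have "norm (y (grid s t n j) - E j) \<le> P j * (\<Sum>i<j. R n i)" for j
    proof (induction j)
      case 0
      then show ?case by (simp add: E_def)
    next
      case (Suc j)
      define u where "u = y (grid s t n j)"
      define v where "v = E j"
      have ESuc: "E (Suc j) = v + (h *\<^sub>R f v + d j *\<^sub>R g v)" by (simp add: E_def v_def)
      have 1: "norm (y (grid s t n (Suc j)) - (u + (h *\<^sub>R f u + d j *\<^sub>R g u))) \<le> R n j"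
        using local_error[OF gm, of n j u] unfolding R_def grid_diff u_def h_def d_def .
      have "norm (y (grid s t n (Suc j)) - E (Suc j)) \<le> norm (y (grid s t n (Suc j)) - (u + (h *\<^sub>R f u + d j *\<^sub>R g u)))
         + norm ((u + (h *\<^sub>R f u + d j *\<^sub>R g u)) - (v + (h *\<^sub>R f v + d j *\<^sub>R g v)))"
        unfolding ESuc dist_norm[symmetric] by (rule dist_triangle)
      also have "\<dots> \<le> R n j + (1 + b * (h + d j)) * norm (u - v)"
        by (rule add_mono[OF 1 step_lip[OF hd(1) hd(2)]])
      also have "\<dots> \<le> P (Suc j) * R n j + (1 + b * (h + d j)) * (P j * (\<Sum>i<j. R n i))"
      proof (rule add_mono)
        show "R n j \<le> P (Suc j) * R n j" using mult_right_mono[OF P1[of "Suc j"] R0[of n j]] by simp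
        show "(1 + b * (h + d j)) * norm (u - v) \<le> (1 + b * (h + d j)) * (P j * (\<Sum>i<j. R n i))"
          using Suc.IH q0[of j] unfolding u_def v_def by (intro mult_left_mono) linarith+
      qed
      also have "\<dots> = P (Suc j) * (\<Sum>i<Suc j. R n i)" unfolding PSuc by (simp add: algebra_simps)
      finally show ?case .
    qed
    from this[of "2 ^ n"] have "norm (y t - E (2 ^ n)) \<le> P (2 ^ n) * (\<Sum>i<2 ^ n. R n i)" by simp
    also have "\<dots> \<le> T * (\<Sum>i<2 ^ n. R n i)"
    proof (rule mult_right_mono)
      have "P (2 ^ n) \<le> exp (\<Sum>i<2 ^ n. b * (h + d i))"
        unfolding P_def by (rule prod_le_exp_sum) (rule q0)
      also have "(\<Sum>i<2 ^ n. b * (h + d i)) = b * ((t - s) + (D t - D s))"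
        using tele[of n] by (simp add: sum_distrib_left[symmetric] sum.distrib h_def d_def)
      finally show "P (2 ^ n) \<le> T" by (simp add: T_def)
    qed (rule sum_nonneg, rule R0)
    finally have "norm (y t - E (2 ^ n)) \<le> T * (\<Sum>i<2 ^ n. R n i)" .
    then show ?thesis unfolding euler_grid_def E_def h_def d_def .
  qed
  have "(\<lambda>n. T * (b * ((LBINT r:{s<..t}. norm (Lim (at_left r) y - grid_step y s t n r))
      + (LINT r:{s<..t}|interval_measure D. norm (Lim (at_left r) y - grid_step y s t n r))))) \<longlonglongrightarrow> T * (b * (0 + 0))"
    by (intro tendsto_intros cadlag_interval.grid_step_L1 cadlag_interval_lborel cadlag_interval_D st)
  moreover have "(\<Sum>i<2 ^ n. R n i) = b * ((LBINT r:{s<..t}. norm (Lim (at_left r) y - grid_step y s t n r))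
      + (LINT r:{s<..t}|interval_measure D. norm (Lim (at_left r) y - grid_step y s t n r)))" for n
    unfolding R_def sum_distrib_left[symmetric] sum.distrib
    using cadlag_interval.sum_cells[OF cadlag_interval_lborel[OF st], of n] cadlag_interval.sum_cells[OF cadlag_interval_D[OF st], of n] by simp
  ultimately have lim: "(\<lambda>n. T * (\<Sum>i<2 ^ n. R n i)) \<longlonglongrightarrow> 0" by simp
  have "(\<lambda>n. y t - euler_grid f g (\<lambda>u v. D v - D u) s t n (y s)) \<longlonglongrightarrow> 0"
    by (rule Lim_null_comparison[OF _ lim]) (use bound in auto)
  from tendsto_diff[OF tendsto_const[of "y t"] this] show ?thesis by simp
qed

text \<open>The integrands are bounded on [0, t], so increments of \<open>y\<close> are dominated by
  those of time and of \<open>D\<close>. If \<open>D\<close> does not jump at \<open>t\<close>,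
  neither does \<open>y\<close>.\<close>

lemma left_lim_eq_if_no_jump:
  assumes t: "0 < t" and D: "(D \<longlongrightarrow> D t) (at_left t)"
  shows "Lim (at_left t) y = y t"
proof -
  obtain K where K: "\<And>r. 0 \<le> r \<Longrightarrow> r \<le> t \<Longrightarrow> norm (y r) \<le> K" using cadlag_bounded[OF cad] by blast
  define B where "B s = ((t - s) * norm (f 0) + (D t - D s) * norm (g 0)) + b * ((t - s) * K + (D t - D s) * K)" for s
  have bound: "norm (y t - y s) \<le> B s" if s: "0 < s" "s < t" for s
  proof -
    have I: "(LINT r:{s<..t}|\<mu>. norm (Lim (at_left r) y - 0)) \<le> measure \<mu> {s<..t} * K"
      if \<mu>: "cadlag_interval y s t \<mu>" for \<mu>
    proof -
      interpret cadlag_interval y s t \<mu> by fact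
      have "(LINT r:{s<..t}|\<mu>. norm (Lim (at_left r) y - 0)) \<le> (LINT r:{s<..t}|\<mu>. K)"
      proof (rule set_integral_mono)
        show "set_integrable \<mu> {s<..t} (\<lambda>r. norm (Lim (at_left r) y - 0))"
          using integrable_left_lim[of "\<lambda>z. z"] by (intro set_integrable_norm) simp
        show "set_integrable \<mu> {s<..t} (\<lambda>r. K)" by (rule set_integral_const_real[OF Ioc_sets fin])
        fix r assume "r \<in> {s<..t}"
        then show "norm (Lim (at_left r) y - 0) \<le> K" using cadlag_left_lim_bounded[OF cad K, of t r] s by simp
      qed
      then show ?thesis using set_integral_const_real[OF Ioc_sets fin, of K] by simp
    qed
    have "y t - y s = (y t - (y s + ((t - s) *\<^sub>R f 0 + (D t - D s) *\<^sub>R g 0))) + ((t - s) *\<^sub>R f 0 + (D t - D s) *\<^sub>R g 0)" by simp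
    also have "norm \<dots> \<le> b * ((t - s) * K + (D t - D s) * K) + ((t - s) * norm (f 0) + (D t - D s) * norm (g 0))"
    proof (rule order_trans[OF norm_triangle_ineq add_mono])
      show "norm (y t - (y s + ((t - s) *\<^sub>R f 0 + (D t - D s) *\<^sub>R g 0))) \<le> b * ((t - s) * K + (D t - D s) * K)"
      proof (rule order_trans[OF local_error])
        have "(LBINT r:{s<..t}. norm (Lim (at_left r) y - 0)) \<le> (t - s) * K"
          using I[OF cadlag_interval_lborel] s by simp
        moreover have "(LINT r:{s<..t}|interval_measure D. norm (Lim (at_left r) y - 0)) \<le> (D t - D s) * K"
          using I[OF cadlag_interval_D] s measure_D[of s t] by simp
        ultimately show "b * ((LBINT r:{s<..t}. norm (Lim (at_left r) y - 0)) + (LINT r:{s<..t}|interval_measure D. norm (Lim (at_left r) y - 0)))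
          \<le> b * ((t - s) * K + (D t - D s) * K)"
          using b by (intro mult_left_mono add_mono)
      qed (use s in auto)
      show "norm ((t - s) *\<^sub>R f 0 + (D t - D s) *\<^sub>R g 0) \<le> (t - s) * norm (f 0) + (D t - D s) * norm (g 0)"
        using norm_triangle_ineq[of "(t - s) *\<^sub>R f 0" "(D t - D s) *\<^sub>R g 0"] s D_mono[of s t] by simp
    qed
    finally show ?thesis unfolding B_def by linarith
  qed
  have "(B \<longlongrightarrow> B t) (at_left t)" unfolding B_def by (intro tendsto_intros D)
  then have lim: "(B \<longlongrightarrow> 0) (at_left t)" by (simp add: B_def)
  have "eventually (\<lambda>s. norm (y t - y s) \<le> B s) (at_left t)"
    unfolding eventually_at_left_field
    by (rule exI[of _ 0], intro conjI allI impI t, rule bound)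
  from Lim_null_comparison[OF this lim] have "((\<lambda>s. y t - y s) \<longlongrightarrow> 0) (at_left t)" .
  from tendsto_diff[OF tendsto_const[of "y t"] this] have "(y \<longlongrightarrow> y t) (at_left t)" by simp
  show ?thesis by (rule tendsto_Lim[OF _ \<open>(y \<longlongrightarrow> y t) (at_left t)\<close>]) simp
qed

end

section \<open>Levy processes: path law and Markov property\<close>

text \<open>Reverses the splitting of a path at \<open>s\<close> into its past and its later
  increments; \<open>x'\<close> is meant to start at 0. The restriction to nonnegative times keeps
  the result in the product space.\<close>

definition concat_path :: "real \<Rightarrow> (real \<Rightarrow> real) \<Rightarrow> (real \<Rightarrow> real) \<Rightarrow> real \<Rightarrow> real" where
  "concat_path s x x' = (\<lambda>u\<in>{0..}. if u \<le> s then x u else x s + x' (u - s))"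

definition shift_path :: "real \<Rightarrow> (real \<Rightarrow> real) \<Rightarrow> real \<Rightarrow> real" where
  "shift_path s x = (\<lambda>u\<in>{0..}. x (s + u) - x s)"

lemma space_paths: "space paths = extensional {0..}"
  by (auto simp: paths_def space_PiM PiE_def)

lemma measurable_into_paths:
  assumes "\<And>u. 0 \<le> u \<Longrightarrow> (\<lambda>w. X w u) \<in> borel_measurable N" "\<And>w. w \<in> space N \<Longrightarrow> X w \<in> extensional {0..}"
  shows "X \<in> measurable N paths"
proof -
  have "(\<lambda>w. \<lambda>u\<in>{0..}. X w u) \<in> measurable N paths"
    unfolding paths_def by (rule measurable_restrict) (use assms in auto)
  moreover have "(\<lambda>u\<in>{0..}. X w u) = X w" if "w \<in> space N" for w
    using assms(2)[OF that] by (simp add: extensional_restrict)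
  ultimately show ?thesis by (simp cong: measurable_cong)
qed

lemma measurable_shift_path: "0 \<le> s \<Longrightarrow> shift_path s \<in> measurable paths paths"
  by (rule measurable_into_paths)
    (auto simp: shift_path_def intro!: borel_measurable_diff measurable_path_eval)

lemma measurable_concat_path:
  assumes "0 \<le> s"
  shows "(\<lambda>(x, x'). concat_path s x x') \<in> measurable (paths \<Otimes>\<^sub>M paths) paths"
proof (rule measurable_into_paths)
  fix u :: real assume "0 \<le> u"
  have 1: "(\<lambda>w. fst w u) \<in> borel_measurable (paths \<Otimes>\<^sub>M paths)"
    using measurable_compose[OF measurable_fst[of paths paths] measurable_path_eval[OF \<open>0 \<le> u\<close>]] by simp
  have 2: "(\<lambda>w. fst w s) \<in> borel_measurable (paths \<Otimes>\<^sub>M paths)"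
    using measurable_compose[OF measurable_fst[of paths paths] measurable_path_eval[OF assms]] by simp
  have 3: "(\<lambda>w. snd w (u - s)) \<in> borel_measurable (paths \<Otimes>\<^sub>M paths)" if "\<not> u \<le> s"
    using measurable_compose[OF measurable_snd[of paths paths] measurable_path_eval[of "u - s"]] that by simp
  show "(\<lambda>w. (case w of (x, x') \<Rightarrow> concat_path s x x') u) \<in> borel_measurable (paths \<Otimes>\<^sub>M paths)"
    unfolding concat_path_def split_beta restrict_apply'[OF atLeast_iff[THEN iffD2, OF \<open>0 \<le> u\<close>]]
    using 1 2 3 by (cases "u \<le> s") auto
qed (auto simp: concat_path_def)

lemma distr_eq_PiM_rectangles:
  assumes \<mu>: "\<And>i. prob_space (\<mu> i)" "\<And>i. sets (\<mu> i) = sets (borel :: real measure)"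
    and X: "\<And>i. i < n \<Longrightarrow> X i \<in> borel_measurable N"
    and rect: "\<And>A. (\<And>i. A i \<in> sets borel) \<Longrightarrow>
      emeasure N {w \<in> space N. \<forall>i<n. X i w \<in> A i} = (\<Prod>i<n. emeasure (\<mu> i) (A i))"
  shows "distr N (PiM {..<n} (\<lambda>_. borel)) (\<lambda>w. \<lambda>i\<in>{..<n::nat}. X i w) = PiM {..<n} \<mu>"
proof -
  interpret product_prob_space \<mu> by (intro product_prob_spaceI \<mu>)
  have m: "(\<lambda>w. \<lambda>i\<in>{..<n}. X i w) \<in> measurable N (PiM {..<n} (\<lambda>_. borel))"
    by (rule measurable_restrict) (use X in auto)
  show ?thesis
  proof (rule PiM_eqI)
    show "sets (distr N (PiM {..<n} (\<lambda>_. borel)) (\<lambda>w. \<lambda>i\<in>{..<n}. X i w)) = sets (PiM {..<n} \<mu>)"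
      using \<mu>(2) by (simp cong: sets_PiM_cong)
    fix A assume A: "\<And>i. i \<in> {..<n} \<Longrightarrow> A i \<in> sets (\<mu> i)"
    define A' where "A' i = (if i < n then A i else {})" for i
    have A': "A' i \<in> sets borel" for i using A \<mu>(2) by (auto simp: A'_def)
    have "Pi\<^sub>E {..<n} A \<in> sets (PiM {..<n} (\<lambda>_. borel))"
      using A \<mu>(2) by (intro sets_PiM_I_finite) auto
    then have "emeasure (distr N (PiM {..<n} (\<lambda>_. borel)) (\<lambda>w. \<lambda>i\<in>{..<n}. X i w)) (Pi\<^sub>E {..<n} A)
      = emeasure N ((\<lambda>w. \<lambda>i\<in>{..<n}. X i w) -` Pi\<^sub>E {..<n} A \<inter> space N)"
      by (rule emeasure_distr[OF m])
    also have "(\<lambda>w. \<lambda>i\<in>{..<n}. X i w) -` Pi\<^sub>E {..<n} A \<inter> space N = {w \<in> space N. \<forall>i<n. X i w \<in> A' i}"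

    proof (intro set_eqI)
      fix w
      have "(\<lambda>i\<in>{..<n}. X i w) \<in> Pi\<^sub>E {..<n} A \<longleftrightarrow> (\<forall>i<n. X i w \<in> A i)"
        by (simp add: PiE_iff Ball_def)
      then show "w \<in> (\<lambda>w. \<lambda>i\<in>{..<n}. X i w) -` Pi\<^sub>E {..<n} A \<inter> space N \<longleftrightarrow> w \<in> {w \<in> space N. \<forall>i<n. X i w \<in> A' i}"
        by (simp add: A'_def conj_commute)
    qed
    also have "emeasure N \<dots> = (\<Prod>i<n. emeasure (\<mu> i) (A' i))" by (rule rect[OF A'])
    also have "\<dots> = (\<Prod>i\<in>{..<n}. emeasure (\<mu> i) (A i))" by (intro prod.cong) (auto simp: A'_def)
    finally show "emeasure (distr N (PiM {..<n} (\<lambda>_. borel)) (\<lambda>w. \<lambda>i\<in>{..<n}. X i w)) (Pi\<^sub>E {..<n} A) = (\<Prod>i\<in>{..<n}. emeasure (\<mu> i) (A i))" .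
  qed simp
qed

locale levy = prob_space M for M :: "'w measure" +
  fixes L :: "real \<Rightarrow> 'w \<Rightarrow> real"
  assumes levy_process: "levy_process M L"
begin

lemma L_measurable [measurable]: "0 \<le> t \<Longrightarrow> L t \<in> borel_measurable M"
  using levy_process by (simp add: levy_process_def)

text \<open>Subtracting \<open>L s\<close> makes these paths vanish at 0 for every \<omega>, whereas
  \<open>L 0 = 0\<close> holds only almost surely.\<close>

definition Lp :: "real \<Rightarrow> 'w \<Rightarrow> real \<Rightarrow> real" where
  "Lp s \<omega> = (\<lambda>u\<in>{0..}. L (s + u) \<omega> - L s \<omega>)"

definition path_law :: "(real \<Rightarrow> real) measure" where
  "path_law = distr M paths (Lp 0)"

lemma Lp_measurable [measurable]: "0 \<le> s \<Longrightarrow> Lp s \<in> measurable M paths"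
  by (rule measurable_into_paths) (auto simp: Lp_def intro!: borel_measurable_diff)

lemma shift_Lp: "0 \<le> s \<Longrightarrow> shift_path s (Lp 0 \<omega>) = Lp s \<omega>"
  by (auto simp: shift_path_def Lp_def)

lemma prob_space_path_law: "prob_space path_law"
  unfolding path_law_def by (rule prob_space_distr) simp

lemma sets_path_law [measurable_cong, simp]: "sets path_law = sets paths"
  by (simp add: path_law_def)

lemma space_path_law [simp]: "space path_law = space paths"
  by (simp add: path_law_def)

text \<open>The absolute value makes this a probability measure for every real argument, so that
  product measures over arbitrary indices need no side condition.\<close>

definition inc_law :: "real \<Rightarrow> real measure" where
  "inc_law t = distr M borel (\<lambda>\<omega>. L \<bar>t\<bar> \<omega> - L 0 \<omega>)"

lemma prob_space_inc_law: "prob_space (inc_law t)"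
  unfolding inc_law_def by (rule prob_space_distr) simp

lemma sets_inc_law [simp]: "sets (inc_law t) = sets borel"
  by (simp add: inc_law_def)

lemma emeasure_increment:
  assumes "0 \<le> u" "u \<le> v" "A \<in> sets borel"
  shows "emeasure M {\<omega> \<in> space M. L v \<omega> - L u \<omega> \<in> A} = emeasure (inc_law (v - u)) A"
proof -
  have "distr M borel (\<lambda>\<omega>. L (u + (v - u)) \<omega> - L u \<omega>) = distr M borel (\<lambda>\<omega>. L (v - u) \<omega> - L 0 \<omega>)"
  proof -
    have "\<forall>s\<ge>0. \<forall>t\<ge>0. distr M borel (\<lambda>\<omega>. L (s + t) \<omega> - L s \<omega>) = distr M borel (\<lambda>\<omega>. L t \<omega> - L 0 \<omega>)"
      using levy_process by (simp add: levy_process_def)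
    from this[rule_format, of u "v - u"] show ?thesis using assms by simp
  qed
  then have eq: "distr M borel (\<lambda>\<omega>. L v \<omega> - L u \<omega>) = inc_law (v - u)"
    using assms by (simp add: inc_law_def)
  have "(\<lambda>\<omega>. L v \<omega> - L u \<omega>) \<in> borel_measurable M" using assms by (intro borel_measurable_diff L_measurable) auto
  then have "emeasure (distr M borel (\<lambda>\<omega>. L v \<omega> - L u \<omega>)) A = emeasure M ((\<lambda>\<omega>. L v \<omega> - L u \<omega>) -` A \<inter> space M)"
    using assms by (intro emeasure_distr)
  also have "(\<lambda>\<omega>. L v \<omega> - L u \<omega>) -` A \<inter> space M = {\<omega> \<in> space M. L v \<omega> - L u \<omega> \<in> A}" by auto
  finally show ?thesis unfolding eq by simp
qed

lemma emeasure_increments: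
  fixes t :: "nat \<Rightarrow> real"
  assumes t: "0 \<le> t 0" "\<And>i. i < n \<Longrightarrow> t i < t (Suc i)" and A: "\<And>i. A i \<in> sets borel"
  shows "emeasure M {\<omega> \<in> space M. \<forall>i<n. L (t (Suc i)) \<omega> - L (t i) \<omega> \<in> A i}
    = (\<Prod>i<n. emeasure (inc_law (t (Suc i) - t i)) (A i))"
proof (cases "n = 0")
  case True
  then show ?thesis by (simp add: emeasure_space_1)
next
  case False
  have t0: "0 \<le> t i" if "i \<le> n" for i
    using that by (induction i) (use t in \<open>auto intro: order_trans less_imp_le simp: Suc_le_eq\<close>)
  have "indep_vars (\<lambda>_. borel) (\<lambda>i \<omega>. L (t (Suc i)) \<omega> - L (t i) \<omega>) {..<n}"
  proof -
    have "\<forall>(n::nat) t. 0 \<le> t 0 \<and> (\<forall>i<n. t i < t (Suc i)) \<longrightarrow>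
      indep_vars (\<lambda>_. borel) (\<lambda>i \<omega>. L (t (Suc i)) \<omega> - L (t i) \<omega>) {..<n}"
      using levy_process by (simp add: levy_process_def)
    then show ?thesis using t by blast
  qed
  then have "prob (\<Inter>i\<in>{..<n}. (\<lambda>\<omega>. L (t (Suc i)) \<omega> - L (t i) \<omega>) -` A i \<inter> space M)
     = (\<Prod>i\<in>{..<n}. prob ((\<lambda>\<omega>. L (t (Suc i)) \<omega> - L (t i) \<omega>) -` A i \<inter> space M))"
    by (rule indep_varsD) (use A False in auto)
  moreover have "(\<Inter>i\<in>{..<n}. (\<lambda>\<omega>. L (t (Suc i)) \<omega> - L (t i) \<omega>) -` A i \<inter> space M)
     = {\<omega> \<in> space M. \<forall>i<n. L (t (Suc i)) \<omega> - L (t i) \<omega> \<in> A i}"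
    using False by auto
  moreover have "(\<lambda>\<omega>. L (t (Suc i)) \<omega> - L (t i) \<omega>) -` A i \<inter> space M = {\<omega> \<in> space M. L (t (Suc i)) \<omega> - L (t i) \<omega> \<in> A i}" for i
    by auto
  ultimately have "emeasure M {\<omega> \<in> space M. \<forall>i<n. L (t (Suc i)) \<omega> - L (t i) \<omega> \<in> A i}
     = (\<Prod>i<n. emeasure M {\<omega> \<in> space M. L (t (Suc i)) \<omega> - L (t i) \<omega> \<in> A i})"
    by (simp add: emeasure_eq_measure prod_ennreal)
  also have "\<dots> = (\<Prod>i<n. emeasure (inc_law (t (Suc i) - t i)) (A i))"
    using t t0 A by (intro prod.cong emeasure_increment) (auto intro: less_imp_le)
  finally show ?thesis .
qed

text \<open>Once 0 and \<open>s\<close> are added to the time points, no increment straddles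
  \<open>s\<close>. The successive increments of one path and those of two independent paths glued
  at \<open>s\<close> then have the same product law, because the law of an increment depends only
  on the length of its interval. The event is a condition on partial sums of these
  increments.\<close>

lemma concat_law_aux:
  assumes s: "0 \<le> s" and J: "finite J" "J \<subseteq> {0..}" and A: "\<And>u. u \<in> J \<Longrightarrow> A u \<in> sets borel"
  shows "emeasure M {\<omega> \<in> space M. \<forall>u\<in>J. Lp 0 \<omega> u \<in> A u}
    = emeasure (M \<Otimes>\<^sub>M M) {w \<in> space (M \<Otimes>\<^sub>M M). \<forall>u\<in>J. concat_path s (Lp 0 (fst w)) (Lp 0 (snd w)) u \<in> A u}"
proof -
  interpret MM: pair_prob_space M M by standard
  define xs where "xs = sorted_list_of_set (J \<union> {0, s})"
  define t where "t i = xs ! i" for i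
  define n where "n = length xs - 1"
  have set_xs: "set xs = J \<union> {0, s}" unfolding xs_def by (rule set_sorted_list_of_set) (use J in simp)
  have srt: "sorted_wrt (<) xs" unfolding xs_def by (rule strict_sorted_list_of_set)
  have ne: "length xs = Suc n" using set_xs unfolding n_def by (cases xs) auto
  have tmono: "t i < t j" if "i < j" "j \<le> n" for i j
    unfolding t_def using sorted_wrt_nth_less[OF srt, of i j] that ne by simp
  have tmono': "t i \<le> t j" if "i \<le> j" "j \<le> n" for i j
    using tmono[of i j] that by (cases "i = j") auto
  have tin: "t i \<in> J \<union> {0, s}" if "i \<le> n" for i
    using that ne set_xs unfolding t_def by (metis le_imp_less_Suc nth_mem)
  have tex: "\<exists>i\<le>n. t i = u" if "u \<in> J \<union> {0, s}" for u
    using that ne set_xs unfolding t_def by (metis in_set_conv_nth less_Suc_eq_le)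
  have tnn: "0 \<le> t i" if "i \<le> n" for i using tin[OF that] J s by auto
  have t0: "t 0 = 0"
  proof -
    obtain i where "i \<le> n" "t i = 0" using tex[of 0] by auto
    then have "t 0 \<le> 0" using tmono'[of 0 i] by simp
    then show ?thesis using tnn[of 0] by simp
  qed
  obtain k where k: "k \<le> n" "t k = s" using tex[of s] by auto
  obtain ix where ix: "\<And>u. u \<in> J \<Longrightarrow> ix u \<le> n \<and> t (ix u) = u" using tex by (metis UnI1)
  define \<mu> where "\<mu> i = inc_law (t (Suc i) - t i)" for i
  define X where "X i \<omega> = L (t (Suc i)) \<omega> - L (t i) \<omega>" for i \<omega>
  \<comment> \<open>Increments of the glued path: up to the index \<open>k\<close> with
    \<open>t k = s\<close> they come from the first copy, afterwards from the second copy with its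
    clock reset at \<open>s\<close>.\<close>
  define X' where "X' i w = (if i < k then X i (fst w) else L (t (Suc i) - s) (snd w) - L (t i - s) (snd w))" for i and w :: "'w \<times> 'w"
  define P where "P = (PiM {..<n} (\<lambda>_. borel) :: (nat \<Rightarrow> real) measure)"
  define E where "E = {\<delta> \<in> space P. \<forall>u\<in>J. (\<Sum>i<ix u. \<delta> i) \<in> A u}"
  have Pm: "(\<lambda>\<delta>. \<delta> i) \<in> borel_measurable P" if "i < n" for i
    unfolding P_def by (rule measurable_component_singleton) (use that in auto)
  have E: "E \<in> sets P"
    unfolding E_def
  proof (rule sets.sets_Collect_finite_All[OF _ J(1)])
    show "{\<delta> \<in> space P. (\<Sum>i<ix u. \<delta> i) \<in> A u} \<in> sets P" if "u \<in> J" for u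
    proof -
      have "(\<lambda>\<delta>. \<Sum>i<ix u. \<delta> i) \<in> borel_measurable P"
        using ix[OF that] by (intro borel_measurable_sum Pm) auto
      from measurable_sets[OF this A[OF that]] show ?thesis by (simp add: vimage_def Int_def conj_commute)
    qed
  qed
  have Xm: "X i \<in> borel_measurable M" if "i < n" for i
    unfolding X_def using that tnn by (intro borel_measurable_diff L_measurable) auto
  have X'm: "X' i \<in> borel_measurable (M \<Otimes>\<^sub>M M)" if "i < n" for i
  proof (cases "i < k")
    case True
    have "(\<lambda>w. X i (fst w)) \<in> borel_measurable (M \<Otimes>\<^sub>M M)" by (rule measurable_compose[OF measurable_fst Xm[OF that]])
    moreover have "X' i = (\<lambda>w. X i (fst w))" using True by (auto simp: X'_def)
    ultimately show ?thesis by simp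
  next
    case False
    then have "0 \<le> t i - s" "0 \<le> t (Suc i) - s" using tmono'[of k i] tmono'[of k "Suc i"] k that by auto
    then have "(\<lambda>\<omega>. L (t (Suc i) - s) \<omega> - L (t i - s) \<omega>) \<in> borel_measurable M" by (intro borel_measurable_diff L_measurable)
    from measurable_compose[OF measurable_snd this]
    have "(\<lambda>w. L (t (Suc i) - s) (snd w) - L (t i - s) (snd w)) \<in> borel_measurable (M \<Otimes>\<^sub>M M)" .
    moreover have "X' i = (\<lambda>w. L (t (Suc i) - s) (snd w) - L (t i - s) (snd w))" using False by (auto simp: X'_def)
    ultimately show ?thesis by simp
  qed
  have d1: "distr M P (\<lambda>\<omega>. \<lambda>i\<in>{..<n}. X i \<omega>) = PiM {..<n} \<mu>"
    unfolding P_def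
  proof (rule distr_eq_PiM_rectangles)
    fix B :: "nat \<Rightarrow> real set" assume "\<And>i. B i \<in> sets borel"
    then show "emeasure M {\<omega> \<in> space M. \<forall>i<n. X i \<omega> \<in> B i} = (\<Prod>i<n. emeasure (\<mu> i) (B i))"
      unfolding X_def \<mu>_def using t0 tmono by (intro emeasure_increments) auto
  qed (use Xm in \<open>auto simp: \<mu>_def prob_space_inc_law\<close>)
  have d2: "distr (M \<Otimes>\<^sub>M M) P (\<lambda>w. \<lambda>i\<in>{..<n}. X' i w) = PiM {..<n} \<mu>"
    unfolding P_def
  proof (rule distr_eq_PiM_rectangles)
    fix B :: "nat \<Rightarrow> real set" assume B: "\<And>i. B i \<in> sets borel"
    let ?E1 = "{\<omega> \<in> space M. \<forall>i<k. X i \<omega> \<in> B i}"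
    let ?t = "\<lambda>i. t (k + i) - s"
    let ?E2 = "{\<omega> \<in> space M. \<forall>i<n - k. L (?t (Suc i)) \<omega> - L (?t i) \<omega> \<in> B (k + i)}"
    have eqE: "{w \<in> space (M \<Otimes>\<^sub>M M). \<forall>i<n. X' i w \<in> B i} = ?E1 \<times> ?E2"
    proof (intro set_eqI)
      fix w
      have "(\<forall>i<n. X' i w \<in> B i) \<longleftrightarrow> (\<forall>i<k. X' i w \<in> B i) \<and> (\<forall>i<n - k. X' (k + i) w \<in> B (k + i))"
      proof (intro iffI conjI allI impI)
        fix i assume *: "(\<forall>i<k. X' i w \<in> B i) \<and> (\<forall>i<n - k. X' (k + i) w \<in> B (k + i))" "i < n"
        show "X' i w \<in> B i"
        proof (cases "i < k")
          case False
          then have "X' (k + (i - k)) w \<in> B (k + (i - k))" using * by (intro conjunct2[OF *(1), rule_format]) auto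
          then show ?thesis using False by simp
        qed (use * in auto)
      qed (use k in auto)
      then show "w \<in> {w \<in> space (M \<Otimes>\<^sub>M M). \<forall>i<n. X' i w \<in> B i} \<longleftrightarrow> w \<in> ?E1 \<times> ?E2"
        by (cases w) (auto simp: X'_def space_pair_measure)
    qed
    have E1: "?E1 \<in> sets M"
    proof -
      have "?E1 = {\<omega> \<in> space M. \<forall>i\<in>{..<k}. X i \<omega> \<in> B i}" by auto
      also have "\<dots> \<in> sets M"
      proof (rule sets.sets_Collect_finite_All)
        show "{\<omega> \<in> space M. X i \<omega> \<in> B i} \<in> sets M" if "i \<in> {..<k}" for i
          using measurable_sets[OF Xm B, of i i] that k by (simp add: vimage_def Int_def conj_commute)
      qed simp
      finally show ?thesis .
    qed
    have E2: "?E2 \<in> sets M"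
    proof -
      have "?E2 = {\<omega> \<in> space M. \<forall>i\<in>{..<n - k}. L (?t (Suc i)) \<omega> - L (?t i) \<omega> \<in> B (k + i)}" by auto
      also have "\<dots> \<in> sets M"
      proof (rule sets.sets_Collect_finite_All)
        fix i assume i: "i \<in> {..<n - k}"
        have "(\<lambda>\<omega>. L (?t (Suc i)) \<omega> - L (?t i) \<omega>) \<in> borel_measurable M"
          using tmono'[of k "k + i"] tmono'[of k "k + Suc i"] k i by (intro borel_measurable_diff L_measurable) auto
        from measurable_sets[OF this B] show "{\<omega> \<in> space M. L (?t (Suc i)) \<omega> - L (?t i) \<omega> \<in> B (k + i)} \<in> sets M"
          by (simp add: vimage_def Int_def conj_commute)
      qed simp
      finally show ?thesis .
    qed
    have "emeasure (M \<Otimes>\<^sub>M M) {w \<in> space (M \<Otimes>\<^sub>M M). \<forall>i<n. X' i w \<in> B i} = emeasure M ?E1 * emeasure M ?E2"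
      unfolding eqE by (rule emeasure_pair_measure_Times[OF E1 E2])
    also have "emeasure M ?E1 = (\<Prod>i<k. emeasure (\<mu> i) (B i))"
      unfolding X_def \<mu>_def using t0 tmono B k by (intro emeasure_increments) auto
    also have "emeasure M ?E2 = (\<Prod>i<n - k. emeasure (inc_law (?t (Suc i) - ?t i)) (B (k + i)))"
      using tmono B k by (intro emeasure_increments) auto
    also have "\<dots> = (\<Prod>i<n - k. emeasure (\<mu> (k + i)) (B (k + i)))" by (simp add: \<mu>_def)
    also have "(\<Prod>i<k. emeasure (\<mu> i) (B i)) * (\<Prod>i<n - k. emeasure (\<mu> (k + i)) (B (k + i))) = (\<Prod>i<n. emeasure (\<mu> i) (B i))"
    proof -
      have "(\<Prod>i<n - k. emeasure (\<mu> (k + i)) (B (k + i))) = (\<Prod>i\<in>{k..<n}. emeasure (\<mu> i) (B i))"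
        using k by (intro prod.reindex_bij_witness[where i = "\<lambda>i. i - k" and j = "\<lambda>i. k + i"]) auto
      moreover have "{..<n} = {..<k} \<union> {k..<n}" using k by auto
      ultimately show ?thesis by (simp add: prod.union_disjoint ivl_disj_int)
    qed
    finally show "emeasure (M \<Otimes>\<^sub>M M) {w \<in> space (M \<Otimes>\<^sub>M M). \<forall>i<n. X' i w \<in> B i} = (\<Prod>i<n. emeasure (\<mu> i) (B i))" .
  qed (use X'm in \<open>auto simp: \<mu>_def prob_space_inc_law\<close>)
  have sumX: "Lp 0 \<omega> (t j) = (\<Sum>i<j. X i \<omega>)" if "j \<le> n" for j \<omega>
    using that tnn[of j] sum_lessThan_telescope[of "\<lambda>i. L (t i) \<omega>" j] t0 by (simp add: Lp_def X_def)
  have sumX': "concat_path s (Lp 0 (fst w)) (Lp 0 (snd w)) (t j) = (\<Sum>i<j. X' i w)" if "j \<le> n" for j w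
  proof (cases "j \<le> k")
    case True
    then have "t j \<le> s" using tmono'[of j k] k by simp
    then have "concat_path s (Lp 0 (fst w)) (Lp 0 (snd w)) (t j) = Lp 0 (fst w) (t j)"
      using tnn[OF that] by (simp add: concat_path_def)
    also have "\<dots> = (\<Sum>i<j. X' i w)" unfolding sumX[OF that] using True by (intro sum.cong) (auto simp: X'_def)
    finally show ?thesis .
  next
    case False
    then have *: "s < t j" using tmono[of k j] k that by simp
    have "(\<Sum>i<j. X' i w) = (\<Sum>i<k. X' i w) + (\<Sum>i\<in>{k..<j}. X' i w)"
      using False sum.union_disjoint[of "{..<k}" "{k..<j}" "\<lambda>i. X' i w"] ivl_disj_un_one(2)[of k j] by (simp add: ivl_disj_int)
    also have "(\<Sum>i<k. X' i w) = Lp 0 (fst w) s"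
      using sumX[OF k(1), of "fst w"] k by (simp add: X'_def)
    also have "(\<Sum>i\<in>{k..<j}. X' i w) = (\<Sum>i\<in>{k..<j}. L (t (Suc i) - s) (snd w) - L (t i - s) (snd w))"
      by (intro sum.cong) (auto simp: X'_def)
    also have "\<dots> = L (t j - s) (snd w) - L 0 (snd w)"
      using False k sum_Suc_diff'[of k j "\<lambda>i. L (t i - s) (snd w)"] by simp
    finally show ?thesis using * s by (simp add: concat_path_def Lp_def)
  qed
  have "emeasure M {\<omega> \<in> space M. \<forall>u\<in>J. Lp 0 \<omega> u \<in> A u} = emeasure (distr M P (\<lambda>\<omega>. \<lambda>i\<in>{..<n}. X i \<omega>)) E"
  proof -
    have "(\<lambda>\<omega>. \<lambda>i\<in>{..<n}. X i \<omega>) \<in> measurable M P"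
      unfolding P_def by (rule measurable_restrict) (use Xm in auto)
    then have "emeasure (distr M P (\<lambda>\<omega>. \<lambda>i\<in>{..<n}. X i \<omega>)) E = emeasure M ((\<lambda>\<omega>. \<lambda>i\<in>{..<n}. X i \<omega>) -` E \<inter> space M)"
      using E by (rule emeasure_distr)
    moreover have "(\<lambda>\<omega>. \<lambda>i\<in>{..<n}. X i \<omega>) -` E \<inter> space M = {\<omega> \<in> space M. \<forall>u\<in>J. Lp 0 \<omega> u \<in> A u}"
    proof (intro set_eqI)
      fix \<omega>
      have "Lp 0 \<omega> u = (\<Sum>i<ix u. (\<lambda>i\<in>{..<n}. X i \<omega>) i)" if "u \<in> J" for u
        using sumX[of "ix u" \<omega>] ix[OF that] by (auto intro!: sum.cong)
      moreover have "(\<lambda>i\<in>{..<n}. X i \<omega>) \<in> space P" by (simp add: P_def space_PiM)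
      ultimately show "\<omega> \<in> (\<lambda>\<omega>. \<lambda>i\<in>{..<n}. X i \<omega>) -` E \<inter> space M \<longleftrightarrow> \<omega> \<in> {\<omega> \<in> space M. \<forall>u\<in>J. Lp 0 \<omega> u \<in> A u}"
        by (simp add: E_def conj_commute)
    qed
    ultimately show ?thesis by simp
  qed
  also have "\<dots> = emeasure (distr (M \<Otimes>\<^sub>M M) P (\<lambda>w. \<lambda>i\<in>{..<n}. X' i w)) E" by (simp add: d1 d2)
  also have "\<dots> = emeasure (M \<Otimes>\<^sub>M M) {w \<in> space (M \<Otimes>\<^sub>M M). \<forall>u\<in>J. concat_path s (Lp 0 (fst w)) (Lp 0 (snd w)) u \<in> A u}"
  proof -
    have "(\<lambda>w. \<lambda>i\<in>{..<n}. X' i w) \<in> measurable (M \<Otimes>\<^sub>M M) P"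
      unfolding P_def by (rule measurable_restrict) (use X'm in auto)
    then have "emeasure (distr (M \<Otimes>\<^sub>M M) P (\<lambda>w. \<lambda>i\<in>{..<n}. X' i w)) E = emeasure (M \<Otimes>\<^sub>M M) ((\<lambda>w. \<lambda>i\<in>{..<n}. X' i w) -` E \<inter> space (M \<Otimes>\<^sub>M M))"
      using E by (rule emeasure_distr)
    moreover have "(\<lambda>w. \<lambda>i\<in>{..<n}. X' i w) -` E \<inter> space (M \<Otimes>\<^sub>M M)
       = {w \<in> space (M \<Otimes>\<^sub>M M). \<forall>u\<in>J. concat_path s (Lp 0 (fst w)) (Lp 0 (snd w)) u \<in> A u}"
    proof (intro set_eqI)
      fix w
      have "concat_path s (Lp 0 (fst w)) (Lp 0 (snd w)) u = (\<Sum>i<ix u. (\<lambda>i\<in>{..<n}. X' i w) i)" if "u \<in> J" for u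
        using sumX'[of "ix u" w] ix[OF that] by (auto intro!: sum.cong)
      moreover have "(\<lambda>i\<in>{..<n}. X' i w) \<in> space P" by (simp add: P_def space_PiM)
      ultimately show "w \<in> (\<lambda>w. \<lambda>i\<in>{..<n}. X' i w) -` E \<inter> space (M \<Otimes>\<^sub>M M)
         \<longleftrightarrow> w \<in> {w \<in> space (M \<Otimes>\<^sub>M M). \<forall>u\<in>J. concat_path s (Lp 0 (fst w)) (Lp 0 (snd w)) u \<in> A u}"
        by (simp add: E_def conj_commute)
    qed
    ultimately show ?thesis by simp
  qed
  finally show ?thesis .
qed

text \<open>Laws on \<open>paths\<close> are determined by finitely many coordinates, so
  \<open>concat_law_aux\<close> suffices. This identity carries independence and stationarity of the
  increments into the Markov arguments.\<close>

lemma concat_law: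
  assumes s: "0 \<le> s"
  shows "distr (path_law \<Otimes>\<^sub>M path_law) paths (\<lambda>(x, x'). concat_path s x x') = path_law"
proof -
  interpret Q: prob_space path_law by (rule prob_space_path_law)
  interpret QQ: pair_prob_space path_law path_law by standard
  interpret MM: pair_prob_space M M by standard
  let ?c = "\<lambda>w. concat_path s (Lp 0 (fst w)) (Lp 0 (snd w))"
  have cm: "(\<lambda>(x, x'). concat_path s x x') \<in> measurable (paths \<Otimes>\<^sub>M paths) paths" by (rule measurable_concat_path[OF s])
  have lm: "(\<lambda>(x, y). (Lp 0 x, Lp 0 y)) \<in> measurable (M \<Otimes>\<^sub>M M) (paths \<Otimes>\<^sub>M paths)" by measurable
  have "path_law \<Otimes>\<^sub>M path_law = distr (M \<Otimes>\<^sub>M M) (paths \<Otimes>\<^sub>M paths) (\<lambda>(x, y). (Lp 0 x, Lp 0 y))"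
    using Q.sigma_finite_measure_axioms unfolding path_law_def by (intro pair_measure_distr) auto
  then have eq: "distr (path_law \<Otimes>\<^sub>M path_law) paths (\<lambda>(x, x'). concat_path s x x') = distr (M \<Otimes>\<^sub>M M) paths ?c"
    using distr_distr[OF cm lm] by (simp add: comp_def split_beta)
  have ccm: "?c \<in> measurable (M \<Otimes>\<^sub>M M) paths"
    using measurable_compose[OF lm cm] by (simp add: split_beta)
  have "distr (M \<Otimes>\<^sub>M M) paths ?c = path_law"
  proof (rule measure_eqI_PiM_infinite)
    show "sets (distr (M \<Otimes>\<^sub>M M) paths ?c) = sets (PiM {0..} (\<lambda>_. borel))" by (simp add: paths_def)
    show "sets path_law = sets (PiM {0..} (\<lambda>_. borel))" by (simp add: paths_def)
    show "finite_measure (distr (M \<Otimes>\<^sub>M M) paths ?c)"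
      using MM.prob_space_distr[OF ccm] by (simp add: prob_space_def)
    fix A :: "real \<Rightarrow> real set" and J :: "real set"
    assume J: "finite J" "J \<subseteq> {0..}" and A: "\<And>i. i \<in> J \<Longrightarrow> A i \<in> sets borel"
    let ?X = "prod_emb {0..} (\<lambda>_. borel) J (Pi\<^sub>E J A)"
    have X: "?X \<in> sets paths" unfolding paths_def by (rule sets_PiM_I) (use J A in auto)
    have in_X: "x \<in> ?X \<longleftrightarrow> (\<forall>u\<in>J. x u \<in> A u)" if "x \<in> space paths" for x
      using that J by (auto simp: prod_emb_def space_paths PiE_iff)
    have 1: "?c -` ?X \<inter> space (M \<Otimes>\<^sub>M M) = {w \<in> space (M \<Otimes>\<^sub>M M). \<forall>u\<in>J. ?c w u \<in> A u}"
      using in_X[OF measurable_space[OF ccm]] by auto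
    have 2: "Lp 0 -` ?X \<inter> space M = {\<omega> \<in> space M. \<forall>u\<in>J. Lp 0 \<omega> u \<in> A u}"
      using in_X[OF measurable_space[OF Lp_measurable[OF order_refl]]] by auto
    have "emeasure (distr (M \<Otimes>\<^sub>M M) paths ?c) ?X = emeasure (M \<Otimes>\<^sub>M M) {w \<in> space (M \<Otimes>\<^sub>M M). \<forall>u\<in>J. ?c w u \<in> A u}"
      unfolding emeasure_distr[OF ccm X] 1 ..
    also have "\<dots> = emeasure M {\<omega> \<in> space M. \<forall>u\<in>J. Lp 0 \<omega> u \<in> A u}"
      by (rule concat_law_aux[OF s J A, symmetric])
    also have "\<dots> = emeasure path_law ?X"
      unfolding path_law_def emeasure_distr[OF Lp_measurable[OF order_refl] X] 2 ..
    finally show "emeasure (distr (M \<Otimes>\<^sub>M M) paths ?c) ?X = emeasure path_law ?X" .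
  qed
  then show ?thesis using eq by simp
qed

lemma nn_integral_path_law:
  assumes "h \<in> borel_measurable paths"
  shows "(\<integral>\<^sup>+x. h x \<partial>path_law) = (\<integral>\<^sup>+\<omega>. h (Lp 0 \<omega>) \<partial>M)"
  unfolding path_law_def using assms by (intro nn_integral_distr) auto

lemma nn_integral_concat:
  assumes s: "0 \<le> s" and h: "h \<in> borel_measurable paths"
  shows "(\<integral>\<^sup>+x. h x \<partial>path_law) = (\<integral>\<^sup>+x. \<integral>\<^sup>+x'. h (concat_path s x x') \<partial>path_law \<partial>path_law)"
proof -
  interpret Q: prob_space path_law by (rule prob_space_path_law)
  have cm: "(\<lambda>(x, x'). concat_path s x x') \<in> measurable (paths \<Otimes>\<^sub>M paths) paths" by (rule measurable_concat_path[OF s])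
  then have cm': "(\<lambda>(x, x'). concat_path s x x') \<in> measurable (path_law \<Otimes>\<^sub>M path_law) paths" by (simp cong: measurable_cong_sets sets_pair_measure_cong)
  have "(\<integral>\<^sup>+x. h x \<partial>path_law) = (\<integral>\<^sup>+x. h x \<partial>distr (path_law \<Otimes>\<^sub>M path_law) paths (\<lambda>(x, x'). concat_path s x x'))"
    by (simp add: concat_law[OF s])
  also have "\<dots> = (\<integral>\<^sup>+w. h (case w of (x, x') \<Rightarrow> concat_path s x x') \<partial>(path_law \<Otimes>\<^sub>M path_law))"
    by (rule nn_integral_distr[OF cm']) (use h in simp)
  also have "\<dots> = (\<integral>\<^sup>+x. \<integral>\<^sup>+x'. h (concat_path s x x') \<partial>path_law \<partial>path_law)"
    using measurable_compose[OF cm' h] by (subst Q.nn_integral_fst[symmetric]) auto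
  finally show ?thesis .
qed

lemma AE_path_law_0: "AE x in path_law. x 0 = 0"
  unfolding path_law_def
proof (subst AE_distr_iff)
  show "{x \<in> space paths. x 0 = 0} \<in> sets paths"
    using measurable_sets[OF measurable_path_eval[OF order_refl], of "{0}"] by (simp add: vimage_def Int_def conj_commute)
qed (auto simp: Lp_def)

text \<open>The glued path takes the value \<open>x s\<close> at time \<open>s\<close>, so the
  initial value of \<open>x'\<close> can be recovered only if it is 0.\<close>

lemma shift_concat:
  assumes "0 \<le> s" "x' \<in> extensional {0..}" "x' 0 = 0"
  shows "shift_path s (concat_path s x x') = x'"
proof
  fix u
  show "shift_path s (concat_path s x x') u = x' u"
    using assms by (cases "0 \<le> u"; cases "u = 0") (auto simp: shift_path_def concat_path_def extensional_def)
qed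

end

section \<open>Markov property with an independent starting value\<close>

definition independent_start :: "'w measure \<Rightarrow> (real \<Rightarrow> 'w \<Rightarrow> real) \<Rightarrow> ('w \<Rightarrow> 'b::topological_space) \<Rightarrow> bool" where
  "independent_start M L Z \<longleftrightarrow> Z \<in> borel_measurable M \<and> indep_of_process M Z L"

context levy
begin

text \<open>Independence is given for the raw paths of \<open>L\<close>; it passes to
  \<open>Lp 0\<close>, which is the measurable image of the raw path under
  \<open>shift_path 0\<close>.\<close>

lemma distr_start_path:
  fixes Z :: "'w \<Rightarrow> 'b::{second_countable_topology, topological_space}"
  assumes "independent_start M L Z"
  shows "distr M (borel \<Otimes>\<^sub>M paths) (\<lambda>\<omega>. (Z \<omega>, Lp 0 \<omega>)) = distr M borel Z \<Otimes>\<^sub>M path_law"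
proof -
  let ?R = "\<lambda>\<omega>. \<lambda>t\<in>{0..}. L t \<omega>"
  have Z: "Z \<in> borel_measurable M" and ind: "indep_of_process M Z L" using assms by (auto simp: independent_start_def)
  have R: "?R \<in> measurable M paths"
    unfolding paths_def by (rule measurable_restrict) auto
  have Lp: "Lp 0 \<omega> = shift_path 0 (?R \<omega>)" for \<omega> by (auto simp: shift_path_def Lp_def)
  interpret Q: prob_space path_law by (rule prob_space_path_law)
  interpret D: prob_space "distr M borel Z" by (rule prob_space_distr[OF Z])
  have ZL: "(\<lambda>\<omega>. (Z \<omega>, Lp 0 \<omega>)) \<in> measurable M (borel \<Otimes>\<^sub>M paths)" using Z by measurable
  have "distr M borel Z \<Otimes>\<^sub>M path_law = distr M (borel \<Otimes>\<^sub>M paths) (\<lambda>\<omega>. (Z \<omega>, Lp 0 \<omega>))"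
  proof (rule pair_measure_eqI)
    show "sets (distr M borel Z \<Otimes>\<^sub>M path_law) = sets (distr M (borel \<Otimes>\<^sub>M paths) (\<lambda>\<omega>. (Z \<omega>, Lp 0 \<omega>)))"
      by (simp cong: sets_pair_measure_cong)
    fix A B assume "A \<in> sets (distr M borel Z)" "B \<in> sets path_law"
    then have A: "A \<in> sets borel" and B: "B \<in> sets paths" by simp_all
    let ?B = "shift_path 0 -` B \<inter> space paths"
    have B': "?B \<in> sets paths" by (rule measurable_sets[OF measurable_shift_path[OF order_refl] B])
    have eqB: "Lp 0 -` B \<inter> space M = ?R -` ?B \<inter> space M"
      using measurable_space[OF R] by (auto simp: Lp)
    have "Z -` A \<inter> space M \<in> sets (vimage_algebra (space M) Z borel)"
      by (rule in_vimage_algebra[OF A])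
    moreover have "?R -` ?B \<inter> space M \<in> sets (vimage_algebra (space M) ?R (\<Pi>\<^sub>M t\<in>{0..}. borel))"
      using B' unfolding paths_def by (rule in_vimage_algebra)
    ultimately have "prob ((Z -` A \<inter> space M) \<inter> (?R -` ?B \<inter> space M)) = prob (Z -` A \<inter> space M) * prob (?R -` ?B \<inter> space M)"
      using ind unfolding indep_of_process_def by (intro indep_setD)
    then have "prob (Z -` A \<inter> space M) * prob (Lp 0 -` B \<inter> space M) = prob ((\<lambda>\<omega>. (Z \<omega>, Lp 0 \<omega>)) -` (A \<times> B) \<inter> space M)"
      unfolding eqB[symmetric] by (simp add: vimage_Times Int_ac comp_def)
    then show "emeasure (distr M borel Z) A * emeasure path_law B = emeasure (distr M (borel \<Otimes>\<^sub>M paths) (\<lambda>\<omega>. (Z \<omega>, Lp 0 \<omega>))) (A \<times> B)"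
      using A B Z ZL unfolding path_law_def by (simp add: emeasure_distr emeasure_eq_measure ennreal_mult[symmetric])
  qed (unfold_locales)
  then show ?thesis ..
qed

lemma nn_integral_start_path:
  fixes Z :: "'w \<Rightarrow> 'b::{second_countable_topology, topological_space}"
  assumes Z: "independent_start M L Z" and h: "h \<in> borel_measurable (borel \<Otimes>\<^sub>M paths)"
  shows "(\<integral>\<^sup>+\<omega>. h (Z \<omega>, Lp 0 \<omega>) \<partial>M) = (\<integral>\<^sup>+\<omega>. \<integral>\<^sup>+x. h (Z \<omega>, x) \<partial>path_law \<partial>M)"
proof -
  interpret Q: prob_space path_law by (rule prob_space_path_law)
  have Zm [measurable]: "Z \<in> borel_measurable M" using Z by (simp add: independent_start_def)
  have "(\<integral>\<^sup>+\<omega>. h (Z \<omega>, Lp 0 \<omega>) \<partial>M) = (\<integral>\<^sup>+w. h w \<partial>distr M (borel \<Otimes>\<^sub>M paths) (\<lambda>\<omega>. (Z \<omega>, Lp 0 \<omega>)))"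
    using h by (intro nn_integral_distr[symmetric]) auto
  also have "\<dots> = (\<integral>\<^sup>+w. h w \<partial>(distr M borel Z \<Otimes>\<^sub>M path_law))" by (simp add: distr_start_path[OF Z])
  also have "\<dots> = (\<integral>\<^sup>+z. \<integral>\<^sup>+x. h (z, x) \<partial>path_law \<partial>distr M borel Z)"
    using h by (intro Q.nn_integral_fst[symmetric]) (simp cong: measurable_cong_sets sets_pair_measure_cong)
  also have "\<dots> = (\<integral>\<^sup>+\<omega>. \<integral>\<^sup>+x. h (Z \<omega>, x) \<partial>path_law \<partial>M)"
    using h by (intro nn_integral_distr) (auto intro!: Q.borel_measurable_nn_integral simp: split_beta cong: measurable_cong_sets sets_pair_measure_cong)
  finally show ?thesis .
qed

text \<open>The path law is replaced by the law of a glued path. By locality \<Phi> sees only the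
  first piece, and the shift recovers the second piece, which is an independent copy.\<close>

lemma markov:
  fixes Z :: "'w \<Rightarrow> 'b::{second_countable_topology, topological_space}"
    and X :: "'w \<Rightarrow> 'c::{second_countable_topology, topological_space}"
  assumes s: "0 \<le> s" and Z: "independent_start M L Z"
    and X: "AE \<omega> in M. X \<omega> = \<Phi> (Z \<omega>) (Lp 0 \<omega>)"
    and \<Phi>: "(\<lambda>(z, x). \<Phi> z x) \<in> measurable (borel \<Otimes>\<^sub>M paths) borel"
    and \<Phi>_local: "\<And>z x x'. (\<And>u. 0 \<le> u \<Longrightarrow> u \<le> s \<Longrightarrow> x u = x' u) \<Longrightarrow> \<Phi> z x = \<Phi> z x'"
    and h: "h \<in> borel_measurable (borel \<Otimes>\<^sub>M paths)"
  shows "(\<integral>\<^sup>+\<omega>. h (X \<omega>, Lp s \<omega>) \<partial>M) = (\<integral>\<^sup>+\<omega>. \<integral>\<^sup>+x. h (X \<omega>, x) \<partial>path_law \<partial>M)"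
proof -
  interpret Q: prob_space path_law by (rule prob_space_path_law)
  have \<Phi>m: "(\<lambda>w. \<Phi> (fst w) (snd w)) \<in> measurable (borel \<Otimes>\<^sub>M paths) borel" using \<Phi> by (simp add: split_beta)
  have h1: "(\<lambda>w. h (\<Phi> (fst w) (snd w), shift_path s (snd w))) \<in> borel_measurable (borel \<Otimes>\<^sub>M paths)"
    using \<Phi>m measurable_shift_path[OF s] by (intro measurable_compose[OF _ h] measurable_Pair) (auto intro: measurable_compose[OF measurable_snd])
  have h2: "(\<lambda>w. \<integral>\<^sup>+x'. h (\<Phi> (fst w) (snd w), x') \<partial>path_law) \<in> borel_measurable (borel \<Otimes>\<^sub>M paths)"
  proof -
    have "(\<lambda>c. \<integral>\<^sup>+x'. h (c, x') \<partial>path_law) \<in> borel_measurable borel"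
      using h by (intro Q.borel_measurable_nn_integral) (simp add: split_beta cong: measurable_cong_sets sets_pair_measure_cong)
    from measurable_compose[OF \<Phi>m this] show ?thesis .
  qed
  have "(\<integral>\<^sup>+\<omega>. h (X \<omega>, Lp s \<omega>) \<partial>M) = (\<integral>\<^sup>+\<omega>. h (\<Phi> (Z \<omega>) (Lp 0 \<omega>), shift_path s (Lp 0 \<omega>)) \<partial>M)"
    using X by (intro nn_integral_cong_AE) (auto simp: shift_Lp[OF s])
  also have "\<dots> = (\<integral>\<^sup>+\<omega>. \<integral>\<^sup>+x. h (\<Phi> (Z \<omega>) x, shift_path s x) \<partial>path_law \<partial>M)"
    using nn_integral_start_path[OF Z h1] by simp
  also have "\<dots> = (\<integral>\<^sup>+\<omega>. \<integral>\<^sup>+x. \<integral>\<^sup>+x'. h (\<Phi> (Z \<omega>) x, x') \<partial>path_law \<partial>path_law \<partial>M)"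
  proof (rule nn_integral_cong)
    fix \<omega>
    have hm: "(\<lambda>x. h (\<Phi> (Z \<omega>) x, shift_path s x)) \<in> borel_measurable paths"
      using measurable_compose[OF measurable_Pair1' h1, of "Z \<omega>"] by simp
    have "(\<integral>\<^sup>+x. h (\<Phi> (Z \<omega>) x, shift_path s x) \<partial>path_law)
       = (\<integral>\<^sup>+x. \<integral>\<^sup>+x'. h (\<Phi> (Z \<omega>) (concat_path s x x'), shift_path s (concat_path s x x')) \<partial>path_law \<partial>path_law)"
      by (rule nn_integral_concat[OF s hm])
    also have "\<dots> = (\<integral>\<^sup>+x. \<integral>\<^sup>+x'. h (\<Phi> (Z \<omega>) x, x') \<partial>path_law \<partial>path_law)"
    proof (rule nn_integral_cong, rule nn_integral_cong_AE)
      fix x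
      show "AE x' in path_law. h (\<Phi> (Z \<omega>) (concat_path s x x'), shift_path s (concat_path s x x')) = h (\<Phi> (Z \<omega>) x, x')"
        using AE_path_law_0 AE_space
      proof eventually_elim
        case (elim x')
        have "\<Phi> (Z \<omega>) (concat_path s x x') = \<Phi> (Z \<omega>) x"
          by (rule \<Phi>_local) (simp add: concat_path_def)
        then show ?case using elim shift_concat[OF s, of x' x] by (simp add: space_paths)
      qed
    qed
    finally show "(\<integral>\<^sup>+x. h (\<Phi> (Z \<omega>) x, shift_path s x) \<partial>path_law)
       = (\<integral>\<^sup>+x. \<integral>\<^sup>+x'. h (\<Phi> (Z \<omega>) x, x') \<partial>path_law \<partial>path_law)" .
  qed
  also have "\<dots> = (\<integral>\<^sup>+\<omega>. \<integral>\<^sup>+x'. h (\<Phi> (Z \<omega>) (Lp 0 \<omega>), x') \<partial>path_law \<partial>M)"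
    using nn_integral_start_path[OF Z h2] by simp
  also have "\<dots> = (\<integral>\<^sup>+\<omega>. \<integral>\<^sup>+x. h (X \<omega>, x) \<partial>path_law \<partial>M)"
    using X by (intro nn_integral_cong_AE) auto
  finally show ?thesis .
qed

text \<open>\<open>markov\<close> for indicators, restated as an identity of joint laws. In this
  form it applies to real-valued integrands and to images under measurable maps.\<close>

lemma distr_markov:
  fixes Z :: "'w \<Rightarrow> 'b::{second_countable_topology, topological_space}"
    and X :: "'w \<Rightarrow> 'c::{second_countable_topology, topological_space}"
  assumes "0 \<le> s" "independent_start M L Z"
    and "AE \<omega> in M. X \<omega> = \<Phi> (Z \<omega>) (Lp 0 \<omega>)"
    and "(\<lambda>(z, x). \<Phi> z x) \<in> measurable (borel \<Otimes>\<^sub>M paths) borel"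
    and "\<And>z x x'. (\<And>u. 0 \<le> u \<Longrightarrow> u \<le> s \<Longrightarrow> x u = x' u) \<Longrightarrow> \<Phi> z x = \<Phi> z x'"
    and X: "X \<in> borel_measurable M"
  shows "distr M (borel \<Otimes>\<^sub>M paths) (\<lambda>\<omega>. (X \<omega>, Lp s \<omega>)) = distr M borel X \<Otimes>\<^sub>M path_law"
proof (rule measure_eqI)
  interpret Q: prob_space path_law by (rule prob_space_path_law)
  fix A assume "A \<in> sets (distr M (borel \<Otimes>\<^sub>M paths) (\<lambda>\<omega>. (X \<omega>, Lp s \<omega>)))"
  then have A [measurable]: "A \<in> sets (borel \<Otimes>\<^sub>M paths)" by simp
  have [measurable]: "X \<in> borel_measurable M" "Lp s \<in> measurable M paths" using X assms(1) by auto
  have "emeasure (distr M (borel \<Otimes>\<^sub>M paths) (\<lambda>\<omega>. (X \<omega>, Lp s \<omega>))) A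
    = (\<integral>\<^sup>+w. indicator A w \<partial>distr M (borel \<Otimes>\<^sub>M paths) (\<lambda>\<omega>. (X \<omega>, Lp s \<omega>)))" using A by simp
  also have "\<dots> = (\<integral>\<^sup>+\<omega>. indicator A (X \<omega>, Lp s \<omega>) \<partial>M)"
    by (rule nn_integral_distr) auto
  also have "\<dots> = (\<integral>\<^sup>+\<omega>. \<integral>\<^sup>+x. indicator A (X \<omega>, x) \<partial>path_law \<partial>M)"
    by (rule markov[OF assms(1-5)]) auto
  also have "\<dots> = (\<integral>\<^sup>+z. \<integral>\<^sup>+x. indicator A (z, x) \<partial>path_law \<partial>distr M borel X)"
    by (intro nn_integral_distr[symmetric] X Q.borel_measurable_nn_integral)
      (simp cong: measurable_cong_sets sets_pair_measure_cong)
  also have "\<dots> = emeasure (distr M borel X \<Otimes>\<^sub>M path_law) A"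
    by (rule Q.emeasure_pair_measure[symmetric]) (use A in \<open>simp cong: sets_pair_measure_cong\<close>)
  finally show "emeasure (distr M (borel \<Otimes>\<^sub>M paths) (\<lambda>\<omega>. (X \<omega>, Lp s \<omega>))) A = emeasure (distr M borel X \<Otimes>\<^sub>M path_law) A" .
qed (simp cong: sets_pair_measure_cong)

text \<open>Stationarity of the whole increment process, not of single increments: the shift of a
  glued path is its second piece.\<close>

lemma nn_integral_Lp:
  assumes s: "0 \<le> s" and h: "h \<in> borel_measurable paths"
  shows "(\<integral>\<^sup>+\<omega>. h (Lp s \<omega>) \<partial>M) = (\<integral>\<^sup>+\<omega>. h (Lp 0 \<omega>) \<partial>M)"
proof -
  interpret Q: prob_space path_law by (rule prob_space_path_law)
  have hs: "(\<lambda>x. h (shift_path s x)) \<in> borel_measurable paths"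
    by (rule measurable_compose[OF measurable_shift_path[OF s] h])
  have "(\<integral>\<^sup>+\<omega>. h (Lp s \<omega>) \<partial>M) = (\<integral>\<^sup>+x. h (shift_path s x) \<partial>path_law)"
    by (simp add: nn_integral_path_law[OF hs] shift_Lp[OF s])
  also have "\<dots> = (\<integral>\<^sup>+x. \<integral>\<^sup>+x'. h (shift_path s (concat_path s x x')) \<partial>path_law \<partial>path_law)"
    by (rule nn_integral_concat[OF s hs])
  also have "\<dots> = (\<integral>\<^sup>+x. \<integral>\<^sup>+x'. h x' \<partial>path_law \<partial>path_law)"
  proof (rule nn_integral_cong, rule nn_integral_cong_AE)
    fix x
    show "AE x' in path_law. h (shift_path s (concat_path s x x')) = h x'"
      using AE_path_law_0 AE_space
      by eventually_elim (simp add: shift_concat[OF s] space_paths)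
  qed
  also have "\<dots> = (\<integral>\<^sup>+\<omega>. h (Lp 0 \<omega>) \<partial>M)"
    by (simp add: Q.emeasure_space_1[simplified] nn_integral_path_law[OF h])
  finally show ?thesis .
qed

end

section \<open>Logarithmic moments of the jumps\<close>

lemma suminf_indicator_less:
  "(\<Sum>j. (of_bool (real j + 1 < x) :: ennreal)) = of_nat (nat (\<lceil>x\<rceil> - 1))"
proof -
  have "real j + 1 < x \<longleftrightarrow> j < nat (\<lceil>x\<rceil> - 1)" for j by linarith
  then have "(\<Sum>j. (of_bool (real j + 1 < x) :: ennreal)) = (\<Sum>j<nat (\<lceil>x\<rceil> - 1). of_bool (real j + 1 < x))"
    by (intro suminf_finite) auto
  also have "\<dots> = (\<Sum>j<nat (\<lceil>x\<rceil> - 1). 1)"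
    by (intro sum.cong) (auto, linarith)
  finally show ?thesis by simp
qed

text \<open>For positive \<open>g\<close> this is the largest multiple of 2^-m strictly below
  \<open>g\<close>, written as a sum over the levels that \<open>g\<close> exceeds. Later each level
  becomes a condition on the size of a jump.\<close>

definition dyadic_layers :: "nat \<Rightarrow> real \<Rightarrow> ennreal" where
  "dyadic_layers m g = (\<Sum>j. ennreal (1 / 2 ^ m) * of_bool ((real j + 1) / 2 ^ m < g))"

lemma dyadic_layers_eq:
  "dyadic_layers m g = ennreal (real (nat (\<lceil>g * 2 ^ m\<rceil> - 1)) / 2 ^ m)"
proof -
  have "(real j + 1) / 2 ^ m < g \<longleftrightarrow> real j + 1 < g * 2 ^ m" for j by (simp add: field_simps)
  then have "dyadic_layers m g = ennreal (1 / 2 ^ m) * (\<Sum>j. of_bool (real j + 1 < g * 2 ^ m))"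
    unfolding dyadic_layers_def by (simp add: ennreal_suminf_cmult)
  also have "\<dots> = ennreal (1 / 2 ^ m) * ennreal (real (nat (\<lceil>g * 2 ^ m\<rceil> - 1)))"
    unfolding suminf_indicator_less by (simp add: ennreal_of_nat_eq_real_of_nat)
  also have "\<dots> = ennreal (real (nat (\<lceil>g * 2 ^ m\<rceil> - 1)) / 2 ^ m)" by (simp add: ennreal_mult[symmetric])
  finally show ?thesis .
qed

lemma dyadic_layers_le: "dyadic_layers m g \<le> ennreal g"
proof (cases "0 \<le> g")
  case True
  have "real (nat (\<lceil>g * 2 ^ m\<rceil> - 1)) \<le> g * 2 ^ m"
  proof -
    have "0 \<le> g * 2 ^ m" using True by simp
    moreover have "of_int \<lceil>x\<rceil> - 1 < x" for x :: real by linarith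
    ultimately show ?thesis by (cases "\<lceil>g * 2 ^ m\<rceil> \<ge> 1") (auto simp: less_imp_le)
  qed
  then show ?thesis unfolding dyadic_layers_eq by (intro ennreal_leI) (simp add: field_simps)
next
  case False
  then have "g * 2 ^ m < 0" by (simp add: mult_neg_pos)
  then have "\<lceil>g * 2 ^ m\<rceil> - 1 \<le> 0" by linarith
  then show ?thesis unfolding dyadic_layers_eq by simp
qed

lemma dyadic_layers_tendsto:
  assumes "0 \<le> g"
  shows "(\<lambda>m. dyadic_layers m g) \<longlonglongrightarrow> ennreal g"
proof -
  have "(\<lambda>m. real (nat (\<lceil>g * 2 ^ m\<rceil> - 1)) / 2 ^ m) \<longlonglongrightarrow> g"
  proof (rule tendsto_sandwich)
    have "(\<lambda>m. g - 1 / 2 ^ m) \<longlonglongrightarrow> g - 0" by (intro tendsto_intros mesh_tendsto_0)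
    then show "(\<lambda>m. g - 1 / 2 ^ m) \<longlonglongrightarrow> g" by simp
    show "eventually (\<lambda>m. g - 1 / 2 ^ m \<le> real (nat (\<lceil>g * 2 ^ m\<rceil> - 1)) / 2 ^ m) sequentially"
    proof (intro always_eventually allI)
      fix m
      have "g * 2 ^ m - 1 \<le> real (nat (\<lceil>g * 2 ^ m\<rceil> - 1))" by linarith
      from divide_right_mono[OF this, of "2 ^ m"]
      show "g - 1 / 2 ^ m \<le> real (nat (\<lceil>g * 2 ^ m\<rceil> - 1)) / 2 ^ m" by (simp add: diff_divide_distrib)
    qed
    show "eventually (\<lambda>m. real (nat (\<lceil>g * 2 ^ m\<rceil> - 1)) / 2 ^ m \<le> g) sequentially"
      using dyadic_layers_le[of _ g] assms by (intro always_eventually allI) (simp add: dyadic_layers_eq)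
  qed simp
  then show ?thesis unfolding dyadic_layers_eq by (rule tendsto_ennrealI)
qed

context levy
begin

lemma AE_cadlag: "AE \<omega> in M. cadlag (\<lambda>t. L t \<omega>)"
  using levy_process by (simp add: levy_process_def)

lemma jsum_Lp:
  assumes "0 \<le> s" "0 \<le> u" "u \<le> v"
  shows "jsum \<phi> (Lp s \<omega>) u v = jsum \<phi> (\<lambda>t. L t \<omega>) (s + u) (s + v)"
  by (rule jsum_cong[where c = "- L s \<omega>"])
    (use grid_nonneg[OF assms(2,3)] in \<open>simp add: Lp_def grid_shift\<close>)

lemma qvar_Lp:
  assumes "0 \<le> s" "0 \<le> u" "u \<le> v"
  shows "qvar (Lp s \<omega>) u v = qvar (\<lambda>t. L t \<omega>) (s + u) (s + v)"
  unfolding qvar_def jsum_Lp[OF assms] ..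

text \<open>The number of jumps above \<open>a\<close> is a supremum of jump sums of continuous
  functions, and these are measurable functionals of the path.\<close>

lemma jump_count:
  assumes \<nu>: "is_levy_measure M L \<nu>" and a: "0 < a"
  obtains N where "N \<in> borel_measurable M"
    "AE \<omega> in M. N \<omega> = (\<integral>\<^sup>+r. of_bool (a < \<bar>ljump (\<lambda>t. L t \<omega>) r\<bar>) \<partial>count_space {0<..1})"
    "(\<integral>\<^sup>+\<omega>. N \<omega> \<partial>M) = emeasure \<nu> {y. a < \<bar>y\<bar>}"
proof -
  \<comment> \<open>Ramps that vanish up to \<open>a\<close> and increase with \<open>k\<close> to
    the indicator of \<open>a < z\<close>; the strict inequality permits this approximation from
    below.\<close>
  define \<phi> where "\<phi> k z = min 1 (real k * max 0 (z - a))" for k z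
  have \<phi>c: "continuous_on UNIV (\<phi> k)" for k unfolding \<phi>_def by (intro continuous_intros)
  have \<phi>m: "\<phi> k z \<le> \<phi> k z'" if "z \<le> z'" for k z z'
    unfolding \<phi>_def using that by (intro min.mono mult_left_mono) auto
  have \<phi>k: "\<phi> k z \<le> \<phi> (Suc k) z" for k z
    unfolding \<phi>_def by (intro min.mono mult_right_mono) auto
  define N where "N \<omega> = (SUP k. jsum (\<phi> k) (Lp 0 \<omega>) 0 1)" for \<omega>
  have sup: "(SUP k. ennreal (\<phi> k z)) = of_bool (a < z)" for z
  proof (cases "a < z")
    case True
    obtain k where "1 < real k * (z - a)" using reals_Archimedean3[of "z - a"] True by auto
    then have "\<phi> k z = 1" using True by (simp add: \<phi>_def)
    then have "1 \<le> (SUP k. ennreal (\<phi> k z))" by (intro SUP_upper2[of k]) auto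
    moreover have "(SUP k. ennreal (\<phi> k z)) \<le> 1" by (intro SUP_least) (auto simp: \<phi>_def)
    ultimately show ?thesis using True by auto
  qed (simp add: \<phi>_def)
  have AE_N: "AE \<omega> in M. N \<omega> = (\<integral>\<^sup>+r. of_bool (a < \<bar>ljump (\<lambda>t. L t \<omega>) r\<bar>) \<partial>count_space {0<..1})"
    using AE_cadlag
  proof eventually_elim
    case (elim \<omega>)
    have "N \<omega> = (SUP k. \<integral>\<^sup>+r. ennreal (\<phi> k \<bar>ljump (\<lambda>t. L t \<omega>) r\<bar>) \<partial>count_space {0<..1})"
      unfolding N_def using \<phi>m a by (simp add: jsum_Lp jsum_eq[OF elim _ _ \<phi>c] \<phi>_def)
    also have "\<dots> = (\<integral>\<^sup>+r. (SUP k. ennreal (\<phi> k \<bar>ljump (\<lambda>t. L t \<omega>) r\<bar>)) \<partial>count_space {0<..1})"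
      by (intro nn_integral_monotone_convergence_SUP[symmetric] incseq_SucI le_funI ennreal_leI \<phi>k) simp
    finally show ?case unfolding sup .
  qed
  have meas: "N \<in> borel_measurable M"
  proof -
    have "(\<lambda>\<omega>. jsum (\<phi> k) (Lp 0 \<omega>) 0 1) \<in> borel_measurable M" for k
      by (rule measurable_compose[OF Lp_measurable measurable_jsum[OF _ _ \<phi>c]]) auto
    then show ?thesis unfolding N_def by measurable
  qed
  have "emeasure \<nu> {y. a < \<bar>y\<bar>} = (\<integral>\<^sup>+\<omega>. emeasure (count_space UNIV) {s \<in> {0<..1}. jump L s \<omega> \<noteq> 0 \<and> jump L s \<omega> \<in> {y. a < \<bar>y\<bar>}} \<partial>M)"
    using \<nu> unfolding is_levy_measure_def by simp
  also have "\<dots> = (\<integral>\<^sup>+\<omega>. N \<omega> \<partial>M)"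
  proof (rule nn_integral_cong_AE)
    show "AE \<omega> in M. emeasure (count_space UNIV) {s \<in> {0<..1}. jump L s \<omega> \<noteq> 0 \<and> jump L s \<omega> \<in> {y. a < \<bar>y\<bar>}} = N \<omega>"
      using AE_N
    proof eventually_elim
      case (elim \<omega>)
      have "{s \<in> {0<..1}. jump L s \<omega> \<noteq> 0 \<and> jump L s \<omega> \<in> {y. a < \<bar>y\<bar>}} = {s \<in> {0<..1}. a < \<bar>ljump (\<lambda>t. L t \<omega>) s\<bar>}"
        using a by (auto simp: jump_eq_ljump)
      then have "emeasure (count_space UNIV) {s \<in> {0<..1}. jump L s \<omega> \<noteq> 0 \<and> jump L s \<omega> \<in> {y. a < \<bar>y\<bar>}}
        = (\<integral>\<^sup>+s. indicator {s \<in> {0<..1}. a < \<bar>ljump (\<lambda>t. L t \<omega>) s\<bar>} s \<partial>count_space UNIV)" by simp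
      also have "\<dots> = (\<integral>\<^sup>+s. of_bool (a < \<bar>ljump (\<lambda>t. L t \<omega>) s\<bar>) * indicator {0<..1} s \<partial>count_space UNIV)"
        by (intro nn_integral_cong) (auto simp: indicator_def)
      also have "\<dots> = (\<integral>\<^sup>+s. of_bool (a < \<bar>ljump (\<lambda>t. L t \<omega>) s\<bar>) \<partial>count_space {0<..1})"
        by (rule nn_integral_count_space_indicator[symmetric]) simp
      finally show ?case using elim by simp
    qed
  qed
  finally show thesis using that[OF meas AE_N] by simp
qed

text \<open>
  The integrand is approximated by combinations of the sets \<open>{y. a < \<bar>y\<bar>}\<close> only, since their jump
  counts are measurable up to null sets by the previous lemma (\<open>M\<close> need not be complete).
\<close>

lemma expected_log_jumps_le:
  assumes \<nu>: "is_levy_measure M L \<nu>" and c: "0 < c"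
  shows "(\<integral>\<^sup>+\<omega>. jsum (\<lambda>z. ln (1 + c * z\<^sup>2)) (Lp 0 \<omega>) 0 1 \<partial>M) \<le> (\<integral>\<^sup>+y. ennreal (ln (1 + c * y\<^sup>2)) \<partial>\<nu>)"
proof -
  have sets_\<nu>: "sets \<nu> = sets borel" using \<nu> by (simp add: is_levy_measure_def)
  define g where "g y = ln (1 + c * y\<^sup>2)" for y
  have g0: "0 \<le> g y" for y using c by (simp add: g_def)
  define q where "q m j = (real j + 1) / 2 ^ m" for m j :: nat
  \<comment> \<open>The size at which \<open>g\<close> reaches the level:
    \<open>ln (1 + c * (a m j)^2) = q m j\<close>.\<close>
  define a where "a m j = sqrt ((exp (q m j) - 1) / c)" for m j
  have q0: "0 < q m j" for m j by (simp add: q_def add_nonneg_pos)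
  have a0: "0 < a m j" for m j using q0[of m j] c by (simp add: a_def)
  have level: "q m j < g y \<longleftrightarrow> a m j < \<bar>y\<bar>" for m j y
  proof -
    have pos: "0 < 1 + c * y\<^sup>2" using c by (simp add: add_pos_nonneg)
    have "q m j < g y \<longleftrightarrow> exp (q m j) < 1 + c * y\<^sup>2"
      unfolding g_def using pos by (metis exp_less_cancel_iff exp_ln)
    also have "\<dots> \<longleftrightarrow> (exp (q m j) - 1) / c < \<bar>y\<bar>\<^sup>2" using c by (simp add: field_simps)
    also have "\<dots> \<longleftrightarrow> a m j < \<bar>y\<bar>"
    proof -
      have "\<bar>y\<bar> = sqrt (\<bar>y\<bar>\<^sup>2)" by simp
      then show ?thesis unfolding a_def by (metis real_sqrt_less_iff)
    qed
    finally show ?thesis .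
  qed
  have lay: "dyadic_layers m (g y) = (\<Sum>j. ennreal (1 / 2 ^ m) * of_bool (a m j < \<bar>y\<bar>))" for m y
    unfolding dyadic_layers_def level[symmetric] q_def ..
  define P where "P m j N \<longleftrightarrow> N \<in> borel_measurable M \<and>
    (AE \<omega> in M. N \<omega> = (\<integral>\<^sup>+r. of_bool (a m j < \<bar>ljump (\<lambda>t. L t \<omega>) r\<bar>) \<partial>count_space {0<..1})) \<and>
    (\<integral>\<^sup>+\<omega>. N \<omega> \<partial>M) = emeasure \<nu> {y. a m j < \<bar>y\<bar>}" for m j N
  have "\<exists>N. P m j N" for m j
    unfolding P_def by (rule jump_count[OF \<nu> a0[of m j]]) blast
  then have "\<forall>m j. \<exists>N. P m j N" by blast
  then obtain N where "\<forall>m j. P m j (N m j)" unfolding choice_iff by blast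
  then have N: "\<And>m j. N m j \<in> borel_measurable M"
    "\<And>m j. AE \<omega> in M. N m j \<omega> = (\<integral>\<^sup>+r. of_bool (a m j < \<bar>ljump (\<lambda>t. L t \<omega>) r\<bar>) \<partial>count_space {0<..1})"
    "\<And>m j. (\<integral>\<^sup>+\<omega>. N m j \<omega> \<partial>M) = emeasure \<nu> {y. a m j < \<bar>y\<bar>}"
    unfolding P_def by blast+
  have [measurable]: "N m j \<in> borel_measurable M" for m j by (rule N(1))
  have all: "AE \<omega> in M. \<forall>m j. N m j \<omega> = (\<integral>\<^sup>+r. of_bool (a m j < \<bar>ljump (\<lambda>t. L t \<omega>) r\<bar>) \<partial>count_space {0<..1})"
    using N(2) by (simp add: AE_all_countable)
  have "AE \<omega> in M. jsum g (Lp 0 \<omega>) 0 1 \<le> liminf (\<lambda>m. \<Sum>j. ennreal (1 / 2 ^ m) * N m j \<omega>)"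
    using all AE_cadlag
  proof eventually_elim
    case (elim \<omega>)
    let ?l = "ljump (\<lambda>t. L t \<omega>)"
    have "jsum g (Lp 0 \<omega>) 0 1 = (\<integral>\<^sup>+r. ennreal (g (?l r)) \<partial>count_space {0<..1})"
      using jsum_Lp[of 0 0 1 g \<omega>] jsum_ln_eq[OF elim(2) _ _ c, of 0 1] by (simp add: g_def[abs_def])
    \<comment> \<open>Fatou's lemma is applied twice, here to the sum over the jumps and below to
      the expectation. It loses only in the harmless direction, since an upper bound is
      wanted.\<close>
    also have "\<dots> = (\<integral>\<^sup>+r. liminf (\<lambda>m. dyadic_layers m (g (?l r))) \<partial>count_space {0<..1})"
      by (intro nn_integral_cong lim_imp_Liminf[symmetric] dyadic_layers_tendsto g0) simp
    also have "\<dots> \<le> liminf (\<lambda>m. \<integral>\<^sup>+r. dyadic_layers m (g (?l r)) \<partial>count_space {0<..1})"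
      by (rule nn_integral_liminf) simp
    also have "(\<lambda>m. \<integral>\<^sup>+r. dyadic_layers m (g (?l r)) \<partial>count_space {0<..1}) = (\<lambda>m. \<Sum>j. ennreal (1 / 2 ^ m) * N m j \<omega>)"
      unfolding lay using elim(1) by (subst nn_integral_suminf) (auto simp: nn_integral_cmult)
    finally show ?case .
  qed
  then have "(\<integral>\<^sup>+\<omega>. jsum g (Lp 0 \<omega>) 0 1 \<partial>M) \<le> (\<integral>\<^sup>+\<omega>. liminf (\<lambda>m. \<Sum>j. ennreal (1 / 2 ^ m) * N m j \<omega>) \<partial>M)"
    by (rule nn_integral_mono_AE)
  also have "\<dots> \<le> liminf (\<lambda>m. \<integral>\<^sup>+\<omega>. (\<Sum>j. ennreal (1 / 2 ^ m) * N m j \<omega>) \<partial>M)"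
    by (rule nn_integral_liminf) simp
  also have "(\<lambda>m. \<integral>\<^sup>+\<omega>. (\<Sum>j. ennreal (1 / 2 ^ m) * N m j \<omega>) \<partial>M) = (\<lambda>m. \<Sum>j. ennreal (1 / 2 ^ m) * emeasure \<nu> {y. a m j < \<bar>y\<bar>})"
    by (subst nn_integral_suminf) (auto simp: nn_integral_cmult N(3))
  also have "\<dots> = (\<lambda>m. \<integral>\<^sup>+y. dyadic_layers m (g y) \<partial>\<nu>)"
  proof
    fix m
    have ms: "{y. a m j < \<bar>y\<bar>} \<in> sets \<nu>" for j unfolding sets_\<nu> by measurable
    have "(\<integral>\<^sup>+y. dyadic_layers m (g y) \<partial>\<nu>) = (\<integral>\<^sup>+y. (\<Sum>j. ennreal (1 / 2 ^ m) * indicator {y. a m j < \<bar>y\<bar>} y) \<partial>\<nu>)"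
      unfolding lay by (simp add: indicator_def of_bool_def)
    also have "\<dots> = (\<Sum>j. \<integral>\<^sup>+y. ennreal (1 / 2 ^ m) * indicator {y. a m j < \<bar>y\<bar>} y \<partial>\<nu>)"
      by (intro nn_integral_suminf borel_measurable_times_ennreal borel_measurable_const borel_measurable_indicator ms)
    also have "\<dots> = (\<Sum>j. ennreal (1 / 2 ^ m) * emeasure \<nu> {y. a m j < \<bar>y\<bar>})"
      using ms by (simp add: nn_integral_cmult_indicator)
    finally show "(\<Sum>j. ennreal (1 / 2 ^ m) * emeasure \<nu> {y. a m j < \<bar>y\<bar>}) = (\<integral>\<^sup>+y. dyadic_layers m (g y) \<partial>\<nu>)" ..
  qed
  also have "liminf (\<lambda>m. \<integral>\<^sup>+y. dyadic_layers m (g y) \<partial>\<nu>) \<le> liminf (\<lambda>m::nat. \<integral>\<^sup>+y. ennreal (g y) \<partial>\<nu>)"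
    by (intro Liminf_mono always_eventually allI nn_integral_mono dyadic_layers_le)
  also have "\<dots> = (\<integral>\<^sup>+y. ennreal (g y) \<partial>\<nu>)" by (simp add: Liminf_const)
  finally show ?thesis unfolding g_def .
qed

lemma measurable_log_jumps:
  assumes "0 < c" "0 \<le> s"
  shows "(\<lambda>\<omega>. jsum (\<lambda>z. ln (1 + c * z\<^sup>2)) (Lp s \<omega>) 0 1) \<in> borel_measurable M"
  by (rule measurable_compose[OF Lp_measurable[OF assms(2)] measurable_jsum[OF _ _ continuous_ln_square[OF assms(1)]]]) auto

lemma AE_log_jumps_finite:
  assumes \<nu>: "is_levy_measure M L \<nu>" and c: "0 < c" and s: "0 \<le> s"
    and fin: "(\<integral>\<^sup>+y. ennreal (ln (1 + c * y\<^sup>2)) \<partial>\<nu>) < \<infinity>"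
  shows "AE \<omega> in M. jsum (\<lambda>z. ln (1 + c * z\<^sup>2)) (Lp s \<omega>) 0 1 < \<infinity>"
proof -
  have "(\<integral>\<^sup>+\<omega>. jsum (\<lambda>z. ln (1 + c * z\<^sup>2)) (Lp s \<omega>) 0 1 \<partial>M) = (\<integral>\<^sup>+\<omega>. jsum (\<lambda>z. ln (1 + c * z\<^sup>2)) (Lp 0 \<omega>) 0 1 \<partial>M)"
    by (rule nn_integral_Lp[OF s]) (rule measurable_jsum[OF _ _ continuous_ln_square[OF c]], auto)
  also have "\<dots> < \<infinity>" using expected_log_jumps_le[OF \<nu> c] fin by (rule le_less_trans)
  finally have "AE \<omega> in M. jsum (\<lambda>z. ln (1 + c * z\<^sup>2)) (Lp s \<omega>) 0 1 \<noteq> \<infinity>"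
    by (intro nn_integral_PInf_AE measurable_log_jumps[OF c s]) auto
  then show ?thesis by (simp add: top.not_eq_extremum)
qed

lemma AE_good_path:
  assumes \<nu>: "is_levy_measure M L \<nu>" and c: "0 < c"
    and fin: "(\<integral>\<^sup>+y. ennreal (ln (1 + c * y\<^sup>2)) \<partial>\<nu>) < \<infinity>"
  shows "AE \<omega> in M. good_path (\<lambda>t. L t \<omega>)"
proof -
  have "AE \<omega> in M. \<forall>k::nat. jsum (\<lambda>z. ln (1 + c * z\<^sup>2)) (Lp (real k) \<omega>) 0 1 < \<infinity>"
    unfolding AE_all_countable using AE_log_jumps_finite[OF \<nu> c _ fin] by simp
  with AE_cadlag show ?thesis
    by eventually_elim (rule good_pathI[OF _ c], auto simp: jsum_Lp)
qed

text \<open>Stochastic continuity makes the probability of a deviation above \<epsilon> vanish along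
  times increasing to \<open>t\<close>. A jump above \<epsilon> at \<open>t\<close> would force this
  deviation at all late times of the sequence, which Fatou's lemma for the indicators excludes
  almost surely.\<close>

lemma AE_no_fixed_jump:
  assumes t: "0 < t"
  shows "AE \<omega> in M. ljump (\<lambda>t. L t \<omega>) t = 0"
proof -
  define s where "s n = t - t / real (Suc (Suc n))" for n
  have s_pos: "0 \<le> s n" "s n < t" for n using t by (auto simp: s_def field_simps)
  have "(\<lambda>n. t - t * (1 / real (Suc (Suc n)))) \<longlonglongrightarrow> t - t * 0"
    by (intro tendsto_intros LIMSEQ_Suc lim_1_over_n)
  then have s_lim: "s \<longlonglongrightarrow> t" by (simp add: s_def[abs_def])
  have AE_eps: "AE \<omega> in M. \<bar>ljump (\<lambda>t. L t \<omega>) t\<bar> \<le> \<epsilon>" if \<epsilon>: "0 < \<epsilon>" for \<epsilon>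
  proof -
    define E where "E n = {\<omega> \<in> space M. \<bar>L (s n) \<omega> - L t \<omega>\<bar> > \<epsilon>}" for n
    have E: "E n \<in> sets M" for n
    proof -
      have [measurable]: "L (s n) \<in> borel_measurable M" "L t \<in> borel_measurable M" using s_pos t by auto
      show ?thesis unfolding E_def by measurable
    qed
    have "((\<lambda>s. measure M {\<omega> \<in> space M. \<bar>L s \<omega> - L t \<omega>\<bar> > \<epsilon>}) \<longlongrightarrow> 0) (at t within {0..})"
      using levy_process t \<epsilon> by (simp add: levy_process_def)
    moreover have "filterlim s (at t within {0..}) sequentially"
      unfolding filterlim_at using s_lim s_pos by (auto intro!: always_eventually simp: less_imp_neq)
    ultimately have "(\<lambda>n. measure M (E n)) \<longlonglongrightarrow> 0" unfolding E_def by (rule filterlim_compose)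
    then have "(\<lambda>n. emeasure M (E n)) \<longlonglongrightarrow> 0"
      using tendsto_ennrealI[of "\<lambda>n. measure M (E n)" 0] by (simp add: emeasure_eq_measure)
    then have "liminf (\<lambda>n. emeasure M (E n)) = 0" by (intro lim_imp_Liminf) auto
    moreover have "(\<integral>\<^sup>+\<omega>. liminf (\<lambda>n. indicator (E n) \<omega>) \<partial>M) \<le> liminf (\<lambda>n. \<integral>\<^sup>+\<omega>. indicator (E n) \<omega> \<partial>M)"
      using E by (intro nn_integral_liminf) simp
    ultimately have "(\<integral>\<^sup>+\<omega>. liminf (\<lambda>n. indicator (E n) \<omega>) \<partial>M) = 0" using E by simp
    then have "AE \<omega> in M. liminf (\<lambda>n. indicator (E n) \<omega> :: ennreal) = 0"
      using E by (subst (asm) nn_integral_0_iff_AE) auto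
    with AE_cadlag AE_space show ?thesis
    proof eventually_elim
      case (elim \<omega>)
      have "filterlim s (at_left t) sequentially"
        unfolding filterlim_at using s_lim s_pos by (auto intro!: always_eventually simp: less_imp_neq)
      then have "(\<lambda>n. L (s n) \<omega>) \<longlonglongrightarrow> Lim (at_left t) (\<lambda>t. L t \<omega>)"
        using filterlim_compose[OF cadlag_left_lim[OF elim(1) t]] by blast
      then have lim: "(\<lambda>n. \<bar>L (s n) \<omega> - L t \<omega>\<bar>) \<longlonglongrightarrow> \<bar>Lim (at_left t) (\<lambda>t. L t \<omega>) - L t \<omega>\<bar>"
        by (intro tendsto_intros)
      show ?case
      proof (rule ccontr)
        assume "\<not> ?thesis"
        then have "\<epsilon> < \<bar>Lim (at_left t) (\<lambda>t. L t \<omega>) - L t \<omega>\<bar>" by (simp add: ljump_def abs_minus_commute)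
        from order_tendstoD(1)[OF lim this] have "eventually (\<lambda>n. indicator (E n) \<omega> = (1::ennreal)) sequentially"
          by eventually_elim (use elim in \<open>simp add: E_def\<close>)
        then have "liminf (\<lambda>n. indicator (E n) \<omega>) = liminf (\<lambda>n::nat. 1 :: ennreal)" by (intro Liminf_eq)
        then show False using elim by (simp add: Liminf_const)
      qed
    qed
  qed
  have "AE \<omega> in M. \<forall>k::nat. \<bar>ljump (\<lambda>t. L t \<omega>) t\<bar> \<le> 1 / real (Suc k)"
    unfolding AE_all_countable using AE_eps by simp
  then show ?thesis
  proof eventually_elim
    case (elim \<omega>)
    have "\<bar>ljump (\<lambda>t. L t \<omega>) t\<bar> \<le> 0"
      by (rule LIMSEQ_le_const[OF LIMSEQ_Suc[OF lim_1_over_n]]) (use elim in auto)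
    then show ?case by simp
  qed
qed

end

section \<open>The adapted norm\<close>

text \<open>On the positive half-line this is convexity of the power; the boundary cases use
  \<open>w powr p <= w\<close> for \<open>0 <= w <= 1\<close>.\<close>

lemma powr_convex_nonneg:
  fixes x y u v p :: real
  assumes p: "1 \<le> p" and uv: "0 \<le> u" "0 \<le> v" "u + v = 1" and xy: "0 \<le> x" "0 \<le> y"
  shows "(u * x + v * y) powr p \<le> u * x powr p + v * y powr p"
proof -
  have shrink: "(w * z) powr p \<le> w * z powr p" if "0 \<le> w" "w \<le> 1" "0 \<le> z" for w z :: real
  proof -
    have "w powr p \<le> w"
      using that p powr_mono'[of 1 p w] by (cases "w = 0") auto
    then show ?thesis using that by (simp add: powr_mult mult_right_mono)
  qed
  consider "x = 0" | "y = 0" | "0 < x" "0 < y" using xy by linarith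
  then show ?thesis
  proof cases
    case 1 then show ?thesis using shrink[of v y] uv xy by simp
  next
    case 2 then show ?thesis using shrink[of u x] uv xy by simp
  next
    case 3
    have "u = 1 - v" using uv by simp
    moreover have "((1 - v) * x + v * y) powr p \<le> (1 - v) * x powr p + v * y powr p"
      using convex_onD[OF powr_convex[OF p], of v x y] uv 3 by simp
    ultimately show ?thesis by simp
  qed
qed

text \<open>Concavity of the logarithm between 1 and \<open>1 + \<kappa> * x\<close>, with weight
  \<open>1 / \<kappa>\<close>. It serves to take a factor slightly above 1 out of the
  logarithm.\<close>

lemma ln_1_plus_mult_le:
  fixes \<kappa> x :: real
  assumes "1 \<le> \<kappa>" "0 \<le> x"
  shows "ln (1 + \<kappa> * x) \<le> \<kappa> * ln (1 + x)"
proof -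
  have pos: "0 < 1 + \<kappa> * x" using assms by (simp add: add_pos_nonneg)
  have "(1 - 1 / \<kappa>) * ln 1 + (1 / \<kappa>) * ln (1 + \<kappa> * x) \<le> ln ((1 - 1 / \<kappa>) *\<^sub>R 1 + (1 / \<kappa>) *\<^sub>R (1 + \<kappa> * x))"
    by (rule concave_onD[OF ln_concave]) (use assms pos in auto)
  also have "(1 - 1 / \<kappa>) *\<^sub>R 1 + (1 / \<kappa>) *\<^sub>R (1 + \<kappa> * x) = 1 + x"
    using assms by (simp add: field_simps)
  finally show ?thesis using assms by (simp add: field_simps)
qed

text \<open>These norms depend on the moduli of the coordinates only, and monotonically. Hence for
  every \<open>r\<close> a diagonal matrix stretches vectors at most by the largest modulus of its
  entries, which is how the eigenvalues of the drift will enter.\<close>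

lemma lr_norm_mono:
  fixes x y :: "complex ^ 'n"
  assumes r: "1 \<le> r" and m: "0 \<le> m" and le: "\<And>i. cmod (x $ i) \<le> m * cmod (y $ i)"
  shows "lr_norm r x \<le> m * lr_norm r y"
proof (cases "r = \<infinity>")
  case True
  have "cmod (x $ i) \<le> m * Max (range (\<lambda>i. cmod (y $ i)))" for i
    using le[of i] mult_left_mono[OF Max_ge[of "range (\<lambda>i. cmod (y $ i))" "cmod (y $ i)"] m] by simp
  then show ?thesis unfolding lr_norm_def using True by (simp add: Max_le_iff)
next
  case False
  define p where "p = real_of_ereal r"
  have p: "1 \<le> p" unfolding p_def using r False by (cases r) auto
  have "(\<Sum>i\<in>UNIV. cmod (x $ i) powr p) powr (1 / p) \<le> (\<Sum>i\<in>UNIV. (m * cmod (y $ i)) powr p) powr (1 / p)"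
    using p le by (intro powr_mono2 sum_nonneg sum_mono) auto
  also have "\<dots> = (m powr p * (\<Sum>i\<in>UNIV. cmod (y $ i) powr p)) powr (1 / p)"
    using m by (simp add: powr_mult sum_distrib_left)
  also have "\<dots> = m * (\<Sum>i\<in>UNIV. cmod (y $ i) powr p) powr (1 / p)"
    using m p by (simp add: powr_mult sum_nonneg powr_powr)
  finally show ?thesis using False by (simp add: lr_norm_def p_def)
qed

lemma component_le_lr_norm:
  fixes x :: "complex ^ 'n"
  assumes r: "1 \<le> r"
  shows "cmod (x $ i) \<le> lr_norm r x"
proof (cases "r = \<infinity>")
  case True
  then show ?thesis by (simp add: lr_norm_def)
next
  case False
  define p where "p = real_of_ereal r"
  have p: "1 \<le> p" unfolding p_def using r False by (cases r) auto
  have "cmod (x $ i) = (cmod (x $ i) powr p) powr (1 / p)" using p by (simp add: powr_powr)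
  also have "\<dots> \<le> (\<Sum>i\<in>UNIV. cmod (x $ i) powr p) powr (1 / p)"
    using p by (intro powr_mono2 member_le_sum) auto
  finally show ?thesis using False by (simp add: lr_norm_def p_def)
qed

lemma lr_norm_nonneg: "1 \<le> r \<Longrightarrow> 0 \<le> lr_norm r (x :: complex ^ 'n)"
  using component_le_lr_norm[of r x undefined] norm_ge_zero order_trans by blast

lemma lr_norm_zero_iff: "1 \<le> r \<Longrightarrow> lr_norm r (x :: complex ^ 'n) = 0 \<longleftrightarrow> x = 0"
proof
  assume "1 \<le> r" "lr_norm r x = 0"
  then show "x = 0" using component_le_lr_norm[of r x] by (simp add: vec_eq_iff)
next
  assume "1 \<le> r" "x = 0"
  then show "lr_norm r x = 0"
    using lr_norm_mono[of r 0 x x] lr_norm_nonneg[of r x] by simp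
qed

lemma lr_norm_scale:
  assumes r: "1 \<le> r"
  shows "lr_norm r (\<chi> i. c * x $ i) \<le> cmod c * lr_norm r (x :: complex ^ 'n)"
  by (rule lr_norm_mono[OF r]) (simp_all add: norm_mult)

text \<open>Minkowski's inequality from convexity of the power: \<open>x + y\<close> is
  \<open>A + B\<close> times a convex combination of the normalised vectors, with weights
  \<open>A / (A + B)\<close> and \<open>B / (A + B)\<close>.\<close>

lemma lr_norm_triangle:
  fixes x y :: "complex ^ 'n"
  assumes r: "1 \<le> r"
  shows "lr_norm r (x + y) \<le> lr_norm r x + lr_norm r y"
proof (cases "r = \<infinity>")
  case True
  have mx: "cmod (z $ i) \<le> Max (range (\<lambda>i. cmod (z $ i)))" for i and z :: "complex ^ 'n"
    by (rule Max_ge) auto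
  have "cmod ((x + y) $ i) \<le> Max (range (\<lambda>i. cmod (x $ i))) + Max (range (\<lambda>i. cmod (y $ i)))" for i
    unfolding vector_add_component by (rule norm_triangle_le[OF add_mono[OF mx mx]])
  then show ?thesis unfolding lr_norm_def using True by (simp add: Max_le_iff)
next
  case False
  define p where "p = real_of_ereal r"
  have p: "1 \<le> p" unfolding p_def using r False by (cases r) auto
  have N: "lr_norm r z = (\<Sum>i\<in>UNIV. cmod (z $ i) powr p) powr (1 / p)" for z :: "complex ^ 'n"
    using False by (simp add: lr_norm_def p_def)
  define A where "A = lr_norm r x"
  define B where "B = lr_norm r y"
  show ?thesis
  proof (cases "A = 0 \<or> B = 0")
    case True
    then show ?thesis using r by (auto simp: A_def B_def lr_norm_zero_iff lr_norm_nonneg)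
  next
    case False
    then have AB: "0 < A" "0 < B" using lr_norm_nonneg[OF r] by (auto simp: A_def B_def less_le)
    have pow: "(\<Sum>i\<in>UNIV. cmod (z $ i) powr p) = lr_norm r z powr p" for z :: "complex ^ 'n"
      unfolding N using p by (simp add: powr_powr sum_nonneg)
    have unit: "(\<Sum>i\<in>UNIV. (cmod (z $ i) / lr_norm r z) powr p) = 1" if "0 < lr_norm r z" for z :: "complex ^ 'n"
    proof -
      have "(\<Sum>i\<in>UNIV. (cmod (z $ i) / lr_norm r z) powr p) = (\<Sum>i\<in>UNIV. cmod (z $ i) powr p) / lr_norm r z powr p"
        using that by (simp add: powr_divide sum_divide_distrib)
      then show ?thesis using that by (simp add: pow)
    qed
    let ?u = "A / (A + B)" and ?v = "B / (A + B)"
    have uv: "?u + ?v = 1" using AB by (simp add: add_divide_distrib[symmetric])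
    have "cmod ((x + y) $ i) powr p \<le> (A + B) powr p * (?u * (cmod (x $ i) / A) powr p + ?v * (cmod (y $ i) / B) powr p)" for i
    proof -
      have "cmod ((x + y) $ i) \<le> (A + B) * (?u * (cmod (x $ i) / A) + ?v * (cmod (y $ i) / B))"
        using AB norm_triangle_ineq[of "x $ i" "y $ i"] by (simp add: distrib_left)
      then have "cmod ((x + y) $ i) powr p \<le> ((A + B) * (?u * (cmod (x $ i) / A) + ?v * (cmod (y $ i) / B))) powr p"
        using p by (intro powr_mono2) auto
      also have "\<dots> = (A + B) powr p * (?u * (cmod (x $ i) / A) + ?v * (cmod (y $ i) / B)) powr p"
        by (rule powr_mult)
      also have "\<dots> \<le> (A + B) powr p * (?u * (cmod (x $ i) / A) powr p + ?v * (cmod (y $ i) / B) powr p)"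
        using AB uv p by (intro mult_left_mono powr_convex_nonneg) auto
      finally show ?thesis .
    qed
    then have "(\<Sum>i\<in>UNIV. cmod ((x + y) $ i) powr p) \<le> (\<Sum>i\<in>UNIV. (A + B) powr p * (?u * (cmod (x $ i) / A) powr p + ?v * (cmod (y $ i) / B) powr p))"
      by (rule sum_mono)
    also have "\<dots> = (A + B) powr p * (?u * (\<Sum>i\<in>UNIV. (cmod (x $ i) / A) powr p) + ?v * (\<Sum>i\<in>UNIV. (cmod (y $ i) / B) powr p))"
      by (simp only: sum_distrib_left[symmetric] sum.distrib)
    also have "\<dots> = (A + B) powr p"
      using unit[of x] unit[of y] AB uv unfolding A_def[symmetric] B_def[symmetric] by simp
    finally have "(\<Sum>i\<in>UNIV. cmod ((x + y) $ i) powr p) powr (1 / p) \<le> ((A + B) powr p) powr (1 / p)"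
      using p by (intro powr_mono2) (auto intro: sum_nonneg)
    then show ?thesis using AB p by (simp add: N[of "x + y"] powr_powr A_def B_def)
  qed
qed

lemma lr_norm_const_bound:
  fixes x :: "complex ^ 'n"
  assumes r: "1 \<le> r" and "\<And>i. cmod (x $ i) \<le> m"
  shows "lr_norm r x \<le> m * lr_norm r (1 :: complex ^ 'n)"
proof (rule lr_norm_mono[OF r])
  show "0 \<le> m" using assms(2) norm_ge_zero order_trans by blast
qed (use assms in simp)

lemma matrix_vector_component_bound:
  fixes A :: "complex ^ 'n ^ 'm"
  assumes r: "1 \<le> r"
  shows "cmod ((A *v x) $ i) \<le> (\<Sum>i\<in>UNIV. \<Sum>j\<in>UNIV. cmod (A $ i $ j)) * lr_norm r x"
proof -
  have "cmod ((A *v x) $ i) \<le> (\<Sum>j\<in>UNIV. cmod (A $ i $ j) * cmod (x $ j))"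
    unfolding matrix_vector_mult_def by (simp add: order_trans[OF norm_sum] norm_mult)
  also have "\<dots> \<le> (\<Sum>j\<in>UNIV. cmod (A $ i $ j) * lr_norm r x)"
    by (intro sum_mono mult_left_mono component_le_lr_norm r) auto
  also have "\<dots> = (\<Sum>j\<in>UNIV. cmod (A $ i $ j)) * lr_norm r x" by (simp add: sum_distrib_right)
  also have "\<dots> \<le> (\<Sum>i\<in>UNIV. \<Sum>j\<in>UNIV. cmod (A $ i $ j)) * lr_norm r x"
    by (intro mult_right_mono lr_norm_nonneg r member_le_sum[of i UNIV "\<lambda>i. \<Sum>j\<in>UNIV. cmod (A $ i $ j)"]) (auto intro: sum_nonneg)
  finally show ?thesis .
qed

text \<open>The crude bound by the sum of all entries serves only to make the supremum in
  \<open>lr_opnorm\<close> a genuine one.\<close>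

lemma lr_opnorm_bdd:
  fixes A :: "complex ^ 'n ^ 'n"
  assumes r: "1 \<le> r"
  shows "bdd_above ((\<lambda>x. lr_norm r (A *v x) / lr_norm r x) ` {x. x \<noteq> 0})"
proof (rule bdd_aboveI2)
  fix x :: "complex ^ 'n" assume "x \<in> {x. x \<noteq> 0}"
  then have pos: "0 < lr_norm r x" using lr_norm_nonneg[OF r, of x] lr_norm_zero_iff[OF r, of x] by simp
  have "lr_norm r (A *v x) \<le> ((\<Sum>i\<in>UNIV. \<Sum>j\<in>UNIV. cmod (A $ i $ j)) * lr_norm r x) * lr_norm r (1 :: complex ^ 'n)"
    by (rule lr_norm_const_bound[OF r matrix_vector_component_bound[OF r]])
  then show "lr_norm r (A *v x) / lr_norm r x \<le> (\<Sum>i\<in>UNIV. \<Sum>j\<in>UNIV. cmod (A $ i $ j)) * lr_norm r (1 :: complex ^ 'n)"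
    using pos by (simp add: field_simps)
qed

lemma lr_opnorm_bound:
  fixes A :: "complex ^ 'n ^ 'n"
  assumes r: "1 \<le> r"
  shows "lr_norm r (A *v x) \<le> lr_opnorm r A * lr_norm r x"
proof (cases "x = 0")
  case True
  then show ?thesis using lr_norm_zero_iff[OF r, of "0 :: complex ^ 'n"] by simp
next
  case False
  then have pos: "0 < lr_norm r x" using lr_norm_nonneg[OF r, of x] lr_norm_zero_iff[OF r, of x] by simp
  have "lr_norm r (A *v x) / lr_norm r x \<le> lr_opnorm r A"
    unfolding lr_opnorm_def using False by (intro cSUP_upper lr_opnorm_bdd r) auto
  then show ?thesis using pos by (simp add: field_simps)
qed

lemma lr_opnorm_pos:
  fixes A :: "complex ^ 'n ^ 'n"
  assumes r: "1 \<le> r" and "A \<noteq> 0"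
  shows "0 < lr_opnorm r A"
proof -
  obtain x where x: "A *v x \<noteq> 0" using assms(2) by (metis matrix_eq matrix_vector_mult_0)
  then have "0 < lr_norm r (A *v x)" using lr_norm_nonneg[OF r, of "A *v x"] lr_norm_zero_iff[OF r, of "A *v x"] by simp
  then have "0 < lr_opnorm r A * lr_norm r x" using lr_opnorm_bound[OF r, of A x] by linarith
  then show ?thesis using lr_norm_nonneg[OF r, of x] by (simp add: zero_less_mult_iff)
qed

section \<open>Diagonalisation of the drift and the norm adapted to it\<close>

lemma matrix_inv_inverse:
  assumes "invertible A"
  shows "A ** matrix_inv A = mat 1" "matrix_inv A ** A = mat 1"
  using someI_ex[OF assms[unfolded invertible_def]] unfolding matrix_inv_def by auto

definition cvec :: "real ^ 'n \<Rightarrow> complex ^ 'n" where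
  "cvec y = (\<chi> i. complex_of_real (y $ i))"

lemma cvec_add: "cvec (y + z) = cvec y + cvec z" and cvec_scaleR: "cvec (c *\<^sub>R y) = of_real c *s cvec y"
  by (simp_all add: cvec_def vec_eq_iff)

lemma cmat_cvec: "cmat A *v cvec y = cvec (A *v y)"
  by (simp add: cmat_def cvec_def matrix_vector_mult_def vec_eq_iff)

lemma outer_mult_vec: "outer u v *v y = (v \<bullet> y) *\<^sub>R u"
  by (simp add: outer_def matrix_vector_mult_def vec_eq_iff inner_vec_def sum_distrib_left mult_ac)

text \<open>The factor of one Euler step for a scalar linear equation obeys the bound of the exact
  solution up to a second-order term, which disappears when the steps are composed over a refining
  grid.\<close>

lemma cmod_1_plus_le:
  fixes z :: complex
  assumes h: "0 \<le> h" and z: "Re z \<le> l"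
  shows "cmod (1 + of_real h * z) \<le> exp (l * h + (cmod z)\<^sup>2 / 2 * h\<^sup>2)"
proof -
  have "(cmod (1 + of_real h * z))\<^sup>2 = 1 + (2 * h * Re z + h\<^sup>2 * (cmod z)\<^sup>2)"
    unfolding cmod_power2 by (simp add: power2_eq_square algebra_simps)
  also have "\<dots> \<le> 1 + (2 * h * l + h\<^sup>2 * (cmod z)\<^sup>2)"
    using mult_left_mono[OF z, of "2 * h"] h by simp
  also have "\<dots> \<le> exp (2 * h * l + h\<^sup>2 * (cmod z)\<^sup>2)" by (rule exp_ge_add_one_self)
  also have "\<dots> = (exp (l * h + (cmod z)\<^sup>2 / 2 * h\<^sup>2))\<^sup>2"
    by (simp add: exp_double[symmetric] algebra_simps)
  finally show ?thesis by (rule power2_le_imp_le) simp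
qed

text \<open>What is kept of \<open>S\<close> and \<open>r\<close>: equivalence with the Euclidean
  norm through \<open>m1\<close> and \<open>m2\<close>, and one estimate for a linear Euler step.
  The term \<open>C * h^2\<close> in it is the price of Euler steps in place of the matrix
  exponential.\<close>

locale adapted_norm =
  fixes B :: "real ^ 'q ^ 'q" and a e :: "real ^ 'q" and l K C :: real
    and nrm :: "real ^ 'q \<Rightarrow> real" and m1 m2 :: real
  assumes nrm_triangle: "nrm (y + z) \<le> nrm y + nrm z"
    and nrm_scale: "nrm (c *\<^sub>R y) \<le> \<bar>c\<bar> * nrm y"
    and norm_le_nrm: "norm y \<le> m1 * nrm y" and nrm_le_norm: "nrm y \<le> m2 * norm y"
    and m12: "0 \<le> m1" "0 \<le> m2" and C: "0 \<le> C"
    and nrm_nonneg: "0 \<le> nrm y"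
    and nrm_step: "0 \<le> h \<Longrightarrow> 0 \<le> d \<Longrightarrow>
      nrm (y + (h *\<^sub>R (B *v y) + d *\<^sub>R ((a \<bullet> y) *\<^sub>R e))) \<le> (exp (l * h + C * h\<^sup>2) + K * d) * nrm y"

text \<open>The norm is the \<open>r\<close>-norm after multiplication by the inverse of
  \<open>S\<close>. In these coordinates the drift is diagonal, so a drift step is bounded by its
  worst diagonal entry, and the jump part by its operator norm.\<close>

lemma adapted_norm_exists:
  fixes B :: "real ^ 'q ^ 'q" and a e :: "real ^ 'q" and S :: "complex ^ 'q ^ 'q"
  assumes fin: "finite (eigenvalues B)" and r: "1 \<le> r" and S: "invertible S"
    and diag: "diagonal_mat (matrix_inv S ** cmat B ** S)"
  shows "\<exists>C nrm m1 m2. adapted_norm B a e (spectral_abscissa B)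
    (lr_opnorm r (matrix_inv S ** cmat (outer e a) ** S)) C nrm m1 m2"
proof -
  define T where "T = matrix_inv S"
  define \<Lambda> where "\<Lambda> = T ** cmat B ** S"
  define E where "E = T ** cmat (outer e a) ** S"
  have ST: "S ** T = mat 1" "T ** S = mat 1" using matrix_inv_inverse[OF S] by (auto simp: T_def)
  have \<Lambda>diag: "\<Lambda> $ i $ j = 0" if "i \<noteq> j" for i j using diag that by (simp add: diagonal_mat_def \<Lambda>_def T_def)
  have \<Lambda>T: "\<Lambda> ** T = T ** cmat B" and ET: "E ** T = T ** cmat (outer e a)" and S\<Lambda>: "S ** \<Lambda> = cmat B ** S"
    unfolding \<Lambda>_def E_def using ST
    by (metis matrix_mul_assoc matrix_mul_rid, metis matrix_mul_assoc matrix_mul_rid, metis matrix_mul_assoc matrix_mul_lid)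
  have \<Lambda>mult: "(\<Lambda> *v w) $ i = \<Lambda> $ i $ i * w $ i" for w i
  proof -
    have "(\<Lambda> *v w) $ i = (\<Sum>j\<in>UNIV. if j = i then \<Lambda> $ i $ i * w $ i else 0)"
      unfolding matrix_vector_mult_def vec_lambda_beta by (rule sum.cong) (auto simp: \<Lambda>diag)
    then show ?thesis by simp
  qed
  have eig: "\<Lambda> $ j $ j \<in> eigenvalues B" for j
  proof -
    \<comment> \<open>The columns of \<open>S\<close> are eigenvectors, so the diagonal entries are
      eigenvalues of \<open>B\<close> and their real parts are at most the spectral
      abscissa.\<close>
    define v where "v = S *v axis j 1"
    have "v \<noteq> 0"
    proof
      assume "v = 0"
      then have "T *v v = 0" by simp
      then have "axis j (1::complex) = 0" by (simp add: v_def matrix_vector_mul_assoc ST)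
      then show False by (simp add: axis_eq_0_iff)
    qed
    moreover have "cmat B *v v = \<Lambda> $ j $ j *s v"
    proof -
      have "\<Lambda> *v axis j 1 = \<Lambda> $ j $ j *s axis j 1"
        by (simp add: vec_eq_iff \<Lambda>mult axis_def)
      moreover have "cmat B *v v = S *v (\<Lambda> *v axis j 1)"
        unfolding v_def by (simp add: matrix_vector_mul_assoc S\<Lambda>)
      ultimately show ?thesis unfolding v_def by (simp add: vector_scalar_commute)
    qed
    ultimately show ?thesis unfolding eigenvalues_def by blast
  qed
  have Re_le: "Re (\<Lambda> $ j $ j) \<le> spectral_abscissa B" for j
    unfolding spectral_abscissa_def using eig fin by (intro Max_ge) auto
  define C where "C = (\<Sum>j\<in>UNIV. (cmod (\<Lambda> $ j $ j))\<^sup>2 / 2)"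
  have C: "(cmod (\<Lambda> $ j $ j))\<^sup>2 / 2 \<le> C" for j
    unfolding C_def by (rule member_le_sum) auto
  define nrm where "nrm y = lr_norm r (T *v cvec y)" for y :: "real ^ 'q"
  define s where "s = (\<Sum>i\<in>UNIV. \<Sum>j\<in>UNIV. cmod (S $ i $ j))"
  define t where "t = (\<Sum>i\<in>UNIV. \<Sum>j\<in>UNIV. cmod (T $ i $ j))"
  define o1 where "o1 = lr_norm r (1 :: complex ^ 'q)"
  have nn: "0 \<le> s" "0 \<le> t" "0 \<le> o1" by (auto simp: s_def t_def o1_def lr_norm_nonneg r intro!: sum_nonneg)
  have "adapted_norm B a e (spectral_abscissa B) (lr_opnorm r E) C nrm (real CARD('q) * s) (t * o1 * o1)"
  proof
    show "nrm (y + z) \<le> nrm y + nrm z" for y z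
      unfolding nrm_def cvec_add matrix_vector_right_distrib by (rule lr_norm_triangle[OF r])
    have sc: "T *v cvec (c *\<^sub>R y) = (\<chi> i. of_real c * (T *v cvec y) $ i)" for c y
      unfolding cvec_scaleR by (simp add: vec_eq_iff vector_scalar_commute)
    show "nrm (c *\<^sub>R y) \<le> \<bar>c\<bar> * nrm y" for c y
      unfolding nrm_def sc using lr_norm_scale[OF r, of "of_real c" "T *v cvec y"] by simp
    show "0 \<le> nrm y" for y unfolding nrm_def by (rule lr_norm_nonneg[OF r])
    show "norm y \<le> real CARD('q) * s * nrm y" for y
    proof -
      have "norm y \<le> (\<Sum>i\<in>UNIV. \<bar>y $ i\<bar>)" by (rule norm_le_l1_cart)
      also have "\<dots> \<le> (\<Sum>i\<in>(UNIV::'q set). s * nrm y)"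
      proof (rule sum_mono)
        fix i
        have "cvec y = S *v (T *v cvec y)" by (simp add: matrix_vector_mul_assoc ST)
        then have "\<bar>y $ i\<bar> = cmod ((S *v (T *v cvec y)) $ i)" by (metis cvec_def norm_of_real vec_lambda_beta)
        also have "\<dots> \<le> s * nrm y" unfolding s_def nrm_def by (rule matrix_vector_component_bound[OF r])
        finally show "\<bar>y $ i\<bar> \<le> s * nrm y" .
      qed
      finally show ?thesis by simp
    qed
    show "nrm y \<le> t * o1 * o1 * norm y" for y
    proof -
      have "lr_norm r (cvec y) \<le> norm y * o1"
        unfolding o1_def by (rule lr_norm_const_bound[OF r]) (simp add: cvec_def component_le_norm_cart)
      then have "t * lr_norm r (cvec y) \<le> t * (norm y * o1)" using nn by (intro mult_left_mono)
      moreover have "nrm y \<le> t * lr_norm r (cvec y) * o1"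
        unfolding nrm_def t_def o1_def by (rule lr_norm_const_bound[OF r matrix_vector_component_bound[OF r]])
      ultimately have "nrm y \<le> t * (norm y * o1) * o1" using nn by (meson mult_right_mono order_trans)
      then show ?thesis by (simp add: mult_ac)
    qed
    show "0 \<le> real CARD('q) * s" "0 \<le> t * o1 * o1" using nn by auto
    show "0 \<le> C" unfolding C_def by (intro sum_nonneg) auto
    fix h d :: real and y assume hd: "0 \<le> h" "0 \<le> d"
    define w where "w = T *v cvec y"
    have "T *v cvec (y + (h *\<^sub>R (B *v y) + d *\<^sub>R ((a \<bullet> y) *\<^sub>R e))) = (\<chi> i. (1 + of_real h * \<Lambda> $ i $ i) * w $ i) + (\<chi> i. of_real d * (E *v w) $ i)"
    proof -
      have 1: "T *v cvec (B *v y) = \<Lambda> *v w"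
        unfolding w_def cmat_cvec[symmetric] by (simp add: matrix_vector_mul_assoc \<Lambda>T)
      have 2: "T *v cvec ((a \<bullet> y) *\<^sub>R e) = E *v w"
        unfolding w_def outer_mult_vec[symmetric] cmat_cvec[symmetric] by (simp add: matrix_vector_mul_assoc ET)
      show ?thesis
        unfolding cvec_add matrix_vector_right_distrib sc[of h "B *v y"] sc[of d "(a \<bullet> y) *\<^sub>R e"] 1 2 w_def[symmetric]
        by (simp add: vec_eq_iff \<Lambda>mult algebra_simps)
    qed
    then have "nrm (y + (h *\<^sub>R (B *v y) + d *\<^sub>R ((a \<bullet> y) *\<^sub>R e)))
      \<le> lr_norm r (\<chi> i. (1 + of_real h * \<Lambda> $ i $ i) * w $ i) + lr_norm r (\<chi> i. of_real d * (E *v w) $ i)"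
      unfolding nrm_def using lr_norm_triangle[OF r] by simp
    also have "lr_norm r (\<chi> i. of_real d * (E *v w) $ i) \<le> d * lr_norm r (E *v w)"
      using lr_norm_scale[OF r, of "of_real d" "E *v w"] hd by simp
    also have "d * lr_norm r (E *v w) \<le> d * (lr_opnorm r E * lr_norm r w)"
      using hd by (intro mult_left_mono lr_opnorm_bound r)
    also have "lr_norm r (\<chi> i. (1 + of_real h * \<Lambda> $ i $ i) * w $ i) \<le> exp (spectral_abscissa B * h + C * h\<^sup>2) * lr_norm r w"
    proof (rule lr_norm_mono[OF r])
      fix i
      have "cmod (1 + of_real h * \<Lambda> $ i $ i) \<le> exp (spectral_abscissa B * h + (cmod (\<Lambda> $ i $ i))\<^sup>2 / 2 * h\<^sup>2)"
        by (rule cmod_1_plus_le[OF hd(1) Re_le])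
      also have "\<dots> \<le> exp (spectral_abscissa B * h + C * h\<^sup>2)"
        using mult_right_mono[OF C[of i], of "h\<^sup>2"] by simp
      finally show "cmod ((\<chi> i. (1 + of_real h * \<Lambda> $ i $ i) * w $ i) $ i) \<le> exp (spectral_abscissa B * h + C * h\<^sup>2) * cmod (w $ i)"
        by (simp add: norm_mult mult_right_mono)
    qed simp
    finally show "nrm (y + (h *\<^sub>R (B *v y) + d *\<^sub>R ((a \<bullet> y) *\<^sub>R e)))
      \<le> (exp (spectral_abscissa B * h + C * h\<^sup>2) + lr_opnorm r E * d) * nrm y"
      unfolding nrm_def[of y] w_def[symmetric] by (simp add: algebra_simps)
  qed
  then show ?thesis unfolding E_def T_def by blast
qed

text \<open>Conjugation by \<open>S\<close> cannot annihilate a nonzero matrix. Positivity of this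
  constant allows division by it, as in the jump sizes belonging to logarithmic levels.\<close>

lemma lr_opnorm_conjugate_pos:
  fixes S :: "complex ^ 'q ^ 'q" and e a :: "real ^ 'q"
  assumes r: "1 \<le> r" and S: "invertible S" and ea: "e \<noteq> 0" "a \<noteq> 0"
  shows "0 < lr_opnorm r (matrix_inv S ** cmat (outer e a) ** S)"
proof (rule lr_opnorm_pos[OF r])
  obtain i j where ij: "e $ i \<noteq> 0" "a $ j \<noteq> 0" using ea by (auto simp: vec_eq_iff)
  show "matrix_inv S ** cmat (outer e a) ** S \<noteq> 0"
  proof
    assume *: "matrix_inv S ** cmat (outer e a) ** S = 0"
    have "cmat (outer e a) = S ** (matrix_inv S ** cmat (outer e a) ** S) ** matrix_inv S"
      using matrix_inv_inverse[OF S] by (metis matrix_mul_assoc matrix_mul_lid matrix_mul_rid)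
    also have "\<dots> = 0" unfolding * by (simp add: matrix_matrix_mult_def vec_eq_iff)
    finally have "cmat (outer e a) $ i $ j = 0" by simp
    then show False using ij by (simp add: cmat_def outer_def)
  qed
qed

section \<open>The flow of the state equation\<close>

text \<open>\<open>lim\<close> is arbitrary where the scheme diverges, but the result is a
  measurable function of starting value and path, and it does not presuppose a solution.\<close>

definition flow :: "('e \<Rightarrow> 'e) \<Rightarrow> ('e \<Rightarrow> 'e) \<Rightarrow> real \<Rightarrow> 'e::real_normed_vector \<Rightarrow> (real \<Rightarrow> real) \<Rightarrow> 'e" where
  "flow f g t y x = lim (\<lambda>n. euler_grid f g (qvar x) 0 t n y)"

lemma euler_cong:
  "(\<And>i. i < n \<Longrightarrow> d i = d' i) \<Longrightarrow> euler f g h d y n = euler f g h d' y n"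
  by (induction n) auto

lemma euler_grid_cong:
  assumes "\<And>i. i < 2 ^ n \<Longrightarrow> d (grid s t n i) (grid s t n (Suc i)) = d' (grid s' t' n i) (grid s' t' n (Suc i))"
    and "t - s = t' - s'"
  shows "euler_grid f g d s t n y = euler_grid f g d' s' t' n y"
  unfolding euler_grid_def assms(2) by (rule euler_cong) (rule assms(1))

lemma flow_local:
  assumes "0 \<le> t" "\<And>u. 0 \<le> u \<Longrightarrow> u \<le> t \<Longrightarrow> x u = x' u"
  shows "flow f g t y x = flow f g t y x'"
proof -
  have "qvar x (grid 0 t n i) (grid 0 t n (Suc i)) = qvar x' (grid 0 t n i) (grid 0 t n (Suc i))" if i: "i < 2 ^ n" for n i
  proof -
    have g: "0 \<le> grid 0 t n i" "grid 0 t n i \<le> grid 0 t n (Suc i)" "grid 0 t n (Suc i) \<le> t"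
      using grid_bounds[OF assms(1), of i n] grid_bounds[OF assms(1), of "Suc i" n] grid_mono[OF assms(1), of i "Suc i" n] i by auto
    show ?thesis unfolding qvar_def
      by (rule arg_cong[where f = enn2real], rule jsum_cong[where c = 0])
        (use grid_bounds[OF g(2)] g assms(2) in \<open>force\<close>)
  qed
  then have "euler_grid f g (qvar x) 0 t n y = euler_grid f g (qvar x') 0 t n y" for n
    by (intro euler_grid_cong) auto
  then show ?thesis unfolding flow_def by simp
qed

lemma measurable_flow:
  fixes f g :: "'e::euclidean_space \<Rightarrow> 'e"
  assumes t: "0 \<le> t" and f: "continuous_on UNIV f" and g: "continuous_on UNIV g"
  shows "(\<lambda>(y, x). flow f g t y x) \<in> measurable (borel \<Otimes>\<^sub>M paths) borel"
proof -
  have fm: "f \<in> borel_measurable borel" and gm: "g \<in> borel_measurable borel"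
    using f g by (auto intro: borel_measurable_continuous_onI)
  have q: "(\<lambda>w. qvar (snd w) (grid 0 t n i) (grid 0 t n (Suc i))) \<in> borel_measurable (borel \<Otimes>\<^sub>M paths)" for n i
    by (rule measurable_compose[OF measurable_snd measurable_qvar])
      (use grid_nonneg[OF order_refl t] grid_mono[OF t, of i "Suc i" n] in auto)
  have "(\<lambda>w. euler f g h (\<lambda>i. qvar (snd w) (grid 0 t n i) (grid 0 t n (Suc i))) (fst w) j) \<in> borel_measurable (borel \<Otimes>\<^sub>M paths)" for h n j
  proof (induction j)
    case (Suc j)
    show ?case unfolding euler.simps
      by (intro borel_measurable_add borel_measurable_scaleR borel_measurable_const Suc q
          measurable_compose[OF Suc fm] measurable_compose[OF Suc gm])
  qed simp
  then have "(\<lambda>w. euler_grid f g (qvar (snd w)) 0 t n (fst w)) \<in> borel_measurable (borel \<Otimes>\<^sub>M paths)" for n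
    unfolding euler_grid_def .
  then show ?thesis unfolding flow_def split_beta by (rule borel_measurable_lim_metric)
qed

lemma additive_on_qvar:
  assumes "good_path x" "0 \<le> s"
  shows "additive_on 0 t (\<lambda>u v. qvar x (s + u) (s + v))"
proof -
  have "0 \<le> qvar x u v" for u v by (simp add: qvar_def)
  then show ?thesis unfolding additive_on_def using assms by (auto simp: qvar_eq)
qed

context levy
begin

lemma good_path_euler_grid:
  fixes f g :: "'e::real_normed_vector \<Rightarrow> 'e"
  assumes s: "0 \<le> s" and t: "0 \<le> t"
  shows "euler_grid f g (qvar (Lp s \<omega>)) 0 t n y = euler_grid f g (\<lambda>u v. qvar (\<lambda>t. L t \<omega>) (s + u) (s + v)) 0 t n y"
  by (rule euler_grid_cong) (use grid_nonneg[OF order_refl t] grid_mono[OF t] s in \<open>auto simp: qvar_Lp\<close>)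

lemma flow_convergent:
  assumes co: "lipschitz_coeffs f g b" and x: "good_path (\<lambda>t. L t \<omega>)" and s: "0 \<le> s" and t: "0 \<le> t"
  shows "(\<lambda>n. euler_grid f g (qvar (Lp s \<omega>)) 0 t n y) \<longlonglongrightarrow> flow f g t y (Lp s \<omega>)"
proof -
  have "convergent (\<lambda>n. euler_grid f g (qvar (Lp s \<omega>)) 0 t n y)"
    unfolding good_path_euler_grid[OF s t]
    by (rule lipschitz_coeffs.euler_grid_convergent[OF co additive_on_qvar[OF x s] t])
  then show ?thesis unfolding flow_def by (rule convergent_LIMSEQ_iff[THEN iffD1])
qed

text \<open>The constant is random, but it does not depend on the starting values; this makes the
  transition operators preserve continuity.\<close>

lemma flow_lipschitz:
  assumes co: "lipschitz_coeffs f g b" and x: "good_path (\<lambda>t. L t \<omega>)" and s: "0 \<le> s" and t: "0 \<le> t"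
  shows "norm (flow f g t y (Lp s \<omega>) - flow f g t z (Lp s \<omega>)) \<le> exp (b * (t + qvar (\<lambda>t. L t \<omega>) s (s + t))) * norm (y - z)"
proof (rule tendsto_upperbound)
  show "(\<lambda>n. norm (euler_grid f g (qvar (Lp s \<omega>)) 0 t n y - euler_grid f g (qvar (Lp s \<omega>)) 0 t n z))
     \<longlonglongrightarrow> norm (flow f g t y (Lp s \<omega>) - flow f g t z (Lp s \<omega>))"
    by (intro tendsto_intros flow_convergent[OF assms])
  show "eventually (\<lambda>n. norm (euler_grid f g (qvar (Lp s \<omega>)) 0 t n y - euler_grid f g (qvar (Lp s \<omega>)) 0 t n z)
     \<le> exp (b * (t + qvar (\<lambda>t. L t \<omega>) s (s + t))) * norm (y - z)) sequentially"
    unfolding good_path_euler_grid[OF s t]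
    using lipschitz_coeffs.euler_grid_lip[OF co additive_on_qvar[OF x s] t] by simp
qed simp

text \<open>The grid of [s, s + t] is a translate of the grid of [0, t], and the scheme uses only
  increments of the integrator. The limit for the solution restarted at \<open>s\<close> is
  therefore the flow along the shifted path, for all \<open>s\<close> and \<open>t\<close> off a
  single null set.\<close>

lemma solution_flow:
  assumes co: "integral_equation f g b y (sq_jumps (\<lambda>t. L t \<omega>))"
    and x: "good_path (\<lambda>t. L t \<omega>)" and s: "0 \<le> s" and t: "0 \<le> t"
  shows "y (s + t) = flow f g t (y s) (Lp s \<omega>)"
proof -
  interpret integral_equation f g b y "sq_jumps (\<lambda>t. L t \<omega>)" by fact
  have "(\<lambda>n. euler_grid f g (\<lambda>u v. sq_jumps (\<lambda>t. L t \<omega>) v - sq_jumps (\<lambda>t. L t \<omega>) u) s (s + t) n (y s)) \<longlonglongrightarrow> y (s + t)"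
    by (rule solution_euler_limit) (use s t in auto)
  moreover have "euler_grid f g (\<lambda>u v. sq_jumps (\<lambda>t. L t \<omega>) v - sq_jumps (\<lambda>t. L t \<omega>) u) s (s + t) n (y s)
    = euler_grid f g (qvar (Lp s \<omega>)) 0 t n (y s)" for n
  proof (rule euler_grid_cong)
    fix i
    have g: "0 \<le> grid 0 t n i" "grid 0 t n i \<le> grid 0 t n (Suc i)"
      using grid_nonneg[OF order_refl t] grid_mono[OF t, of i "Suc i" n] by auto
    have "qvar (Lp s \<omega>) (grid 0 t n i) (grid 0 t n (Suc i)) = qvar (\<lambda>t. L t \<omega>) (s + grid 0 t n i) (s + grid 0 t n (Suc i))"
      by (rule qvar_Lp[OF s g])
    also have "\<dots> = sq_jumps (\<lambda>t. L t \<omega>) (s + grid 0 t n (Suc i)) - sq_jumps (\<lambda>t. L t \<omega>) (s + grid 0 t n i)"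
      using s g by (intro qvar_eq[OF x]) auto
    finally show "sq_jumps (\<lambda>t. L t \<omega>) (grid s (s + t) n (Suc i)) - sq_jumps (\<lambda>t. L t \<omega>) (grid s (s + t) n i)
      = qvar (Lp s \<omega>) (grid 0 t n i) (grid 0 t n (Suc i))"
      by (simp add: grid_shift)
  qed simp
  ultimately have "(\<lambda>n. euler_grid f g (qvar (Lp s \<omega>)) 0 t n (y s)) \<longlonglongrightarrow> y (s + t)" by simp
  moreover have "(\<lambda>n. euler_grid f g (qvar (Lp s \<omega>)) 0 t n (y s)) \<longlonglongrightarrow> flow f g t (y s) (Lp s \<omega>)"
    by (rule flow_convergent[OF lipschitz_coeffs_axioms x s t])
  ultimately show ?thesis by (rule LIMSEQ_unique)
qed

end

section \<open>Contraction and growth of the Euler scheme in the adapted norm\<close>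

locale cogarch_coeffs = adapted_norm B a e l K C nrm m1 m2
  for B :: "real ^ 'q ^ 'q" and a e l K C nrm m1 m2 +
  fixes \<alpha>\<^sub>0 :: real
  assumes K: "0 < K" and l: "l < 0" and \<alpha>\<^sub>0: "0 \<le> \<alpha>\<^sub>0"
begin

definition f :: "real ^ 'q \<Rightarrow> real ^ 'q" where "f y = B *v y"
definition g :: "real ^ 'q \<Rightarrow> real ^ 'q" where "g y = (\<alpha>\<^sub>0 + a \<bullet> y) *\<^sub>R e"
definition b :: real where "b = onorm ((*v) B) + (norm a * norm e + \<alpha>\<^sub>0 * norm e)"

lemma lipschitz_fg: "lipschitz_coeffs f g b"
proof
  have bl: "bounded_linear ((*v) B)" by (rule matrix_vector_mul_bounded_linear)
  have o: "0 \<le> onorm ((*v) B)" by (rule onorm_pos_le[OF bl])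
  have ae: "0 \<le> norm a * norm e" "0 \<le> \<alpha>\<^sub>0 * norm e" using \<alpha>\<^sub>0 by auto
  show "0 \<le> b" unfolding b_def using o ae by simp
  fix y z
  have "norm (f y - f z) = norm (B *v (y - z))" by (simp add: f_def matrix_vector_mult_diff_distrib)
  also have "\<dots> \<le> onorm ((*v) B) * norm (y - z)" by (rule onorm[OF bl])
  also have "\<dots> \<le> b * norm (y - z)" unfolding b_def using ae by (intro mult_right_mono) auto
  finally show "norm (f y - f z) \<le> b * norm (y - z)" .
  have "norm (f y) \<le> onorm ((*v) B) * norm y" unfolding f_def by (rule onorm[OF bl])
  also have "\<dots> \<le> b * (norm y + 1)" unfolding b_def using ae o by (intro mult_mono) auto
  finally show "norm (f y) \<le> b * (norm y + 1)" .
  have "g y - g z = (a \<bullet> (y - z)) *\<^sub>R e" by (simp add: g_def inner_diff_right algebra_simps)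
  then have "norm (g y - g z) \<le> (norm a * norm (y - z)) * norm e"
    using Cauchy_Schwarz_ineq2[of a "y - z"] by (simp add: mult_right_mono)
  also have "\<dots> = (norm a * norm e) * norm (y - z)" by simp
  also have "\<dots> \<le> b * norm (y - z)" unfolding b_def using ae o by (intro mult_right_mono) auto
  finally show "norm (g y - g z) \<le> b * norm (y - z)" .
  have "\<bar>\<alpha>\<^sub>0 + a \<bullet> y\<bar> \<le> \<alpha>\<^sub>0 + norm a * norm y"
    using Cauchy_Schwarz_ineq2[of a y] \<alpha>\<^sub>0 by linarith
  then have "norm (g y) \<le> (\<alpha>\<^sub>0 + norm a * norm y) * norm e" unfolding g_def by (simp add: mult_right_mono)
  also have "\<dots> = \<alpha>\<^sub>0 * norm e * 1 + (norm a * norm e) * norm y" by (simp add: algebra_simps)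
  also have "\<dots> \<le> b * 1 + b * norm y" unfolding b_def using ae o by (intro add_mono mult_right_mono) auto
  finally show "norm (g y) \<le> b * (norm y + 1)" by (simp add: algebra_simps)
qed

lemma fg_continuous: "continuous_on UNIV f" "continuous_on UNIV g"
  using lipschitz_imp_continuous[of f b] lipschitz_imp_continuous[of g b] lipschitz_fg
  by (auto simp: lipschitz_coeffs_def)

text \<open>By its triangle inequality the adapted norm is Lipschitz for the Euclidean norm.\<close>

lemma nrm_tendsto:
  assumes "X \<longlonglongrightarrow> x"
  shows "(\<lambda>n. nrm (X n)) \<longlonglongrightarrow> nrm x"
proof -
  have lip: "\<bar>nrm y - nrm z\<bar> \<le> m2 * norm (y - z)" for y z
    using nrm_triangle[of z "y - z"] nrm_triangle[of y "z - y"] nrm_le_norm[of "y - z"] nrm_le_norm[of "z - y"]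
    by (simp add: norm_minus_commute)
  have "(\<lambda>n. norm (X n - x)) \<longlonglongrightarrow> 0"
    using tendsto_norm[OF LIM_zero[OF assms]] by simp
  then have lim: "(\<lambda>n. m2 * norm (X n - x)) \<longlonglongrightarrow> 0"
    by (rule tendsto_mult_right_zero)
  have "(\<lambda>n. nrm (X n) - nrm x) \<longlonglongrightarrow> 0"
    by (rule Lim_null_comparison[OF _ lim]) (simp add: lip)
  then show ?thesis by (rule LIM_zero_cancel)
qed

text \<open>The difference of two schemes follows the homogeneous recursion, since
  \<open>\<alpha>\<^sub>0\<close> cancels; \<open>nrm_step\<close> applies to it directly.\<close>

lemma euler_nrm_contraction:
  assumes h: "0 \<le> h" and d: "\<And>i. 0 \<le> d i"
  shows "nrm (euler f g h d y n - euler f g h d z n) \<le> (\<Prod>i<n. exp (l * h + C * h\<^sup>2) + K * d i) * nrm (y - z)"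
proof (induction n)
  case (Suc n)
  let ?y = "euler f g h d y n" and ?z = "euler f g h d z n"
  have eq: "euler f g h d y (Suc n) - euler f g h d z (Suc n) = (?y - ?z) + (h *\<^sub>R (B *v (?y - ?z)) + d n *\<^sub>R ((a \<bullet> (?y - ?z)) *\<^sub>R e))"
    by (simp add: f_def g_def matrix_vector_mult_diff_distrib inner_diff_right algebra_simps)
  have "nrm (euler f g h d y (Suc n) - euler f g h d z (Suc n)) \<le> (exp (l * h + C * h\<^sup>2) + K * d n) * nrm (?y - ?z)"
    unfolding eq by (rule nrm_step[OF h d])
  also have "\<dots> \<le> (exp (l * h + C * h\<^sup>2) + K * d n) * ((\<Prod>i<n. exp (l * h + C * h\<^sup>2) + K * d i) * nrm (y - z))"
    using Suc d[of n] K by (intro mult_left_mono) (auto intro: add_nonneg_nonneg)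
  finally show ?case by (simp add: mult_ac)
qed simp

text \<open>With \<open>m = l * h + C * h^2\<close> a factor is
  \<open>exp m * (1 + exp (- m) * K * d)\<close>. Here \<open>exp (- m)\<close> is at most
  \<open>\<kappa> = exp (\<bar>l\<bar> * h)\<close>, and \<kappa> is taken out of the logarithm. For
  2^n steps of length 2^-n the term with \<open>C\<close> vanishes and \<kappa> tends to 1.\<close>

lemma contraction_product:
  assumes h: "0 \<le> h" and d: "\<And>i. 0 \<le> d i" and G: "(\<Sum>i<n. ln (1 + K * d i)) \<le> G"
  shows "(\<Prod>i<n. exp (l * h + C * h\<^sup>2) + K * d i) \<le> exp (real n * (l * h + C * h\<^sup>2) + exp (\<bar>l\<bar> * h) * G)"
proof -
  let ?m = "l * h + C * h\<^sup>2" and ?\<kappa> = "exp (\<bar>l\<bar> * h)"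
  have \<kappa>: "1 \<le> ?\<kappa>" using h by simp
  have Kd: "0 \<le> K * d i" for i using K d[of i] by simp
  have one: "exp ?m + K * d i \<le> exp (?m + ?\<kappa> * ln (1 + K * d i))" for i
  proof -
    have "- ?m \<le> \<bar>l\<bar> * h" using mult_nonneg_nonneg[OF C zero_le_power2[of h]] l by simp
    then have "exp (- ?m) \<le> ?\<kappa>" by simp
    then have "exp (- ?m) * (K * d i) \<le> ?\<kappa> * (K * d i)" using Kd by (rule mult_right_mono)
    then have "1 + exp (- ?m) * (K * d i) \<le> 1 + ?\<kappa> * (K * d i)" by simp
    also have "\<dots> = exp (ln (1 + ?\<kappa> * (K * d i)))" using Kd[of i] by (simp add: add_pos_nonneg)
    also have "\<dots> \<le> exp (?\<kappa> * ln (1 + K * d i))" using ln_1_plus_mult_le[OF \<kappa> Kd] by simp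
    finally have "exp ?m * (1 + exp (- ?m) * (K * d i)) \<le> exp ?m * exp (?\<kappa> * ln (1 + K * d i))"
      by (intro mult_left_mono) auto
    moreover have "exp ?m * (exp (- ?m) * (K * d i)) = K * d i"
      by (simp only: mult.assoc[symmetric] exp_add[symmetric]) simp
    moreover have "exp (?m + ?\<kappa> * ln (1 + K * d i)) = exp ?m * exp (?\<kappa> * ln (1 + K * d i))" by (rule exp_add)
    ultimately show ?thesis by (simp only: distrib_left mult_1_right)
  qed
  have "(\<Prod>i<n. exp ?m + K * d i) \<le> (\<Prod>i<n. exp (?m + ?\<kappa> * ln (1 + K * d i)))"
    by (rule prod_mono) (use one Kd in \<open>auto intro: add_nonneg_nonneg\<close>)
  also have "\<dots> = exp (\<Sum>i<n. ?m + ?\<kappa> * ln (1 + K * d i))" by (simp add: exp_sum)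
  also have "(\<Sum>i<n. ?m + ?\<kappa> * ln (1 + K * d i)) = real n * ?m + ?\<kappa> * (\<Sum>i<n. ln (1 + K * d i))"
    by (simp add: sum.distrib sum_distrib_left)
  also have "exp \<dots> \<le> exp (real n * ?m + ?\<kappa> * G)"
    using mult_left_mono[OF G, of ?\<kappa>] by simp
  finally show ?thesis .
qed

text \<open>Chosen so that \<open>K * d * R = d * \<alpha>\<^sub>0 * nrm e\<close>: adding
  \<open>R\<close> to the norm turns the affine recursion into a multiplicative one.\<close>

definition R :: real where "R = \<alpha>\<^sub>0 * nrm e / K"

lemma R_nonneg: "0 \<le> R"
  unfolding R_def using \<alpha>\<^sub>0 K nrm_nonneg by simp

lemma euler_nrm_growth:
  assumes h: "0 \<le> h" "l * h + C * h\<^sup>2 \<le> 0" and d: "\<And>i. 0 \<le> d i"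
  shows "nrm (euler f g h d y n) + R \<le> (\<Prod>i<n. 1 + K * d i) * (nrm y + R)"
proof (induction n)
  case (Suc n)
  let ?y = "euler f g h d y n"
  have eq: "euler f g h d y (Suc n) = (?y + (h *\<^sub>R (B *v ?y) + d n *\<^sub>R ((a \<bullet> ?y) *\<^sub>R e))) + (d n * \<alpha>\<^sub>0) *\<^sub>R e"
    by (simp add: f_def g_def algebra_simps)
  have "nrm (euler f g h d y (Suc n)) \<le> nrm (?y + (h *\<^sub>R (B *v ?y) + d n *\<^sub>R ((a \<bullet> ?y) *\<^sub>R e))) + nrm ((d n * \<alpha>\<^sub>0) *\<^sub>R e)"
    unfolding eq by (rule nrm_triangle)
  also have "\<dots> \<le> (1 + K * d n) * nrm ?y + d n * \<alpha>\<^sub>0 * nrm e"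
  proof (rule add_mono)
    show "nrm (?y + (h *\<^sub>R (B *v ?y) + d n *\<^sub>R ((a \<bullet> ?y) *\<^sub>R e))) \<le> (1 + K * d n) * nrm ?y"
      using h by (intro order_trans[OF nrm_step[OF h(1) d]] mult_right_mono nrm_nonneg) auto
    show "nrm ((d n * \<alpha>\<^sub>0) *\<^sub>R e) \<le> d n * \<alpha>\<^sub>0 * nrm e"
      using nrm_scale[of "d n * \<alpha>\<^sub>0" e] d[of n] \<alpha>\<^sub>0 by simp
  qed
  also have "d n * \<alpha>\<^sub>0 * nrm e = K * d n * R" using K by (simp add: R_def)
  finally have "nrm (euler f g h d y (Suc n)) + R \<le> (1 + K * d n) * (nrm ?y + R)" by (simp add: algebra_simps)
  also have "\<dots> \<le> (1 + K * d n) * ((\<Prod>i<n. 1 + K * d i) * (nrm y + R))"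
    using Suc d[of n] K by (intro mult_left_mono) (auto intro: add_nonneg_nonneg)
  finally show ?case by (simp add: mult_ac)
qed simp

end

locale cogarch = levy M L + cogarch_coeffs B a e l K C nrm m1 m2 \<alpha>\<^sub>0
  for M :: "'w measure" and L and B :: "real ^ 'q ^ 'q" and a e l K C nrm m1 m2 \<alpha>\<^sub>0 +
  fixes \<nu> :: "real measure"
  assumes \<nu>: "is_levy_measure M L \<nu>"
    and log_moment: "(\<integral>\<^sup>+y. ennreal (ln (1 + K * y\<^sup>2)) \<partial>\<nu>) < ennreal (- l)"
begin

definition G :: "'w \<Rightarrow> real" where
  "G \<omega> = enn2real (jsum (\<lambda>z. ln (1 + K * z\<^sup>2)) (Lp 0 \<omega>) 0 1)"

definition good :: "'w \<Rightarrow> bool" where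
  "good \<omega> \<longleftrightarrow> good_path (\<lambda>t. L t \<omega>) \<and> jsum (\<lambda>z. ln (1 + K * z\<^sup>2)) (Lp 0 \<omega>) 0 1 < \<infinity>"

abbreviation F :: "real \<Rightarrow> real ^ 'q \<Rightarrow> (real \<Rightarrow> real) \<Rightarrow> real ^ 'q" where
  "F \<equiv> flow f g"

lemma log_moment_finite: "(\<integral>\<^sup>+y. ennreal (ln (1 + K * y\<^sup>2)) \<partial>\<nu>) < \<infinity>"
  using log_moment by (auto intro: less_trans)

lemma AE_good: "AE \<omega> in M. good \<omega>"
  using AE_good_path[OF \<nu> K log_moment_finite] AE_log_jumps_finite[OF \<nu> K order_refl log_moment_finite]
  by eventually_elim (simp add: good_def)

lemma G_nonneg: "0 \<le> G \<omega>"
  by (simp add: G_def)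

lemma G_measurable [measurable]: "G \<in> borel_measurable M"
  unfolding G_def using measurable_log_jumps[OF K order_refl] by measurable

lemma nn_integral_G: "(\<integral>\<^sup>+\<omega>. ennreal (G \<omega>) \<partial>M) < ennreal (- l)"
proof -
  have "(\<integral>\<^sup>+\<omega>. ennreal (G \<omega>) \<partial>M) \<le> (\<integral>\<^sup>+\<omega>. jsum (\<lambda>z. ln (1 + K * z\<^sup>2)) (Lp 0 \<omega>) 0 1 \<partial>M)"
    unfolding G_def by (intro nn_integral_mono) (simp add: ennreal_enn2real_if)
  also have "\<dots> \<le> (\<integral>\<^sup>+y. ennreal (ln (1 + K * y\<^sup>2)) \<partial>\<nu>)" by (rule expected_log_jumps_le[OF \<nu> K])
  finally show ?thesis using log_moment by (rule le_less_trans)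
qed

lemma G_integrable: "integrable M G" and expectation_G: "expectation G < - l"
proof -
  show i: "integrable M G"
    using nn_integral_G by (intro integrableI_nonneg) (auto simp: G_nonneg intro: less_trans)
  have "ennreal (expectation G) = (\<integral>\<^sup>+\<omega>. ennreal (G \<omega>) \<partial>M)"
    by (rule nn_integral_eq_integral[symmetric, OF i]) (simp add: G_nonneg)
  then have "ennreal (expectation G) < ennreal (- l)" using nn_integral_G by simp
  then show "expectation G < - l"
    using Bochner_Integration.integral_nonneg[of M G] G_nonneg by (simp add: ennreal_less_iff)
qed

lemma good_log_sum:
  assumes "good \<omega>"
  shows "(\<Sum>i<2 ^ n. ln (1 + K * qvar (Lp 0 \<omega>) (grid 0 1 n i) (grid 0 1 n (Suc i)))) \<le> G \<omega>"
proof -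
  have gp: "good_path (\<lambda>t. L t \<omega>)" using assms by (simp add: good_def)
  have j: "jsum (\<lambda>z. ln (1 + K * z\<^sup>2)) (Lp 0 \<omega>) 0 1 = jsum (\<lambda>z. ln (1 + K * z\<^sup>2)) (\<lambda>t. L t \<omega>) 0 1"
    using jsum_Lp[of 0 0 1] by simp
  have q: "qvar (Lp 0 \<omega>) (grid 0 1 n i) (grid 0 1 n (Suc i)) = qvar (\<lambda>t. L t \<omega>) (grid 0 1 n i) (grid 0 1 n (Suc i))" for i
    using qvar_Lp[of 0 "grid 0 1 n i" "grid 0 1 n (Suc i)"] grid_nonneg[of 0 1 n i] grid_mono[of 0 1 i "Suc i" n] by simp
  show ?thesis unfolding q G_def j
    by (rule sum_ln_qvar_le[OF gp _ _ K]) (use assms j in \<open>auto simp: good_def\<close>)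
qed

lemma flow_contraction:
  assumes "good \<omega>"
  shows "nrm (F 1 y (Lp 0 \<omega>) - F 1 z (Lp 0 \<omega>)) \<le> exp (l + G \<omega>) * nrm (y - z)"
proof -
  have gp: "good_path (\<lambda>t. L t \<omega>)" using assms by (simp add: good_def)
  let ?E = "euler_grid f g (qvar (Lp 0 \<omega>)) 0 1"
  have lim1: "(\<lambda>n. nrm (?E n y - ?E n z)) \<longlonglongrightarrow> nrm (F 1 y (Lp 0 \<omega>) - F 1 z (Lp 0 \<omega>))"
    by (intro nrm_tendsto tendsto_diff flow_convergent[OF lipschitz_fg gp]) auto
  have "(\<lambda>n. exp (l + C * (1 / 2 ^ n) + exp (\<bar>l\<bar> * (1 / 2 ^ n)) * G \<omega>) * nrm (y - z))
      \<longlonglongrightarrow> exp (l + C * 0 + exp (\<bar>l\<bar> * 0) * G \<omega>) * nrm (y - z)"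
    by (intro tendsto_intros mesh_tendsto_0)
  then have lim2: "(\<lambda>n. exp (l + C * (1 / 2 ^ n) + exp (\<bar>l\<bar> * (1 / 2 ^ n)) * G \<omega>) * nrm (y - z)) \<longlonglongrightarrow> exp (l + G \<omega>) * nrm (y - z)"
    by simp
  have "nrm (?E n y - ?E n z) \<le> exp (l + C * (1 / 2 ^ n) + exp (\<bar>l\<bar> * (1 / 2 ^ n)) * G \<omega>) * nrm (y - z)" for n
  proof -
    let ?h = "1 / 2 ^ n :: real" and ?d = "\<lambda>i. qvar (Lp 0 \<omega>) (grid 0 1 n i) (grid 0 1 n (Suc i))"
    have "nrm (?E n y - ?E n z) \<le> (\<Prod>i<2 ^ n. exp (l * ?h + C * ?h\<^sup>2) + K * ?d i) * nrm (y - z)"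
      unfolding euler_grid_def diff_zero by (rule euler_nrm_contraction) (auto simp: qvar_def)
    also have "\<dots> \<le> exp (real (2 ^ n) * (l * ?h + C * ?h\<^sup>2) + exp (\<bar>l\<bar> * ?h) * G \<omega>) * nrm (y - z)"
      by (intro mult_right_mono contraction_product good_log_sum[OF assms] nrm_nonneg) (auto simp: qvar_def)
    \<comment> \<open>With 2^n steps of length 2^-n the second-order terms add up to
      \<open>C * 2^-n\<close> only.\<close>
    also have "real (2 ^ n) * (l * ?h + C * ?h\<^sup>2) = l + C * ?h" by (simp add: power2_eq_square field_simps)
    finally show ?thesis .
  qed
  then show ?thesis by (intro LIMSEQ_le[OF lim1 lim2]) auto
qed

text \<open>A crude bound: once the grid is fine, the drift factor is at most 1 and is dropped. It
  will control one application of the random map to 0.\<close>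

lemma flow_growth:
  assumes "good \<omega>"
  shows "nrm (F 1 y (Lp 0 \<omega>)) + R \<le> exp (G \<omega>) * (nrm y + R)"
proof -
  have gp: "good_path (\<lambda>t. L t \<omega>)" using assms by (simp add: good_def)
  let ?E = "euler_grid f g (qvar (Lp 0 \<omega>)) 0 1"
  have lim: "(\<lambda>n. nrm (?E n y) + R) \<longlonglongrightarrow> nrm (F 1 y (Lp 0 \<omega>)) + R"
    by (intro tendsto_intros nrm_tendsto flow_convergent[OF lipschitz_fg gp]) auto
  have "(\<lambda>n. l + C * (1 / 2 ^ n)) \<longlonglongrightarrow> l + C * 0" by (intro tendsto_intros mesh_tendsto_0)
  then have "eventually (\<lambda>n. l + C * (1 / 2 ^ n) < 0) sequentially"
    using l by (intro order_tendstoD) auto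
  then have "eventually (\<lambda>n. nrm (?E n y) + R \<le> exp (G \<omega>) * (nrm y + R)) sequentially"
  proof eventually_elim
    case (elim n)
    let ?h = "1 / 2 ^ n :: real" and ?d = "\<lambda>i. qvar (Lp 0 \<omega>) (grid 0 1 n i) (grid 0 1 n (Suc i))"
    have d: "0 \<le> ?d i" for i by (simp add: qvar_def)
    have "?h * (l + C * ?h) \<le> 0" using elim by (intro mult_nonneg_nonpos) auto
    then have m: "l * ?h + C * ?h\<^sup>2 \<le> 0" by (simp add: power2_eq_square algebra_simps)
    have pos: "0 < 1 + K * ?d i" for i using K d[of i] by (simp add: add_pos_nonneg)
    have "nrm (?E n y) + R \<le> (\<Prod>i<2 ^ n. 1 + K * ?d i) * (nrm y + R)"
      unfolding euler_grid_def diff_zero by (rule euler_nrm_growth[OF _ m d]) simp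
    also have "(\<Prod>i<2 ^ n. 1 + K * ?d i) = exp (\<Sum>i<2 ^ n. ln (1 + K * ?d i))"
      by (simp add: exp_sum pos)
    also have "\<dots> * (nrm y + R) \<le> exp (G \<omega>) * (nrm y + R)"
      using good_log_sum[OF assms, of n] R_nonneg nrm_nonneg[of y] by (intro mult_right_mono) auto
    finally show ?case .
  qed
  from tendsto_upperbound[OF lim this] show ?thesis by simp
qed

end

section \<open>Boundedness of random walks with negative drift\<close>

definition shift_seq :: "(nat \<Rightarrow> 'a) \<Rightarrow> nat \<Rightarrow> 'a" where
  "shift_seq w = (\<lambda>i. w (Suc i))"

lemma shift_seq_case_nat [simp]: "shift_seq (case_nat s w) = w"
  by (simp add: shift_seq_def)

text \<open>The maximum of the partial sums of lengths 0 to n. The recursive form builds in the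
  relation between the maximum and its shift on which Garsia's argument rests.\<close>

primrec max_partial_sum :: "('a \<Rightarrow> real) \<Rightarrow> nat \<Rightarrow> (nat \<Rightarrow> 'a) \<Rightarrow> real" where
  "max_partial_sum X 0 w = 0"
| "max_partial_sum X (Suc n) w = max 0 (X (w 0) + max_partial_sum X n (shift_seq w))"

lemma max_partial_sum_nonneg: "0 \<le> max_partial_sum X n w"
  by (cases n) auto

lemma max_partial_sum_mono: "max_partial_sum X n w \<le> max_partial_sum X (Suc n) w"
proof (induction n arbitrary: w)
  case (Suc n)
  show ?case
    using Suc[of "shift_seq w"] unfolding max_partial_sum.simps(2)[of X "Suc n"] max_partial_sum.simps(2)[of X n w]
    by (intro max.mono) auto
qed simp

lemma partial_sum_shift: "(\<Sum>k<Suc n. X (w k)) = X (w 0) + (\<Sum>k<n. X (shift_seq w k))" for X :: "'a \<Rightarrow> real"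
  by (subst sum.lessThan_Suc_shift) (simp add: shift_seq_def)

lemma partial_sum_le_max: "(\<Sum>k<n. X (w k)) \<le> max_partial_sum X n w"
proof (induction n arbitrary: w)
  case (Suc n)
  show ?case using Suc[of "shift_seq w"] unfolding partial_sum_shift by simp
qed simp

section \<open>Independent sequences, their shift, and walks with negative drift\<close>

context sequence_space
begin

lemma measurable_shift_seq [measurable]: "shift_seq \<in> measurable S S"
  unfolding shift_seq_def by (rule measurable_PiM_single') (auto simp: space_PiM)

lemma measurable_case_nat_pair: "(\<lambda>(s, w). case_nat s w) \<in> measurable (M \<Otimes>\<^sub>M S) S"
  by measurable

lemma measurable_coord [measurable]: "(\<lambda>w. w i) \<in> measurable S M"
  by (rule measurable_component_singleton) simp

text \<open>Prepending an independent value to the sequence reproduces the law, so the first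
  coordinate can be integrated separately.\<close>

lemma nn_integral_case_nat:
  assumes h: "h \<in> borel_measurable S"
  shows "(\<integral>\<^sup>+w. h w \<partial>S) = (\<integral>\<^sup>+s. \<integral>\<^sup>+w. h (case_nat s w) \<partial>S \<partial>M)"
proof -
  have hm: "(\<lambda>p. h (case p of (s, w) \<Rightarrow> case_nat s w)) \<in> borel_measurable (M \<Otimes>\<^sub>M S)"
    by (rule measurable_compose[OF measurable_case_nat_pair h])
  have "(\<integral>\<^sup>+w. h w \<partial>S) = (\<integral>\<^sup>+w. h w \<partial>distr (M \<Otimes>\<^sub>M S) S (\<lambda>(s, w). case_nat s w))" by (simp add: PiM_iter)
  also have "\<dots> = (\<integral>\<^sup>+p. h (case p of (s, w) \<Rightarrow> case_nat s w) \<partial>(M \<Otimes>\<^sub>M S))"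
    by (rule nn_integral_distr[OF measurable_case_nat_pair]) (use h in simp)
  also have "\<dots> = (\<integral>\<^sup>+s. \<integral>\<^sup>+w. h (case_nat s w) \<partial>S \<partial>M)"
    using P.nn_integral_fst[OF hm] by simp
  finally show ?thesis .
qed

lemma distr_shift_seq: "distr S S shift_seq = S"
proof (rule measure_eqI)
  fix A assume "A \<in> sets (distr S S shift_seq)"
  then have A: "A \<in> sets S" by simp
  have "emeasure (distr S S shift_seq) A = (\<integral>\<^sup>+w. indicator A w \<partial>distr S S shift_seq)" using A by simp
  also have "\<dots> = (\<integral>\<^sup>+w. indicator A (shift_seq w) \<partial>S)"
    by (rule nn_integral_distr[OF measurable_shift_seq]) (use A in simp)
  also have "\<dots> = (\<integral>\<^sup>+s. \<integral>\<^sup>+w. indicator A w \<partial>S \<partial>M)"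
    using A by (subst nn_integral_case_nat) auto
  also have "\<dots> = emeasure S A" using A by (simp add: M.emeasure_space_1)
  finally show "emeasure (distr S S shift_seq) A = emeasure S A" .
qed simp

lemma distr_coord: "distr S M (\<lambda>w. w i) = M"
  using PiM_component[of i] by simp

lemma integral_coord:
  fixes X :: "'a \<Rightarrow> real"
  assumes "integrable M X"
  shows "integrable S (\<lambda>w. X (w i))" "(\<integral>w. X (w i) \<partial>S) = (\<integral>s. X s \<partial>M)"
proof -
  show "integrable S (\<lambda>w. X (w i))"
    using integrable_distr[of "\<lambda>w. w i" S M X] assms by (simp add: distr_coord)
  show "(\<integral>w. X (w i) \<partial>S) = (\<integral>s. X s \<partial>M)"
    using integral_distr[of "\<lambda>w. w i" S M X] assms by (simp add: distr_coord)
qed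

lemma integral_shift_seq:
  fixes h :: "(nat \<Rightarrow> 'a) \<Rightarrow> real"
  assumes "integrable S h"
  shows "integrable S (\<lambda>w. h (shift_seq w))" "(\<integral>w. h (shift_seq w) \<partial>S) = (\<integral>w. h w \<partial>S)"
proof -
  show "integrable S (\<lambda>w. h (shift_seq w))"
    using integrable_distr[of shift_seq S S h] assms by (simp add: distr_shift_seq)
  show "(\<integral>w. h (shift_seq w) \<partial>S) = (\<integral>w. h w \<partial>S)"
    using integral_distr[of shift_seq S S h] assms by (simp add: distr_shift_seq)
qed

lemma max_partial_sum_integrable:
  assumes "integrable M X"
  shows "integrable S (max_partial_sum X n)"
proof (induction n)
  case 0
  have "max_partial_sum X 0 = (\<lambda>_. 0)" by (simp add: fun_eq_iff)
  then show ?case by simp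
next
  case (Suc n)
  have "integrable S (\<lambda>w. max 0 (X (w 0) + max_partial_sum X n (shift_seq w)))"
    by (intro integrable_max integrable_zero Bochner_Integration.integrable_add integral_coord assms integral_shift_seq Suc)
  then show ?case by (simp add: fun_eq_iff[symmetric] cong: integrable_cong)
qed

text \<open>
  Garsia's maximal inequality, applied on the shift-invariant set where the partial sums are
  unbounded; that set is independent of the first coordinate.
\<close>

lemma partial_sums_bounded_above:
  fixes X :: "'a \<Rightarrow> real"
  assumes X: "integrable M X" and neg: "(\<integral>s. X s \<partial>M) < 0"
  shows "AE w in S. \<exists>c. \<forall>n. (\<Sum>k<n. X (w k)) \<le> c"
proof -
  interpret MS: pair_prob_space M S ..
  have Xm [measurable]: "X \<in> borel_measurable M" using X by simp
  define A where "A = {w \<in> space S. \<forall>c::nat. \<exists>n. real c < (\<Sum>k<n. X (w k))}"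
  have A [measurable]: "A \<in> sets S" unfolding A_def by measurable
  have inv: "shift_seq w \<in> A \<longleftrightarrow> w \<in> A" if w: "w \<in> space S" for w
  proof -
    have sw: "shift_seq w \<in> space S" using measurable_space[OF measurable_shift_seq w] .
    have "\<exists>n. real c < (\<Sum>k<n. X (w k))" if U: "\<forall>c::nat. \<exists>n. real c < (\<Sum>k<n. X (shift_seq w k))" for c :: nat
    proof -
      obtain c' :: nat where "real c - X (w 0) \<le> real c'" using real_arch_simple by blast
      moreover obtain n where "real c' < (\<Sum>k<n. X (shift_seq w k))" using U by blast
      ultimately have "real c < (\<Sum>k<Suc n. X (w k))" unfolding partial_sum_shift by linarith
      then show ?thesis by blast
    qed
    moreover have "\<exists>n. real c < (\<Sum>k<n. X (shift_seq w k))" if U: "\<forall>c::nat. \<exists>n. real c < (\<Sum>k<n. X (w k))" for c :: nat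
    proof -
      obtain c' :: nat where c': "real c + \<bar>X (w 0)\<bar> \<le> real c'" using real_arch_simple by blast
      obtain n where n: "real c' < (\<Sum>k<n. X (w k))" using U by blast
      have "n \<noteq> 0" using n by (intro notI) simp
      then obtain m where "n = Suc m" by (cases n) auto
      then have "real c < (\<Sum>k<m. X (shift_seq w k))" using c' n partial_sum_shift[of X w m] by simp
      then show ?thesis by blast
    qed
    ultimately show ?thesis unfolding A_def using w sw by blast
  qed
  let ?I = "indicator A :: (nat \<Rightarrow> 'a) \<Rightarrow> real"
  let ?m = "max_partial_sum X"
  note mi = max_partial_sum_integrable[OF X]
  have mm [measurable]: "?m n \<in> borel_measurable S" for n using mi[of n] by simp
  have Im: "integrable S (\<lambda>w. ?I w * ?m n w)" for n
    using mi[of n] A by (intro integrable_real_mult_indicator[of A S "?m n", simplified mult.commute]) auto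
  have Is: "integrable S (\<lambda>w. ?I w * ?m n (shift_seq w))" "(\<integral>w. ?I w * ?m n (shift_seq w) \<partial>S) = (\<integral>w. ?I w * ?m n w \<partial>S)" for n
  proof -
    have eq: "?I (shift_seq w) * ?m n (shift_seq w) = ?I w * ?m n (shift_seq w)" if "w \<in> space S" for w
      using inv[OF that] by (simp add: indicator_def)
    show "integrable S (\<lambda>w. ?I w * ?m n (shift_seq w))"
      by (rule Bochner_Integration.integrable_cong[OF refl eq, THEN iffD1, OF _ integral_shift_seq(1)[OF Im]])
    show "(\<integral>w. ?I w * ?m n (shift_seq w) \<partial>S) = (\<integral>w. ?I w * ?m n w \<partial>S)"
      by (rule trans[OF Bochner_Integration.integral_cong[OF refl eq[symmetric]] integral_shift_seq(2)[OF Im]])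
  qed
  \<comment> \<open>Garsia's difference. Its integral is nonnegative, because the shift preserves
    the measure and the maxima increase with \<open>n\<close>; on \<open>A\<close> it is eventually
    equal to \<open>X (w 0)\<close>.\<close>
  define D where "D n w = ?I w * (?m (Suc n) w - ?m n (shift_seq w))" for n w
  have D_nonneg: "0 \<le> (\<integral>w. D n w \<partial>S)" for n
  proof -
    have "(\<integral>w. ?I w * ?m n w \<partial>S) \<le> (\<integral>w. ?I w * ?m (Suc n) w \<partial>S)"
      by (intro integral_mono Im mult_left_mono max_partial_sum_mono) auto
    moreover have "(\<integral>w. D n w \<partial>S) = (\<integral>w. ?I w * ?m (Suc n) w \<partial>S) - (\<integral>w. ?I w * ?m n (shift_seq w) \<partial>S)"
      unfolding D_def right_diff_distrib by (rule Bochner_Integration.integral_diff[OF Im Is(1)])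
    ultimately show ?thesis using Is(2)[of n] by linarith
  qed
  have lim: "(\<lambda>n. \<integral>w. D n w \<partial>S) \<longlonglongrightarrow> (\<integral>w. ?I w * X (w 0) \<partial>S)"
  proof (rule integral_dominated_convergence[where w = "\<lambda>w. \<bar>X (w 0)\<bar>"])
    show "integrable S (\<lambda>w. \<bar>X (w 0)\<bar>)" by (intro integrable_abs integral_coord X)
    show "AE w in S. norm (D n w) \<le> \<bar>X (w 0)\<bar>" for n
    proof (rule AE_I2)
      fix w
      show "norm (D n w) \<le> \<bar>X (w 0)\<bar>"
        using max_partial_sum_nonneg[of X n "shift_seq w"] by (auto simp: D_def indicator_def max_def)
    qed
    show "AE w in S. (\<lambda>n. D n w) \<longlonglongrightarrow> ?I w * X (w 0)"
    proof (rule AE_I2)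
      fix w
      show "(\<lambda>n. D n w) \<longlonglongrightarrow> ?I w * X (w 0)"
      proof (cases "w \<in> A")
        case True
        then obtain N where "real 0 < (\<Sum>k<N. X (w k))" unfolding A_def by blast
        then have N: "0 < ?m N w" using partial_sum_le_max[of X w N] by simp
        have "0 < ?m n w" if "n \<ge> N" for n
          using lift_Suc_mono_le[of "\<lambda>n. ?m n w", OF max_partial_sum_mono that] N by simp
        then have "D n w = ?I w * X (w 0)" if "n \<ge> N" for n
          using that[THEN le_SucI] by (force simp: D_def max_def split: if_splits)
        then show ?thesis by (intro tendsto_eventually) (auto simp: eventually_sequentially)
      qed (simp add: D_def)
    qed
  qed (auto simp: D_def)
  have 1: "0 \<le> (\<integral>w. ?I w * X (w 0) \<partial>S)"
    by (rule LIMSEQ_le_const[OF lim]) (use D_nonneg in auto)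
  have 2: "(\<integral>w. ?I w * X (w 0) \<partial>S) = (\<integral>s. X s \<partial>M) * measure S A"
  proof -
    \<comment> \<open>By invariance of \<open>A\<close> the indicator may be evaluated at the
      shifted sequence, which is independent of the first coordinate, so the integral
      factorises.\<close>
    have "(\<integral>w. ?I w * X (w 0) \<partial>S) = (\<integral>w. ?I (shift_seq w) * X (w 0) \<partial>S)"
      using inv by (intro Bochner_Integration.integral_cong) (auto simp: indicator_def)
    also have "\<dots> = (\<integral>w. ?I (shift_seq w) * X (w 0) \<partial>distr (M \<Otimes>\<^sub>M S) S (\<lambda>(s, w). case_nat s w))" by (simp add: PiM_iter)
    also have "\<dots> = (\<integral>p. ?I (shift_seq (case p of (s, w) \<Rightarrow> case_nat s w)) * X ((case p of (s, w) \<Rightarrow> case_nat s w) 0) \<partial>(M \<Otimes>\<^sub>M S))"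
      by (rule integral_distr[OF measurable_case_nat_pair]) measurable
    also have "\<dots> = (\<integral>p. X (fst p) * ?I (snd p) \<partial>(M \<Otimes>\<^sub>M S))"
      by (intro Bochner_Integration.integral_cong) auto
    also have "\<dots> = (\<integral>s. \<integral>w. X s * ?I w \<partial>S \<partial>M)"
    proof -
      have "integrable (M \<Otimes>\<^sub>M S) (\<lambda>p. X (fst p) * ?I (snd p))"
      proof (rule Bochner_Integration.integrable_bound)
        show "integrable (M \<Otimes>\<^sub>M S) (\<lambda>p. X (fst p))"
          using integrable_distr[of fst "M \<Otimes>\<^sub>M S" M X] X P.distr_pair_fst[of M] by simp
      qed (auto simp: indicator_def)
      from MS.integral_fst'[OF this] show ?thesis by simp
    qed
    also have "\<dots> = (\<integral>s. X s \<partial>M) * measure S A" using A by simp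
    finally show ?thesis .
  qed
  have "measure S A = 0"
  proof (rule ccontr)
    assume "measure S A \<noteq> 0"
    then have "0 < measure S A" using measure_nonneg[of S A] by linarith
    then have "(\<integral>s. X s \<partial>M) * measure S A < 0" using neg by (simp add: mult_neg_pos)
    then show False using 1 2 by simp
  qed
  then have "A \<in> null_sets S" using A by (simp add: null_sets_def P.emeasure_eq_measure)
  then have "AE w in S. w \<notin> A" by (rule AE_not_in)
  with AE_space show ?thesis
  proof eventually_elim
    case (elim w)
    then obtain c :: nat where "\<And>n. \<not> real c < (\<Sum>k<n. X (w k))" unfolding A_def by blast
    then show ?case by (intro exI[of _ "real c"]) (simp add: not_less)
  qed
qed

end

section \<open>Convergence in distribution\<close>

lemma (in sigma_finite_measure) AE_pair_snd:
  assumes "AE w in M. P w"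
  shows "AE p in N \<Otimes>\<^sub>M M. P (snd p)"
proof -
  obtain A where A: "A \<in> null_sets M" "{w \<in> space M. \<not> P w} \<subseteq> A" using assms by (auto elim!: AE_E)
  have "space N \<times> A \<in> null_sets (N \<Otimes>\<^sub>M M)"
    using A(1) by (auto simp: null_sets_def emeasure_pair_measure_Times)
  then show ?thesis
    by (rule AE_I') (use A(2) in \<open>auto simp: space_pair_measure\<close>)
qed

text \<open>The functions \<open>max 0 (1 - n * infdist x A)\<close> decrease to the indicator of a
  nonempty closed set \<open>A\<close>. The measures thus agree on closed sets, an
  intersection-stable generator.\<close>

lemma measure_eqI_bounded_continuous:
  fixes \<mu> \<nu> :: "'b::metric_space measure"
  assumes \<mu>: "prob_space \<mu>" "sets \<mu> = sets borel" and \<nu>: "prob_space \<nu>" "sets \<nu> = sets borel"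
    and eq: "\<And>f :: 'b \<Rightarrow> real. continuous_on UNIV f \<Longrightarrow> bounded (range f) \<Longrightarrow> integral\<^sup>L \<mu> f = integral\<^sup>L \<nu> f"
  shows "\<mu> = \<nu>"
proof -
  interpret \<mu>: prob_space \<mu> by fact
  interpret \<nu>: prob_space \<nu> by fact
  have sp: "space \<mu> = UNIV" "space \<nu> = UNIV" using sets_eq_imp_space_eq[OF \<mu>(2)] sets_eq_imp_space_eq[OF \<nu>(2)] by auto
  have closed_eq: "emeasure \<mu> A = emeasure \<nu> A" if A: "closed A" for A
  proof (cases "A = {}")
    case False
    define f where "f n x = max 0 (1 - real n * infdist x A)" for n x
    have fc: "continuous_on UNIV (f n)" for n unfolding f_def by (intro continuous_intros)
    have fb: "0 \<le> f n x" "f n x \<le> 1" for n x unfolding f_def by (auto simp: infdist_nonneg)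
    have fm: "f n \<in> borel_measurable borel" for n by (rule borel_measurable_continuous_onI[OF fc])
    have lim: "(\<lambda>n. f n x) \<longlonglongrightarrow> indicator A x" for x
    proof (cases "x \<in> A")
      case True
      then show ?thesis by (simp add: f_def infdist_zero)
    next
      case False2: False
      then have pos: "0 < infdist x A" using infdist_pos_not_in_closed[OF A False] by simp
      obtain N where N: "1 < real N * infdist x A" using reals_Archimedean3[OF pos] by auto
      have "f n x = 0" if "n \<ge> N" for n
      proof -
        have "real N * infdist x A \<le> real n * infdist x A" using that pos by (intro mult_right_mono) auto
        then show ?thesis using N by (simp add: f_def)
      qed
      then show ?thesis using False2 by (intro tendsto_eventually) (auto simp: eventually_sequentially)
    qed
    have conv: "(\<lambda>n. integral\<^sup>L \<rho> (f n)) \<longlonglongrightarrow> measure \<rho> A" if "prob_space \<rho>" "sets \<rho> = sets borel" for \<rho>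
    proof -
      interpret prob_space \<rho> by fact
      have As: "A \<in> sets \<rho>" using A that(2) by simp
      have "(\<lambda>n. integral\<^sup>L \<rho> (f n)) \<longlonglongrightarrow> integral\<^sup>L \<rho> (indicator A)"
        by (rule integral_dominated_convergence[where w = "\<lambda>_. 1"])
          (use lim fb fm As borel_closed[OF A] in \<open>auto simp: measurable_cong_sets[OF that(2) refl]\<close>)
      then show ?thesis using As by simp
    qed
    have "integral\<^sup>L \<mu> (f n) = integral\<^sup>L \<nu> (f n)" for n
      by (rule eq[OF fc]) (use fb in \<open>auto simp: bounded_iff intro!: exI[of _ 1]\<close>)
    then have "measure \<mu> A = measure \<nu> A"
      using LIMSEQ_unique[OF conv[OF \<mu>], of "measure \<nu> A"] conv[OF \<nu>] by simp
    then show ?thesis by (simp add: \<mu>.emeasure_eq_measure \<nu>.emeasure_eq_measure)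
  qed simp
  show ?thesis
  proof (rule measure_eqI_generator_eq[where E = "Collect closed" and \<Omega> = UNIV and A = "\<lambda>_. UNIV"])
    show "Int_stable (Collect closed :: 'b set set)" by (auto simp: Int_stable_def)
    show "sets \<mu> = sigma_sets UNIV (Collect closed)" "sets \<nu> = sigma_sets UNIV (Collect closed)"
      unfolding \<mu>(2) \<nu>(2) by (simp_all add: borel_eq_closed)
  qed (use closed_eq in auto)
qed

locale cogarch_state = cogarch M L B a last_unit l K C nrm m1 m2 \<alpha>\<^sub>0 \<nu>
  for M :: "'w measure" and L and B :: "real ^ 'q::{finite,linorder} ^ 'q::{finite,linorder}" and a l K C nrm m1 m2 \<alpha>\<^sub>0 \<nu>
begin

lemma state_processD:
  assumes "state_process M L B a \<alpha>\<^sub>0 Z"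
  shows "0 \<le> t \<Longrightarrow> Z t \<in> borel_measurable M" "\<omega> \<in> space M \<Longrightarrow> cadlag (\<lambda>t. Z t \<omega>)"
    "independent_start M L (Z 0)"
    "AE \<omega> in M. good \<omega> \<and> integral_equation f g b (\<lambda>t. Z t \<omega>) (sq_jumps (\<lambda>t. L t \<omega>))"
proof -
  show 1: "0 \<le> t \<Longrightarrow> Z t \<in> borel_measurable M" for t using assms by (auto simp: state_process_def)
  show 2: "\<omega> \<in> space M \<Longrightarrow> cadlag (\<lambda>t. Z t \<omega>)" for \<omega> using assms by (auto simp: state_process_def)
  show "independent_start M L (Z 0)" using assms by (auto simp: state_process_def independent_start_def)
  have "AE \<omega> in M. \<forall>t\<ge>0. Z t \<omega> = Z 0 \<omega>
          + (LBINT s:{0<..t}. B *v left_lim Z s \<omega>)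
          + (LINT s:{0<..t}|interval_measure (\<lambda>u. disc_qv L u \<omega>). (\<alpha>\<^sub>0 + a \<bullet> left_lim Z s \<omega>) *\<^sub>R last_unit)"
    using assms by (auto simp: state_process_def)
  with AE_good AE_space show "AE \<omega> in M. good \<omega> \<and> integral_equation f g b (\<lambda>t. Z t \<omega>) (sq_jumps (\<lambda>t. L t \<omega>))"
  proof eventually_elim
    case (elim \<omega>)
    then have gp: "good_path (\<lambda>t. L t \<omega>)" by (simp add: good_def)
    have "integral_equation f g b (\<lambda>t. Z t \<omega>) (sq_jumps (\<lambda>t. L t \<omega>))"
      unfolding integral_equation_def integral_equation_axioms_def
    proof (intro conjI allI impI lipschitz_fg)
      fix v :: real assume "0 \<le> v"
      have eq: "(\<lambda>u. disc_qv L u \<omega>) = sq_jumps (\<lambda>t. L t \<omega>)" by (simp add: disc_qv_eq fun_eq_iff)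
      show "Z v \<omega> = Z 0 \<omega> + (LBINT r:{0<..v}. f (Lim (at_left r) (\<lambda>t. Z t \<omega>)))
        + (LINT r:{0<..v}|interval_measure (sq_jumps (\<lambda>t. L t \<omega>)). g (Lim (at_left r) (\<lambda>t. Z t \<omega>)))"
        using elim(3)[rule_format, OF \<open>0 \<le> v\<close>] unfolding f_def g_def left_lim_def eq .
    next
      show "cadlag (\<lambda>t. Z t \<omega>)" by (rule 2[OF elim(2)])
    qed (rule sq_jumps_mono[OF gp], assumption, rule sq_jumps_right_cont[OF gp])
    then show ?case using elim by simp
  qed
qed

lemma state_flow:
  assumes "state_process M L B a \<alpha>\<^sub>0 Z"
  shows "AE \<omega> in M. \<forall>s\<ge>0. \<forall>t\<ge>0. Z (s + t) \<omega> = F t (Z s \<omega>) (Lp s \<omega>)"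
  using state_processD(4)[OF assms]
proof eventually_elim
  case (elim \<omega>)
  then have ie: "integral_equation f g b (\<lambda>t. Z t \<omega>) (sq_jumps (\<lambda>t. L t \<omega>))" and gp: "good_path (\<lambda>t. L t \<omega>)"
    by (simp_all add: good_def)
  show ?case using solution_flow[OF ie gp] by blast
qed

lemma measurable_F: "0 \<le> t \<Longrightarrow> (\<lambda>(y, x). F t y x) \<in> measurable (borel \<Otimes>\<^sub>M paths) borel"
  by (rule measurable_flow[OF _ fg_continuous])

lemma state_initial:
  assumes "state_process M L B a \<alpha>\<^sub>0 Z" "0 \<le> s"
  shows "AE \<omega> in M. Z s \<omega> = F s (Z 0 \<omega>) (Lp 0 \<omega>)"
  using state_flow[OF assms(1)]
proof eventually_elim
  case (elim \<omega>)
  from elim[rule_format, of 0 s] assms(2) show ?case by simp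
qed

lemma state_markov:
  assumes Z: "state_process M L B a \<alpha>\<^sub>0 Z" and s: "0 \<le> s" and h: "h \<in> borel_measurable (borel \<Otimes>\<^sub>M paths)"
  shows "(\<integral>\<^sup>+\<omega>. h (Z s \<omega>, Lp s \<omega>) \<partial>M) = (\<integral>\<^sup>+\<omega>. \<integral>\<^sup>+x. h (Z s \<omega>, x) \<partial>path_law \<partial>M)"
proof (rule markov[OF s state_processD(3)[OF Z] state_initial[OF Z s] measurable_F[OF s] _ h])
  show "F s z x = F s z x'" if "\<And>u. 0 \<le> u \<Longrightarrow> u \<le> s \<Longrightarrow> x u = x' u" for z x x'
    by (rule flow_local[OF s that])
qed

lemma state_distr_markov:
  assumes Z: "state_process M L B a \<alpha>\<^sub>0 Z" and s: "0 \<le> s"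
  shows "distr M (borel \<Otimes>\<^sub>M paths) (\<lambda>\<omega>. (Z s \<omega>, Lp s \<omega>)) = distr M borel (Z s) \<Otimes>\<^sub>M path_law"
proof (rule distr_markov[OF s state_processD(3)[OF Z] state_initial[OF Z s] measurable_F[OF s] _ state_processD(1)[OF Z s]])
  show "F s z x = F s z x'" if "\<And>u. 0 \<le> u \<Longrightarrow> u \<le> s \<Longrightarrow> x u = x' u" for z x x'
    by (rule flow_local[OF s that])
qed

section \<open>Backward iteration of independent unit-time maps\<close>

sublocale seq: sequence_space M ..

abbreviation "S \<equiv> seq.S"

text \<open>With f_i the unit-time map driven by the path of \<open>w i\<close>, this is f_0 o f_1 o
  ... o f_(n-1) applied to \<open>y\<close>. The independent copies live on the infinite power of
  \<open>M\<close> itself.\<close>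

primrec iter :: "nat \<Rightarrow> real ^ 'q::{finite,linorder} \<Rightarrow> (nat \<Rightarrow> 'w) \<Rightarrow> real ^ 'q::{finite,linorder}" where
  "iter 0 y w = y"
| "iter (Suc n) y w = F 1 (iter n y (shift_seq w)) (Lp 0 (w 0))"

text \<open>Passing from \<open>n\<close> to \<open>n + 1\<close> only changes the starting point of
  the same \<open>n\<close> maps, which is why contraction makes the iterates a Cauchy
  sequence.\<close>

lemma iter_Suc_right: "iter (Suc n) y w = iter n (F 1 y (Lp 0 (w n))) w"
proof (induction n arbitrary: w)
  case (Suc n)
  have "iter (Suc (Suc n)) y w = F 1 (iter (Suc n) y (shift_seq w)) (Lp 0 (w 0))" by simp
  also have "iter (Suc n) y (shift_seq w) = iter n (F 1 y (Lp 0 (shift_seq w n))) (shift_seq w)" by (rule Suc)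
  finally show ?case by (simp add: shift_seq_def)
qed simp

lemma measurable_iter: "(\<lambda>p. iter n (fst p) (snd p)) \<in> measurable (borel \<Otimes>\<^sub>M S) borel"
proof (induction n)
  case (Suc n)
  have 1: "(\<lambda>p. iter n (fst p) (shift_seq (snd p))) \<in> measurable (borel \<Otimes>\<^sub>M S) borel"
    using measurable_compose[OF measurable_Pair[OF measurable_fst measurable_compose[OF measurable_snd seq.measurable_shift_seq]] Suc] by simp
  have 2: "(\<lambda>p. Lp 0 (snd p 0)) \<in> measurable (borel \<Otimes>\<^sub>M S) paths"
    by (rule measurable_compose[OF measurable_compose[OF measurable_snd seq.measurable_coord] Lp_measurable]) simp
  show ?case
    using measurable_compose[OF measurable_Pair[OF 1 2] measurable_F[of 1]] by simp
qed simp

lemma measurable_iter' [measurable (raw)]: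
  assumes "u \<in> borel_measurable N" "v \<in> measurable N S"
  shows "(\<lambda>x. iter n (u x) (v x)) \<in> borel_measurable N"
  using measurable_compose[OF measurable_Pair[OF assms] measurable_iter] by simp

text \<open>For fixed \<open>n\<close> the order of independent, identically distributed maps does
  not affect the law of their composition. The last time step acts on the outside and is therefore
  assigned to coordinate 0, by Fubini and splitting off the first coordinate.\<close>

lemma nn_integral_state_iter:
  assumes Z: "state_process M L B a \<alpha>\<^sub>0 Z" and s: "0 \<le> s" and h: "h \<in> borel_measurable borel"
  shows "(\<integral>\<^sup>+\<omega>. h (Z (s + real n) \<omega>) \<partial>M) = (\<integral>\<^sup>+\<omega>. \<integral>\<^sup>+w. h (iter n (Z s \<omega>) w) \<partial>S \<partial>M)"
  using h
proof (induction n arbitrary: h)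
  case 0
  then show ?case by (simp add: seq.P.emeasure_space_1)
next
  case (Suc n)
  interpret MS: pair_prob_space M S ..
  interpret Q: prob_space path_law by (rule prob_space_path_law)
  have sn: "0 \<le> s + real n" using s by simp
  have F1: "(\<lambda>p. h (F 1 (fst p) (snd p))) \<in> borel_measurable (borel \<Otimes>\<^sub>M paths)"
    using measurable_compose[OF measurable_F[of 1] Suc.prems] by (simp add: split_beta)
  have F1x: "(\<lambda>x. h (F 1 y x)) \<in> borel_measurable paths" for y
    using measurable_compose[OF measurable_Pair1' F1, of y] by simp
  have F1M: "(\<lambda>(y, \<sigma>). h (F 1 y (Lp 0 \<sigma>))) \<in> borel_measurable (borel \<Otimes>\<^sub>M M)"
    using measurable_compose[OF measurable_Pair[OF measurable_fst measurable_compose[OF measurable_snd Lp_measurable[OF order_refl]]] F1]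
    by (simp add: split_beta)
  define h' where "h' y = (\<integral>\<^sup>+\<sigma>. h (F 1 y (Lp 0 \<sigma>)) \<partial>M)" for y
  have h': "h' \<in> borel_measurable borel"
    unfolding h'_def using F1M by (rule borel_measurable_nn_integral)
  have "(\<integral>\<^sup>+\<omega>. h (Z (s + real (Suc n)) \<omega>) \<partial>M) = (\<integral>\<^sup>+\<omega>. h (F 1 (Z (s + real n) \<omega>) (Lp (s + real n) \<omega>)) \<partial>M)"
  proof (rule nn_integral_cong_AE)
    show "AE \<omega> in M. h (Z (s + real (Suc n)) \<omega>) = h (F 1 (Z (s + real n) \<omega>) (Lp (s + real n) \<omega>))"
      using state_flow[OF Z]
    proof eventually_elim
      case (elim \<omega>)
      have "Z ((s + real n) + 1) \<omega> = F 1 (Z (s + real n) \<omega>) (Lp (s + real n) \<omega>)"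
        using elim sn by simp
      then show ?case by (simp add: algebra_simps)
    qed
  qed
  also have "\<dots> = (\<integral>\<^sup>+\<omega>. \<integral>\<^sup>+x. h (F 1 (Z (s + real n) \<omega>) x) \<partial>path_law \<partial>M)"
    using state_markov[OF Z sn F1] by simp
  also have "\<dots> = (\<integral>\<^sup>+\<omega>. h' (Z (s + real n) \<omega>) \<partial>M)"
    unfolding h'_def by (simp add: nn_integral_path_law[OF F1x])
  also have "\<dots> = (\<integral>\<^sup>+\<omega>. \<integral>\<^sup>+w. h' (iter n (Z s \<omega>) w) \<partial>S \<partial>M)"
    by (rule Suc.IH[OF h'])
  also have "\<dots> = (\<integral>\<^sup>+\<omega>. \<integral>\<^sup>+w. h (iter (Suc n) (Z s \<omega>) w) \<partial>S \<partial>M)"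
  proof (rule nn_integral_cong)
    fix \<omega>
    let ?y = "Z s \<omega>"
    have m: "(\<lambda>(\<sigma>, w). h (F 1 (iter n ?y w) (Lp 0 \<sigma>))) \<in> borel_measurable (M \<Otimes>\<^sub>M S)"
    proof -
      have "(\<lambda>p. iter n ?y (snd p)) \<in> measurable (M \<Otimes>\<^sub>M S) borel" by measurable
      from measurable_compose[OF measurable_Pair[OF this measurable_compose[OF measurable_fst Lp_measurable[OF order_refl]]] F1]
      show ?thesis by (simp add: split_beta)
    qed
    have hi: "(\<lambda>w. h (iter (Suc n) ?y w)) \<in> borel_measurable S"
      by (rule measurable_compose[OF _ Suc.prems]) measurable
    have "(\<integral>\<^sup>+w. h' (iter n ?y w) \<partial>S) = (\<integral>\<^sup>+w. \<integral>\<^sup>+\<sigma>. h (F 1 (iter n ?y w) (Lp 0 \<sigma>)) \<partial>M \<partial>S)"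
      unfolding h'_def ..
    also have "\<dots> = (\<integral>\<^sup>+\<sigma>. \<integral>\<^sup>+w. h (F 1 (iter n ?y w) (Lp 0 \<sigma>)) \<partial>S \<partial>M)"
      using MS.Fubini[OF m] by simp
    also have "\<dots> = (\<integral>\<^sup>+\<sigma>. \<integral>\<^sup>+w. h (iter (Suc n) ?y (case_nat \<sigma> w)) \<partial>S \<partial>M)" by simp
    also have "\<dots> = (\<integral>\<^sup>+w. h (iter (Suc n) ?y w) \<partial>S)" by (rule seq.nn_integral_case_nat[OF hi, symmetric])
    finally show "(\<integral>\<^sup>+w. h' (iter n ?y w) \<partial>S) = (\<integral>\<^sup>+w. h (iter (Suc n) ?y w) \<partial>S)" .
  qed
  finally show ?case .
qed

lemma distr_state_iter:
  assumes Z: "state_process M L B a \<alpha>\<^sub>0 Z" and s: "0 \<le> s"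
  shows "distr M borel (Z (s + real n)) = distr (M \<Otimes>\<^sub>M S) borel (\<lambda>p. iter n (Z s (fst p)) (snd p))"
proof (rule measure_eqI)
  fix A assume "A \<in> sets (distr M borel (Z (s + real n)))"
  then have A: "A \<in> sets borel" by simp
  have Zm [measurable]: "Z s \<in> borel_measurable M" "Z (s + real n) \<in> borel_measurable M"
    using state_processD(1)[OF Z] s by auto
  have im: "(\<lambda>p. iter n (Z s (fst p)) (snd p)) \<in> borel_measurable (M \<Otimes>\<^sub>M S)" by measurable
  have ind: "(indicator A :: _ \<Rightarrow> ennreal) \<in> borel_measurable borel" using A by simp
  have "emeasure (distr M borel (Z (s + real n))) A = (\<integral>\<^sup>+y. indicator A y \<partial>distr M borel (Z (s + real n)))" using A by simp
  also have "\<dots> = (\<integral>\<^sup>+\<omega>. indicator A (Z (s + real n) \<omega>) \<partial>M)"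
    by (rule nn_integral_distr[OF Zm(2)]) (use A in simp)
  also have "\<dots> = (\<integral>\<^sup>+\<omega>. \<integral>\<^sup>+w. indicator A (iter n (Z s \<omega>) w) \<partial>S \<partial>M)"
    by (rule nn_integral_state_iter[OF Z s ind])
  also have "\<dots> = (\<integral>\<^sup>+p. indicator A (iter n (Z s (fst p)) (snd p)) \<partial>(M \<Otimes>\<^sub>M S))"
    using seq.P.nn_integral_fst[OF measurable_compose[OF im ind]] by simp
  also have "\<dots> = (\<integral>\<^sup>+y. indicator A y \<partial>distr (M \<Otimes>\<^sub>M S) borel (\<lambda>p. iter n (Z s (fst p)) (snd p)))"
    by (rule nn_integral_distr[symmetric, OF im]) (use A in simp)
  also have "\<dots> = emeasure (distr (M \<Otimes>\<^sub>M S) borel (\<lambda>p. iter n (Z s (fst p)) (snd p))) A" using A by simp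
  finally show "emeasure (distr M borel (Z (s + real n))) A = emeasure (distr (M \<Otimes>\<^sub>M S) borel (\<lambda>p. iter n (Z s (fst p)) (snd p))) A" .
qed simp

text \<open>Half the gap in the moment condition, so that \<open>l + G + rate\<close> still has
  negative mean.\<close>

definition rate :: real where "rate = (- l - expectation G) / 2"

lemma rate_pos: "0 < rate"
  using expectation_G by (simp add: rate_def)

definition contracting :: "(nat \<Rightarrow> 'w) \<Rightarrow> bool" where
  "contracting w \<longleftrightarrow> (\<forall>i. good (w i)) \<and> (\<exists>c. \<forall>n. (\<Sum>k<n. l + G (w k)) \<le> c - rate * real n)"

text \<open>The partial sums with \<open>rate\<close> added in each step are bounded above; taking
  it off again leaves linear decay.\<close>

lemma AE_contracting: "AE w in S. contracting w"
proof -
  have "AE w in S. good (w i)" for i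
  proof (rule AE_distrD[OF seq.measurable_coord])
    show "AE \<omega> in distr S M (\<lambda>w. w i). good \<omega>" using AE_good by (simp only: seq.distr_coord)
  qed
  then have 1: "AE w in S. \<forall>i. good (w i)" by (simp add: AE_all_countable)
  have "integrable M (\<lambda>\<omega>. l + G \<omega> + rate)" using G_integrable by simp
  moreover have "expectation (\<lambda>\<omega>. l + G \<omega> + rate) < 0"
  proof -
    have "expectation (\<lambda>\<omega>. l + G \<omega> + rate) = l + expectation G + rate"
      using G_integrable by (simp add: prob_space)
    moreover have "l + expectation G + rate < 0" using expectation_G rate_pos unfolding rate_def by argo
    ultimately show ?thesis by simp
  qed
  ultimately have "AE w in S. \<exists>c. \<forall>n. (\<Sum>k<n. l + G (w k) + rate) \<le> c" by (rule seq.partial_sums_bounded_above)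
  with 1 show ?thesis
  proof eventually_elim
    case (elim w)
    then obtain c where c: "\<And>n. (\<Sum>k<n. l + G (w k) + rate) \<le> c" by blast
    have "(\<Sum>k<n. l + G (w k)) \<le> c - rate * real n" for n
      using c[of n] by (simp add: sum.distrib algebra_simps)
    then show ?case using elim unfolding contracting_def by blast
  qed
qed

lemma iter_contraction:
  assumes "\<And>i. good (w i)"
  shows "nrm (iter n y w - iter n z w) \<le> exp (\<Sum>k<n. l + G (w k)) * nrm (y - z)"
  using assms
proof (induction n arbitrary: w)
  case (Suc n)
  have "nrm (iter (Suc n) y w - iter (Suc n) z w) \<le> exp (l + G (w 0)) * nrm (iter n y (shift_seq w) - iter n z (shift_seq w))"
    unfolding iter.simps by (rule flow_contraction[OF Suc.prems])
  also have "\<dots> \<le> exp (l + G (w 0)) * (exp (\<Sum>k<n. l + G (shift_seq w k)) * nrm (y - z))"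
    by (intro mult_left_mono Suc.IH) (auto simp: shift_seq_def Suc.prems)
  also have "\<dots> = exp (\<Sum>k<Suc n. l + G (w k)) * nrm (y - z)"
    unfolding partial_sum_shift[of "\<lambda>\<omega>. l + G \<omega>"] by (simp add: exp_add)
  finally show ?case .
qed simp

lemma nrm_0: "nrm 0 = 0"
  using nrm_scale[of 0 0] nrm_nonneg[of 0] by simp

definition Zinf :: "(nat \<Rightarrow> 'w) \<Rightarrow> real ^ 'q::{finite,linorder}" where
  "Zinf w = lim (\<lambda>n. iter n 0 w)"

lemma Zinf_measurable [measurable]: "Zinf \<in> borel_measurable S"
  unfolding Zinf_def by (rule borel_measurable_lim_metric) measurable

text \<open>Successive iterates are the same \<open>n\<close> maps started at
  \<open>F 1 0 (Lp 0 (w n))\<close> and at 0, two points at distance at most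
  \<open>exp (G (w n)) * R\<close> in the adapted norm. Their differences are therefore
  geometrically small.\<close>

lemma iter_0_tendsto:
  assumes w: "contracting w"
  shows "(\<lambda>n. iter n 0 w) \<longlonglongrightarrow> Zinf w"
proof -
  obtain c where c: "\<And>n. (\<Sum>k<n. l + G (w k)) \<le> c - rate * real n" using w unfolding contracting_def by blast
  have gd: "good (w i)" for i using w by (simp add: contracting_def)
  define q where "q = exp (- rate)"
  have q: "0 < q" "q < 1" using rate_pos by (auto simp: q_def)
  have step: "norm (iter (Suc n) 0 w - iter n 0 w) \<le> (m1 * exp (- l) * R * exp c) * q ^ n" for n
  proof -
    have "nrm (iter (Suc n) 0 w - iter n 0 w) \<le> exp (\<Sum>k<n. l + G (w k)) * nrm (F 1 0 (Lp 0 (w n)))"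
      using iter_contraction[where y = "F 1 0 (Lp 0 (w n))" and z = 0, OF gd] by (simp only: iter_Suc_right[of n 0 w] diff_zero)
    also have "nrm (F 1 0 (Lp 0 (w n))) \<le> exp (G (w n)) * R"
      using flow_growth[OF gd[of n], of 0] R_nonneg by (simp add: nrm_0)
    \<comment> \<open>The factor \<open>exp (G (w n))\<close> is absorbed into the next partial sum
      at the cost of \<open>exp (- l)\<close>, so the growth of \<open>G (w n)\<close> along the
      sequence requires no separate estimate.\<close>
    also have "exp (\<Sum>k<n. l + G (w k)) * (exp (G (w n)) * R) = exp (- l) * R * exp (\<Sum>k<Suc n. l + G (w k))"
      by (simp add: exp_add[symmetric] mult_ac)
    also have "\<dots> \<le> exp (- l) * R * exp (c - rate * real (Suc n))"
      using c[of "Suc n"] R_nonneg by (intro mult_left_mono) auto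
    also have "\<dots> \<le> exp (- l) * R * (exp c * q ^ n)"
    proof (rule mult_left_mono)
      have "exp (c - rate * real (Suc n)) \<le> exp (c + real n * (- rate))"
        using rate_pos by (simp add: algebra_simps)
      also have "\<dots> = exp c * q ^ n" unfolding q_def exp_add exp_of_nat_mult ..
      finally show "exp (c - rate * real (Suc n)) \<le> exp c * q ^ n" .
    qed (use R_nonneg in simp)
    finally have "nrm (iter (Suc n) 0 w - iter n 0 w) \<le> exp (- l) * R * (exp c * q ^ n)"
      by (simp add: mult_left_mono)
    from mult_left_mono[OF this m12(1)] show ?thesis
      using norm_le_nrm[of "iter (Suc n) 0 w - iter n 0 w"] by (simp add: mult_ac)
  qed
  have "summable (\<lambda>n. (m1 * exp (- l) * R * exp c) * q ^ n)"
    using q by (intro summable_mult summable_geometric) auto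
  then have "summable (\<lambda>n. iter (Suc n) 0 w - iter n 0 w)"
    by (rule summable_comparison_test'[where N = 0]) (rule step)
  then have "convergent (\<lambda>n. \<Sum>k<n. iter (Suc k) 0 w - iter k 0 w)" by (simp add: summable_iff_convergent)
  moreover have "(\<Sum>k<n. iter (Suc k) 0 w - iter k 0 w) = iter n 0 w" for n
    using sum_lessThan_telescope[of "\<lambda>n. iter n 0 w" n] by (simp del: iter.simps(2))
  ultimately have "convergent (\<lambda>n. iter n 0 w)" by (simp only:)
  then show ?thesis unfolding Zinf_def by (simp add: convergent_LIMSEQ_iff)
qed

text \<open>Built from \<open>L\<close> and the coefficients alone, so that it is the limit law of
  every solution on \<open>M\<close>, whatever the starting value.\<close>

definition limit_law :: "(real ^ 'q::{finite,linorder}) measure" where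
  "limit_law = distr S borel Zinf"

lemma prob_space_limit_law: "prob_space limit_law"
  unfolding limit_law_def by (rule seq.P.prob_space_distr) simp

lemma sets_limit_law: "sets limit_law = sets borel"
  by (simp add: limit_law_def)

text \<open>On the product of \<open>M\<close> with the sequence space, the backward iteration with
  floor(t) maps, started at the value of \<open>Z\<close> at the fractional part of
  \<open>t\<close>, has the law of \<open>Z t\<close>. At a fixed point of the product space
  contraction removes the dependence on the start, so it converges along all real \<open>t\<close>,
  and dominated convergence applies.\<close>

lemma state_converges:
  assumes Z: "state_process M L B a \<alpha>\<^sub>0 Z"
  shows "converges_in_distribution M Z limit_law"
  unfolding converges_in_distribution_def
proof (intro allI impI)
  fix \<phi> :: "real ^ 'q::{finite,linorder} \<Rightarrow> real" assume "continuous_on UNIV \<phi> \<and> bounded (range \<phi>)"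
  then have \<phi>c: "continuous_on UNIV \<phi>" and "bounded (range \<phi>)" by auto
  then obtain Cb where Cb: "\<And>x. norm (\<phi> x) \<le> Cb" by (auto simp: bounded_iff)
  have \<phi>m [measurable]: "\<phi> \<in> borel_measurable borel" by (rule borel_measurable_continuous_onI[OF \<phi>c])
  interpret MS: pair_prob_space M S ..
  define \<theta> where "\<theta> t = t - of_int \<lfloor>t\<rfloor>" for t :: real
  have \<theta>: "0 \<le> \<theta> t" "\<theta> t \<le> 1" for t unfolding \<theta>_def by linarith+
  define I where "I t p = \<phi> (iter (nat \<lfloor>t\<rfloor>) (Z (\<theta> t) (fst p)) (snd p))" for t and p :: "'w \<times> (nat \<Rightarrow> 'w)"
  have Zm: "Z (\<theta> t) \<in> borel_measurable M" for t by (rule state_processD(1)[OF Z \<theta>(1)])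
  have im: "(\<lambda>p. iter n (Z (\<theta> t) (fst p)) (snd p)) \<in> borel_measurable (M \<Otimes>\<^sub>M S)" for t n
    using Zm[of t] by measurable
  have Im: "I t \<in> borel_measurable (M \<Otimes>\<^sub>M S)" for t
    unfolding I_def by (rule measurable_compose[OF im \<phi>m])
  have eq: "integral\<^sup>L M (\<lambda>\<omega>. \<phi> (Z t \<omega>)) = integral\<^sup>L (M \<Otimes>\<^sub>M S) (I t)" if t: "0 \<le> t" for t
  proof -
    have t': "t = \<theta> t + real (nat \<lfloor>t\<rfloor>)" using t by (simp add: \<theta>_def)
    have "integral\<^sup>L M (\<lambda>\<omega>. \<phi> (Z t \<omega>)) = integral\<^sup>L (distr M borel (Z t)) \<phi>"
      using state_processD(1)[OF Z t] by (subst integral_distr) auto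
    also have "distr M borel (Z t) = distr (M \<Otimes>\<^sub>M S) borel (\<lambda>p. iter (nat \<lfloor>t\<rfloor>) (Z (\<theta> t) (fst p)) (snd p))"
      by (subst t') (rule distr_state_iter[OF Z \<theta>(1)])
    also have "integral\<^sup>L \<dots> \<phi> = integral\<^sup>L (M \<Otimes>\<^sub>M S) (I t)"
      unfolding I_def by (rule integral_distr[OF im \<phi>m])
    finally show ?thesis .
  qed
  have lim_point: "((\<lambda>t. I t p) \<longlongrightarrow> \<phi> (Zinf (snd p))) at_top"
    if p: "fst p \<in> space M" "contracting (snd p)" for p
  proof -
    define w where "w = snd p"
    obtain c where c: "\<And>n. (\<Sum>k<n. l + G (w k)) \<le> c - rate * real n" using p unfolding contracting_def w_def by blast
    have gd: "good (w i)" for i using p by (simp add: contracting_def w_def)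
    \<comment> \<open>Fractional parts lie in [0, 1], where the path is bounded; a bound for each
      \<omega> is enough, and no moment of the starting value is involved.\<close>
    obtain Kb where Kb: "\<And>r. 0 \<le> r \<Longrightarrow> r \<le> 1 \<Longrightarrow> norm (Z r (fst p)) \<le> Kb"
      using cadlag_bounded[OF state_processD(2)[OF Z p(1)]] by blast
    have close: "norm (iter n (Z (\<theta> t) (fst p)) w - iter n 0 w) \<le> m1 * (exp c * exp (- rate) ^ n * (m2 * Kb))" for n t
    proof -
      have "nrm (iter n (Z (\<theta> t) (fst p)) w - iter n 0 w) \<le> exp (\<Sum>k<n. l + G (w k)) * nrm (Z (\<theta> t) (fst p) - 0)"
        by (rule iter_contraction[OF gd])
      also have "\<dots> \<le> exp (c - rate * real n) * (m2 * Kb)"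
      proof (rule mult_mono)
        show "nrm (Z (\<theta> t) (fst p) - 0) \<le> m2 * Kb"
          using nrm_le_norm[of "Z (\<theta> t) (fst p)"] mult_left_mono[OF Kb[OF \<theta>, of t] m12(2)] by simp
      qed (use c[of n] nrm_nonneg in auto)
      also have "exp (c - rate * real n) = exp c * exp (- rate) ^ n"
        by (simp add: exp_diff exp_of_nat_mult[symmetric] mult.commute[of rate] exp_minus field_simps)
      finally show ?thesis
        using norm_le_nrm[of "iter n (Z (\<theta> t) (fst p)) w - iter n 0 w"] m12(1) by (meson mult_left_mono order_trans)
    qed
    have nt: "filterlim (\<lambda>t::real. nat \<lfloor>t\<rfloor>) sequentially at_top"
      by (rule filterlim_compose[OF filterlim_nat_sequentially filterlim_floor_sequentially])
    have "(\<lambda>n. m1 * (exp c * exp (- rate) ^ n * (m2 * Kb))) \<longlonglongrightarrow> m1 * (exp c * 0 * (m2 * Kb))"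
      using rate_pos by (intro tendsto_intros LIMSEQ_power_zero) auto
    from filterlim_compose[OF this nt]
    have "((\<lambda>t::real. m1 * (exp c * exp (- rate) ^ nat \<lfloor>t\<rfloor> * (m2 * Kb))) \<longlongrightarrow> 0) at_top" by simp
    then have diff: "((\<lambda>t::real. iter (nat \<lfloor>t\<rfloor>) (Z (\<theta> t) (fst p)) w - iter (nat \<lfloor>t\<rfloor>) 0 w) \<longlongrightarrow> 0) at_top"
      by (rule Lim_null_comparison[rotated]) (simp add: close)
    have "((\<lambda>t::real. iter (nat \<lfloor>t\<rfloor>) 0 w) \<longlongrightarrow> Zinf w) at_top"
      by (rule filterlim_compose[OF iter_0_tendsto nt]) (use p in \<open>simp add: w_def\<close>)
    from Lim_transform[OF this diff]
    have "((\<lambda>t::real. iter (nat \<lfloor>t\<rfloor>) (Z (\<theta> t) (fst p)) w) \<longlongrightarrow> Zinf w) at_top" .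
    moreover have "isCont \<phi> (Zinf w)" using \<phi>c by (simp add: continuous_on_eq_continuous_at)
    ultimately show ?thesis unfolding I_def w_def by (rule isCont_tendsto_compose[rotated])
  qed
  have "((\<lambda>t. integral\<^sup>L (M \<Otimes>\<^sub>M S) (I t)) \<longlongrightarrow> integral\<^sup>L (M \<Otimes>\<^sub>M S) (\<lambda>p. \<phi> (Zinf (snd p)))) at_top"
  proof (rule integral_dominated_convergence_at_top[where w = "\<lambda>_. Cb"])
    show "AE p in M \<Otimes>\<^sub>M S. ((\<lambda>t. I t p) \<longlongrightarrow> \<phi> (Zinf (snd p))) at_top"
      using seq.P.AE_pair_snd[OF AE_contracting, of M] AE_space
      by eventually_elim (auto intro: lim_point simp: space_pair_measure)
    show "eventually (\<lambda>t. AE p in M \<Otimes>\<^sub>M S. norm (I t p) \<le> Cb) at_top"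
      by (intro always_eventually allI AE_I2) (simp add: I_def Cb del: real_norm_def)
  qed (use Im in \<open>auto intro!: measurable_compose[OF measurable_compose[OF measurable_snd Zinf_measurable] \<phi>m]\<close>)
  moreover have "integral\<^sup>L (M \<Otimes>\<^sub>M S) (\<lambda>p. \<phi> (Zinf (snd p))) = integral\<^sup>L limit_law \<phi>"
  proof -
    have "integrable (M \<Otimes>\<^sub>M S) (\<lambda>p. \<phi> (Zinf (snd p)))"
      using Cb by (intro MS.P.integrable_const_bound[where B = Cb]) (auto intro!: AE_I2 measurable_compose[OF measurable_compose[OF measurable_snd Zinf_measurable] \<phi>m])
    from MS.integral_fst'[OF this] have "integral\<^sup>L (M \<Otimes>\<^sub>M S) (\<lambda>p. \<phi> (Zinf (snd p))) = integral\<^sup>L S (\<lambda>w. \<phi> (Zinf w))"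
      by (simp add: prob_space)
    then show ?thesis unfolding limit_law_def by (simp add: integral_distr)
  qed
  ultimately have "((\<lambda>t. integral\<^sup>L (M \<Otimes>\<^sub>M S) (I t)) \<longlongrightarrow> integral\<^sup>L limit_law \<phi>) at_top" by simp
  then show "((\<lambda>t. integral\<^sup>L M (\<lambda>\<omega>. \<phi> (Z t \<omega>))) \<longlongrightarrow> integral\<^sup>L limit_law \<phi>) at_top"
    by (rule Lim_transform_eventually) (use eq in \<open>auto simp: eventually_at_top_linorder intro!: exI[of _ 0]\<close>)
qed

end

section \<open>Stationarity\<close>

context cogarch_state
begin

definition transition :: "real \<Rightarrow> (real ^ 'q::{finite,linorder} \<Rightarrow> real) \<Rightarrow> real ^ 'q::{finite,linorder} \<Rightarrow> real" where
  "transition h \<phi> z = (\<integral>\<sigma>. \<phi> (F h z (Lp 0 \<sigma>)) \<partial>M)"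

lemma measurable_F_Lp:
  assumes "0 \<le> h"
  shows "(\<lambda>\<sigma>. F h z (Lp 0 \<sigma>)) \<in> borel_measurable M"
proof -
  have "(\<lambda>x. F h z x) \<in> borel_measurable paths"
    using measurable_compose[OF measurable_Pair1' measurable_F[OF assms], of z] by simp
  from measurable_compose[OF Lp_measurable[OF order_refl] this] show ?thesis .
qed

text \<open>Along almost every path the flow is Lipschitz in the starting point; dominated
  convergence passes continuity on to the expectation.\<close>

lemma transition_feller:
  assumes h: "0 \<le> h" and \<phi>: "continuous_on UNIV \<phi>" "bounded (range \<phi>)"
  shows "continuous_on UNIV (transition h \<phi>)" "bounded (range (transition h \<phi>))"
proof -
  obtain Cb where Cb: "\<And>x. norm (\<phi> x) \<le> Cb" using \<phi>(2) by (auto simp: bounded_iff)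
  have \<phi>m: "\<phi> \<in> borel_measurable borel" by (rule borel_measurable_continuous_onI[OF \<phi>(1)])
  have Im: "(\<lambda>\<sigma>. \<phi> (F h z (Lp 0 \<sigma>))) \<in> borel_measurable M" for z
    by (rule measurable_compose[OF measurable_F_Lp[OF h] \<phi>m])
  show "continuous_on UNIV (transition h \<phi>)"
    unfolding continuous_on_sequentially
  proof (intro allI ballI impI, elim conjE)
    fix X :: "nat \<Rightarrow> real ^ 'q::{finite,linorder}" and z assume X: "X \<longlonglongrightarrow> z"
    have "(\<lambda>n. \<integral>\<sigma>. \<phi> (F h (X n) (Lp 0 \<sigma>)) \<partial>M) \<longlonglongrightarrow> (\<integral>\<sigma>. \<phi> (F h z (Lp 0 \<sigma>)) \<partial>M)"
    proof (rule integral_dominated_convergence[where w = "\<lambda>_. Cb"])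
      show "AE \<sigma> in M. (\<lambda>n. \<phi> (F h (X n) (Lp 0 \<sigma>))) \<longlonglongrightarrow> \<phi> (F h z (Lp 0 \<sigma>))"
        using AE_good
      proof eventually_elim
        case (elim \<sigma>)
        then have gp: "good_path (\<lambda>t. L t \<sigma>)" by (simp add: good_def)
        let ?c = "exp (b * (h + qvar (\<lambda>t. L t \<sigma>) 0 (0 + h)))"
        have "(\<lambda>n. norm (X n - z)) \<longlonglongrightarrow> 0" using tendsto_norm[OF LIM_zero[OF X]] by simp
        then have lim: "(\<lambda>n. ?c * norm (X n - z)) \<longlonglongrightarrow> 0" by (rule tendsto_mult_right_zero)
        have "(\<lambda>n. F h (X n) (Lp 0 \<sigma>) - F h z (Lp 0 \<sigma>)) \<longlonglongrightarrow> 0"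
          by (rule Lim_null_comparison[OF _ lim])
            (rule always_eventually, rule allI, rule flow_lipschitz[OF lipschitz_fg gp order_refl h])
        then have "(\<lambda>n. F h (X n) (Lp 0 \<sigma>)) \<longlonglongrightarrow> F h z (Lp 0 \<sigma>)" by (rule LIM_zero_cancel)
        moreover have "isCont \<phi> (F h z (Lp 0 \<sigma>))" using \<phi>(1) by (simp add: continuous_on_eq_continuous_at)
        ultimately show ?case by (rule isCont_tendsto_compose[rotated])
      qed
      show "AE \<sigma> in M. norm (\<phi> (F h (X n) (Lp 0 \<sigma>))) \<le> Cb" for n by (rule AE_I2, rule Cb)
    qed (simp_all add: Im)
    then show "(transition h \<phi> \<circ> X) \<longlonglongrightarrow> transition h \<phi> z" by (simp add: transition_def comp_def)
  qed
  have "norm (transition h \<phi> z) \<le> Cb" for z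
  proof -
    have i: "integrable M (\<lambda>\<sigma>. \<phi> (F h z (Lp 0 \<sigma>)))"
      by (rule integrable_const_bound[where B = Cb]) (use Cb Im in auto)
    have "norm (transition h \<phi> z) \<le> (\<integral>\<sigma>. norm (\<phi> (F h z (Lp 0 \<sigma>))) \<partial>M)"
      unfolding transition_def by (rule integral_norm_bound)
    also have "\<dots> \<le> (\<integral>\<sigma>. Cb \<partial>M)" by (intro integral_mono integrable_norm i) (use Cb in auto)
    finally show ?thesis by (simp add: prob_space)
  qed
  then show "bounded (range (transition h \<phi>))" by (auto simp: bounded_iff)
qed

lemma expectation_transition:
  assumes Z: "state_process M L B a \<alpha>\<^sub>0 Z" and t: "0 \<le> t" and h: "0 \<le> h"
    and \<phi>: "continuous_on UNIV \<phi>" "bounded (range \<phi>)"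
  shows "expectation (\<lambda>\<omega>. \<phi> (Z (t + h) \<omega>)) = expectation (\<lambda>\<omega>. transition h \<phi> (Z t \<omega>))"
proof -
  interpret Q: prob_space path_law by (rule prob_space_path_law)
  have Zm: "Z t \<in> borel_measurable M" "Z (t + h) \<in> borel_measurable M"
    using state_processD(1)[OF Z] t h by auto
  interpret D: prob_space "distr M borel (Z t)" by (rule prob_space_distr[OF Zm(1)])
  interpret DQ: pair_prob_space "distr M borel (Z t)" path_law ..
  obtain Cb where Cb: "\<And>x. norm (\<phi> x) \<le> Cb" using \<phi>(2) by (auto simp: bounded_iff)
  have \<phi>m: "\<phi> \<in> borel_measurable borel" by (rule borel_measurable_continuous_onI[OF \<phi>(1)])
  have Fm: "(\<lambda>p. \<phi> (F h (fst p) (snd p))) \<in> borel_measurable (borel \<Otimes>\<^sub>M paths)"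
    using measurable_compose[OF measurable_F[OF h] \<phi>m] by (simp add: split_beta)
  have pm: "(\<lambda>\<omega>. (Z t \<omega>, Lp t \<omega>)) \<in> measurable M (borel \<Otimes>\<^sub>M paths)"
    by (rule measurable_Pair[OF Zm(1) Lp_measurable[OF t]])
  have sets_eq: "sets (distr M borel (Z t) \<Otimes>\<^sub>M path_law) = sets (borel \<Otimes>\<^sub>M paths)"
    by (simp cong: sets_pair_measure_cong)
  have "expectation (\<lambda>\<omega>. \<phi> (Z (t + h) \<omega>)) = expectation (\<lambda>\<omega>. \<phi> (F h (Z t \<omega>) (Lp t \<omega>)))"
  proof (rule integral_cong_AE)
    show "AE \<omega> in M. \<phi> (Z (t + h) \<omega>) = \<phi> (F h (Z t \<omega>) (Lp t \<omega>))"
      using state_flow[OF Z] by eventually_elim (use t h in simp)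
    show "(\<lambda>\<omega>. \<phi> (Z (t + h) \<omega>)) \<in> borel_measurable M" by (rule measurable_compose[OF Zm(2) \<phi>m])
    show "(\<lambda>\<omega>. \<phi> (F h (Z t \<omega>) (Lp t \<omega>))) \<in> borel_measurable M"
      using measurable_compose[OF pm Fm] by simp
  qed
  also have "\<dots> = (\<integral>p. \<phi> (F h (fst p) (snd p)) \<partial>distr M (borel \<Otimes>\<^sub>M paths) (\<lambda>\<omega>. (Z t \<omega>, Lp t \<omega>)))"
    using integral_distr[OF pm Fm] by simp
  also have "\<dots> = (\<integral>p. \<phi> (F h (fst p) (snd p)) \<partial>(distr M borel (Z t) \<Otimes>\<^sub>M path_law))"
    by (simp only: state_distr_markov[OF Z t])
  also have "\<dots> = (\<integral>z. \<integral>x. \<phi> (F h z x) \<partial>path_law \<partial>distr M borel (Z t))"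
  proof -
    have "integrable (distr M borel (Z t) \<Otimes>\<^sub>M path_law) (\<lambda>p. \<phi> (F h (fst p) (snd p)))"
      by (rule DQ.P.integrable_const_bound[where B = Cb])
        (use Cb Fm in \<open>auto simp: measurable_cong_sets[OF sets_eq refl]\<close>)
    from DQ.integral_fst'[OF this] show ?thesis by simp
  qed
  also have "\<dots> = (\<integral>z. transition h \<phi> z \<partial>distr M borel (Z t))"
  proof -
    have "(\<integral>x. \<phi> (F h z x) \<partial>path_law) = transition h \<phi> z" for z
    proof -
      have "(\<lambda>x. \<phi> (F h z x)) \<in> borel_measurable paths"
        using measurable_compose[OF measurable_Pair1' Fm, of z] by simp
      then show ?thesis unfolding path_law_def transition_def by (subst integral_distr) auto
    qed
    then show ?thesis by simp
  qed
  also have "\<dots> = expectation (\<lambda>\<omega>. transition h \<phi> (Z t \<omega>))"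
    by (rule integral_distr[OF Zm(1) borel_measurable_continuous_onI[OF transition_feller(1)[OF h \<phi>]]])
  finally show ?thesis .
qed

text \<open>The mean of \<phi> at time t + h equals the mean of \<open>transition h \<phi>\<close>
  at time t. Both functions are bounded and continuous, so letting t tend to infinity on both sides
  shows that they have the same integral under the limit law.\<close>

lemma invariant_law:
  assumes Z: "state_process M L B a \<alpha>\<^sub>0 Z" and Z0: "distr M borel (Z 0) = limit_law" and h: "0 \<le> h"
  shows "distr M borel (Z h) = limit_law"
proof (rule measure_eqI_bounded_continuous)
  have Zm: "0 \<le> t \<Longrightarrow> Z t \<in> borel_measurable M" for t by (rule state_processD(1)[OF Z])
  show "prob_space (distr M borel (Z h))" by (rule prob_space_distr[OF Zm[OF h]])
  fix \<phi> :: "real ^ 'q::{finite,linorder} \<Rightarrow> real" assume \<phi>: "continuous_on UNIV \<phi>" "bounded (range \<phi>)"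
  note tr = transition_feller[OF h \<phi>]
  have conv: "((\<lambda>t. expectation (\<lambda>\<omega>. \<psi> (Z t \<omega>))) \<longlongrightarrow> integral\<^sup>L limit_law \<psi>) at_top"
    if "continuous_on UNIV \<psi>" "bounded (range \<psi>)" for \<psi> :: "real ^ 'q::{finite,linorder} \<Rightarrow> real"
    using state_converges[OF Z] that unfolding converges_in_distribution_def by blast
  have "filterlim (\<lambda>t. t + h) at_top at_top" by (rule filterlim_tendsto_add_at_top[OF tendsto_const filterlim_ident, of h, simplified add.commute])
  from filterlim_compose[OF conv[OF \<phi>] this]
  have "((\<lambda>t. expectation (\<lambda>\<omega>. \<phi> (Z (t + h) \<omega>))) \<longlongrightarrow> integral\<^sup>L limit_law \<phi>) at_top" .
  moreover have "eventually (\<lambda>t. expectation (\<lambda>\<omega>. \<phi> (Z (t + h) \<omega>)) = expectation (\<lambda>\<omega>. transition h \<phi> (Z t \<omega>))) at_top"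
    unfolding eventually_at_top_linorder using expectation_transition[OF Z _ h \<phi>] by blast
  ultimately have "((\<lambda>t. expectation (\<lambda>\<omega>. transition h \<phi> (Z t \<omega>))) \<longlongrightarrow> integral\<^sup>L limit_law \<phi>) at_top"
    by (rule Lim_transform_eventually)
  from tendsto_unique[OF _ this conv[OF tr]]
  have eq: "integral\<^sup>L limit_law \<phi> = integral\<^sup>L limit_law (transition h \<phi>)" by simp
  have "integral\<^sup>L (distr M borel (Z h)) \<phi> = expectation (\<lambda>\<omega>. \<phi> (Z h \<omega>))"
    by (rule integral_distr[OF Zm[OF h] borel_measurable_continuous_onI[OF \<phi>(1)]])
  also have "\<dots> = expectation (\<lambda>\<omega>. transition h \<phi> (Z 0 \<omega>))"
    using expectation_transition[OF Z order_refl h \<phi>] by simp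
  also have "\<dots> = integral\<^sup>L (distr M borel (Z 0)) (transition h \<phi>)"
    by (rule integral_distr[symmetric, OF Zm[OF order_refl] borel_measurable_continuous_onI[OF tr(1)]])
  finally show "integral\<^sup>L (distr M borel (Z h)) \<phi> = integral\<^sup>L limit_law \<phi>" by (simp add: Z0 eq)
qed (simp_all add: prob_space_limit_law sets_limit_law)

text \<open>The values at the times s + t are the image of the pair \<open>(Z s, Lp s)\<close> under
  a map \<Psi> in which \<open>s\<close> does not occur, and the law of this pair does not depend on
  \<open>s\<close> either.\<close>

lemma state_stationary:
  assumes Z: "state_process M L B a \<alpha>\<^sub>0 Z" and Z0: "distr M borel (Z 0) = limit_law"
  shows "strictly_stationary M Z"
  unfolding strictly_stationary_def
proof (intro conjI allI impI)
  have Zm: "0 \<le> t \<Longrightarrow> Z t \<in> borel_measurable M" for t by (rule state_processD(1)[OF Z])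
  show "0 \<le> t \<Longrightarrow> Z t \<in> borel_measurable M" for t by (rule Zm)
  fix I :: "real set" and h :: real assume "finite I \<and> I \<subseteq> {0..} \<and> 0 \<le> h"
  then have I: "finite I" "\<And>t. t \<in> I \<Longrightarrow> 0 \<le> t" and h: "0 \<le> h" by auto
  let ?P = "\<Pi>\<^sub>M t\<in>I. (borel :: (real ^ 'q::{finite,linorder}) measure)"
  define \<Psi> where "\<Psi> p = (\<lambda>t\<in>I. F t (fst p) (snd p))" for p
  have \<Psi>: "\<Psi> \<in> measurable (borel \<Otimes>\<^sub>M paths) ?P"
    unfolding \<Psi>_def by (rule measurable_restrict) (use measurable_F I(2) in \<open>simp add: split_beta\<close>)
  have shifted: "distr M ?P (\<lambda>\<omega>. \<lambda>t\<in>I. Z (s + t) \<omega>) = distr (limit_law \<Otimes>\<^sub>M path_law) ?P \<Psi>" if s: "0 \<le> s" for s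
  proof -
    have pm: "(\<lambda>\<omega>. (Z s \<omega>, Lp s \<omega>)) \<in> measurable M (borel \<Otimes>\<^sub>M paths)"
      by (rule measurable_Pair[OF Zm[OF s] Lp_measurable[OF s]])
    have "distr M ?P (\<lambda>\<omega>. \<lambda>t\<in>I. Z (s + t) \<omega>) = distr M ?P (\<lambda>\<omega>. \<Psi> (Z s \<omega>, Lp s \<omega>))"
    proof (rule distr_cong_AE)
      show "AE \<omega> in M. (\<lambda>t\<in>I. Z (s + t) \<omega>) = \<Psi> (Z s \<omega>, Lp s \<omega>)"
        using state_flow[OF Z]
      proof eventually_elim
        case (elim \<omega>)
        then have "Z (s + t) \<omega> = F t (Z s \<omega>) (Lp s \<omega>)" if "t \<in> I" for t using s I(2)[OF that] by blast
        then show ?case by (auto simp: \<Psi>_def)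
      qed
      show "(\<lambda>\<omega>. \<lambda>t\<in>I. Z (s + t) \<omega>) \<in> measurable M ?P"
        by (rule measurable_restrict) (use Zm s I(2) in auto)
      show "(\<lambda>\<omega>. \<Psi> (Z s \<omega>, Lp s \<omega>)) \<in> measurable M ?P" by (rule measurable_compose[OF pm \<Psi>])
    qed simp_all
    also have "\<dots> = distr (distr M (borel \<Otimes>\<^sub>M paths) (\<lambda>\<omega>. (Z s \<omega>, Lp s \<omega>))) ?P \<Psi>"
      using distr_distr[OF \<Psi> pm] by (simp add: comp_def)
    also have "\<dots> = distr (limit_law \<Otimes>\<^sub>M path_law) ?P \<Psi>"
      by (simp only: state_distr_markov[OF Z s] invariant_law[OF Z Z0 s])
    finally show ?thesis .
  qed
  show "distr M ?P (\<lambda>\<omega>. \<lambda>t\<in>I. Z (t + h) \<omega>) = distr M ?P (\<lambda>\<omega>. \<lambda>t\<in>I. Z t \<omega>)"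
    using shifted[OF h] shifted[OF order_refl] by (simp add: add.commute)
qed

section \<open>Left limits of the state and the volatility process\<close>

lemma state_left_lim:
  assumes Z: "state_process M L B a \<alpha>\<^sub>0 Z" and t: "0 < t"
  shows "AE \<omega> in M. left_lim Z t \<omega> = Z t \<omega>"
  using state_processD(4)[OF Z] AE_no_fixed_jump[OF t]
proof eventually_elim
  case (elim \<omega>)
  then have gp: "good_path (\<lambda>t. L t \<omega>)" and ie: "integral_equation f g b (\<lambda>t. Z t \<omega>) (sq_jumps (\<lambda>t. L t \<omega>))"
    by (simp_all add: good_def)
  have "(sq_jumps (\<lambda>t. L t \<omega>) \<longlongrightarrow> sq_jumps (\<lambda>t. L t \<omega>) t) (at_left t)"
    using sq_jumps_left_lim[OF gp t] elim by simp
  from integral_equation.left_lim_eq_if_no_jump[OF ie t this]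
  show ?case by (simp add: left_lim_def)
qed

text \<open>A limit along deterministic times that exists for every \<omega>, because every path of
  \<open>Z\<close> is cadlag; an almost sure limit would not give measurability on an incomplete
  space.\<close>

lemma left_lim_measurable_state:
  assumes Z: "state_process M L B a \<alpha>\<^sub>0 Z" and t: "0 < t"
  shows "left_lim Z t \<in> borel_measurable M"
proof (rule borel_measurable_LIMSEQ_metric)
  define s where "s n = grid 0 t n (grid_index 0 t n t)" for n
  have s: "0 \<le> s n" for n unfolding s_def by (rule grid_nonneg) (use t in auto)
  show "Z (s n) \<in> borel_measurable M" for n by (rule state_processD(1)[OF Z s])
  fix \<omega> assume "\<omega> \<in> space M"
  then have "cadlag (\<lambda>t. Z t \<omega>)" by (rule state_processD(2)[OF Z])
  from cadlag_grid_left[OF this order_refl t order_refl]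
  show "(\<lambda>n. Z (s n) \<omega>) \<longlonglongrightarrow> left_lim Z t \<omega>" unfolding s_def left_lim_def .
qed

text \<open>Only finitely many times are compared at once, so the null sets on which the volatility
  differs from \<open>v (Z t)\<close> can be united. Its finite-dimensional laws are then images of
  those of the state.\<close>

lemma volatility_stationary:
  assumes Z: "state_process M L B a \<alpha>\<^sub>0 Z" and Z0: "distr M borel (Z 0) = limit_law"
  shows "strictly_stationary M (volatility a \<alpha>\<^sub>0 Z)"
  unfolding strictly_stationary_def
proof (intro conjI allI impI)
  let ?V = "volatility a \<alpha>\<^sub>0 Z"
  define v where "v z = \<alpha>\<^sub>0 + a \<bullet> z" for z
  have vm: "v \<in> borel_measurable borel"
    unfolding v_def by (intro borel_measurable_continuous_onI continuous_intros)
  have Zm: "0 \<le> t \<Longrightarrow> Z t \<in> borel_measurable M" for t by (rule state_processD(1)[OF Z])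
  have Vm: "?V t \<in> borel_measurable M" if "0 \<le> t" for t
  proof (cases "t = 0")
    case True
    then show ?thesis using measurable_compose[OF Zm[of 0] vm] by (simp add: volatility_def[abs_def] v_def)
  next
    case False
    then show ?thesis using measurable_compose[OF left_lim_measurable_state[OF Z, of t] vm] that
      by (simp add: volatility_def[abs_def] v_def)
  qed
  show "0 \<le> t \<Longrightarrow> ?V t \<in> borel_measurable M" for t by (rule Vm)
  have V_eq: "AE \<omega> in M. ?V t \<omega> = v (Z t \<omega>)" if "0 \<le> t" for t
  proof (cases "t = 0")
    case False
    then have "0 < t" using that by simp
    from state_left_lim[OF Z this] show ?thesis
      by eventually_elim (use False in \<open>simp add: volatility_def v_def\<close>)
  qed (simp add: volatility_def v_def)
  fix I :: "real set" and h :: real assume "finite I \<and> I \<subseteq> {0..} \<and> 0 \<le> h"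
  then have I: "finite I" "\<And>t. t \<in> I \<Longrightarrow> 0 \<le> t" and Ih: "finite I \<and> I \<subseteq> {0..} \<and> 0 \<le> h" and h: "0 \<le> h" by auto
  let ?P = "\<Pi>\<^sub>M t\<in>I. (borel :: (real ^ 'q::{finite,linorder}) measure)" and ?R = "\<Pi>\<^sub>M t\<in>I. (borel :: real measure)"
  define T where "T y = (\<lambda>t\<in>I. v (y t))" for y :: "real \<Rightarrow> real ^ 'q::{finite,linorder}"
  have T: "T \<in> measurable ?P ?R"
    unfolding T_def
  proof (rule measurable_restrict)
    fix t assume "t \<in> I"
    then have "(\<lambda>y. y t) \<in> measurable ?P borel" by (rule measurable_component_singleton)
    from measurable_compose[OF this vm] show "(\<lambda>y. v (y t)) \<in> borel_measurable ?P" .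
  qed
  have eq: "distr M ?R (\<lambda>\<omega>. \<lambda>t\<in>I. ?V (t + s) \<omega>) = distr (distr M ?P (\<lambda>\<omega>. \<lambda>t\<in>I. Z (t + s) \<omega>)) ?R T" if s: "0 \<le> s" for s
  proof -
    have Zr: "(\<lambda>\<omega>. \<lambda>t\<in>I. Z (t + s) \<omega>) \<in> measurable M ?P"
      by (rule measurable_restrict) (use Zm s I(2) in auto)
    have "distr M ?R (\<lambda>\<omega>. \<lambda>t\<in>I. ?V (t + s) \<omega>) = distr M ?R (\<lambda>\<omega>. T (\<lambda>t\<in>I. Z (t + s) \<omega>))"
    proof (rule distr_cong_AE)
      have "AE \<omega> in M. \<forall>t\<in>I. ?V (t + s) \<omega> = v (Z (t + s) \<omega>)"
        using V_eq s I by (intro AE_finite_allI) auto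
      then show "AE \<omega> in M. (\<lambda>t\<in>I. ?V (t + s) \<omega>) = T (\<lambda>t\<in>I. Z (t + s) \<omega>)"
        by eventually_elim (auto simp: T_def)
      show "(\<lambda>\<omega>. \<lambda>t\<in>I. ?V (t + s) \<omega>) \<in> measurable M ?R"
        by (rule measurable_restrict) (use Vm s I(2) in auto)
      show "(\<lambda>\<omega>. T (\<lambda>t\<in>I. Z (t + s) \<omega>)) \<in> measurable M ?R" by (rule measurable_compose[OF Zr T])
    qed simp_all
    then show ?thesis using distr_distr[OF T Zr] by (simp add: comp_def)
  qed
  have "distr M ?P (\<lambda>\<omega>. \<lambda>t\<in>I. Z (t + h) \<omega>) = distr M ?P (\<lambda>\<omega>. \<lambda>t\<in>I. Z (t + 0) \<omega>)"
    using state_stationary[OF Z Z0] Ih unfolding strictly_stationary_def by simp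
  then show "distr M ?R (\<lambda>\<omega>. \<lambda>t\<in>I. ?V (t + h) \<omega>) = distr M ?R (\<lambda>\<omega>. \<lambda>t\<in>I. ?V t \<omega>)"
    using eq[OF h] eq[OF order_refl] by simp
qed

end

text \<open>\<open>pos\<close> is strictly increasing with values in {1..q}; injectivity and
  counting make it onto. It locates the coordinates with numbers p and q.\<close>

lemma pos_surj:
  assumes "1 \<le> n" "n \<le> CARD('q::{finite,linorder})"
  shows "\<exists>i::'q. pos i = n"
proof -
  have "pos i < pos j" if "i < j" for i j :: 'q
  proof -
    have "j \<in> {k. k \<le> j}" "j \<notin> {k. k \<le> i}" "{k. k \<le> i} \<subseteq> {k. k \<le> j}" using that by auto
    then show ?thesis unfolding pos_def by (intro psubset_card_mono) auto
  qed
  then have "inj (pos :: 'q \<Rightarrow> nat)" by (metis injI less_irrefl_nat linorder_neqE)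
  moreover have "range (pos :: 'q \<Rightarrow> nat) \<subseteq> {1..CARD('q)}"
  proof
    fix m assume "m \<in> range (pos :: 'q \<Rightarrow> nat)"
    then obtain i :: 'q where m: "m = card {j. j \<le> i}" by (auto simp: pos_def)
    have "0 < card {j. j \<le> i}" by (subst card_gt_0_iff) auto
    moreover have "card {j. j \<le> i} \<le> CARD('q)" by (rule card_mono) auto
    ultimately show "m \<in> {1..CARD('q)}" using m by auto
  qed
  ultimately have "range (pos :: 'q \<Rightarrow> nat) = {1..CARD('q)}"
    by (intro card_subset_eq) (auto simp: card_image)
  then show ?thesis using assms by (metis atLeastAtMost_iff imageE)
qed

theorem theorem3p1:
  fixes p :: nat
    and \<alpha> \<beta> :: "nat \<Rightarrow> real"
    and a :: "real ^ 'q::{finite,linorder}"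
    and B :: "real ^ 'q::{finite,linorder} ^ 'q::{finite,linorder}"
    and M :: "'w measure"
    and L :: "real \<Rightarrow> 'w \<Rightarrow> real"
    and \<nu> :: "real measure"
    and Y :: "real \<Rightarrow> 'w \<Rightarrow> real ^ 'q::{finite,linorder}"
  assumes "1 \<le> p" and "p \<le> CARD('q)"
    and "\<alpha> 0 > 0" and "\<alpha> p \<noteq> 0" and "\<beta> CARD('q) \<noteq> 0"
    and "\<forall>i\<in>{p<..CARD('q)}. \<alpha> i = 0"
    and B_def: "B = companion \<beta>" and a_def: "a = param_vec \<alpha>"
    and "levy_process M L" and "is_levy_measure M L \<nu>" and "emeasure \<nu> UNIV \<noteq> 0"
    and "state_process M L B a (\<alpha> 0) Y"
    and "card (eigenvalues B) = CARD('q)"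
    and "\<exists>r::ereal. 1 \<le> r \<and> (\<exists>S :: complex ^ 'q::{finite,linorder} ^ 'q::{finite,linorder}.
           invertible S \<and> diagonal_mat (matrix_inv S ** cmat B ** S) \<and>
           enn2ereal (\<integral>\<^sup>+y. ennreal (ln (1 +
               lr_opnorm r (matrix_inv S ** cmat (outer last_unit a) ** S) * y\<^sup>2)) \<partial>\<nu>)
             < ereal (- spectral_abscissa B))"
  shows "\<exists>\<mu>. prob_space \<mu> \<and> sets \<mu> = sets borel \<and>
           converges_in_distribution M Y \<mu> \<and>
           (\<forall>Z. state_process M L B a (\<alpha> 0) Z \<and> distr M borel (Z 0) = \<mu> \<longrightarrow>
              strictly_stationary M Z \<and> strictly_stationary M (volatility a (\<alpha> 0) Z))"
proof -
  obtain r and S :: "complex ^ 'q::{finite,linorder} ^ 'q::{finite,linorder}" where r: "1 \<le> r" and S: "invertible S"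
    and diag: "diagonal_mat (matrix_inv S ** cmat B ** S)"
    and moment: "enn2ereal (\<integral>\<^sup>+y. ennreal (ln (1 +
               lr_opnorm r (matrix_inv S ** cmat (outer last_unit a) ** S) * y\<^sup>2)) \<partial>\<nu>)
             < ereal (- spectral_abscissa B)"
    using assms(14) by blast
  define K where "K = lr_opnorm r (matrix_inv S ** cmat (outer last_unit a) ** S)"
  define l where "l = spectral_abscissa B"
  \<comment> \<open>A positive cardinality implies finiteness, which makes \<open>Max\<close> in
    \<open>spectral_abscissa\<close> an upper bound for the real parts.\<close>
  have fin: "finite (eigenvalues B)" using assms(13) by (intro card_ge_0_finite) simp
  \<comment> \<open>Coordinate p of \<open>a\<close> and the last coordinate of
    \<open>last_unit\<close> are nonzero, so the matrix \<open>outer last_unit a\<close> does not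
    vanish and \<open>K\<close> is positive.\<close>
  obtain i :: 'q where "pos i = p" using pos_surj[OF assms(1,2)] by blast
  then have "a $ i \<noteq> 0" using assms(4) by (simp add: a_def param_vec_def)
  then have a0: "a \<noteq> 0" by auto
  obtain j :: 'q where "pos j = CARD('q)" using pos_surj[of "CARD('q)"] by (auto simp: Suc_le_eq)
  then have "(last_unit :: real ^ 'q::{finite,linorder}) $ j \<noteq> 0" by (simp add: last_unit_def)
  then have e0: "(last_unit :: real ^ 'q::{finite,linorder}) \<noteq> 0" by auto
  have K: "0 < K" unfolding K_def by (rule lr_opnorm_conjugate_pos[OF r S e0 a0])
  have lt: "enn2ereal (\<integral>\<^sup>+y. ennreal (ln (1 + K * y\<^sup>2)) \<partial>\<nu>) < ereal (- l)"
    using moment by (simp add: K_def l_def)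
  \<comment> \<open>The integral is nonnegative, so the moment condition forces a negative spectral
    abscissa.\<close>
  have l: "l < 0"
  proof -
    have "0 < ereal (- l)" using enn2ereal_nonneg lt by (rule le_less_trans)
    then show ?thesis by simp
  qed
  have log_moment: "(\<integral>\<^sup>+y. ennreal (ln (1 + K * y\<^sup>2)) \<partial>\<nu>) < ennreal (- l)"
    using lt l by (simp add: less_ennreal.rep_eq enn2ereal_ennreal)
  obtain C nrm m1 m2 where "adapted_norm B a last_unit l K C nrm m1 m2"
    using adapted_norm_exists[OF fin r S diag, of a last_unit] unfolding K_def l_def by blast
  then interpret adapted_norm B a last_unit l K C nrm m1 m2 .
  have "prob_space M" using assms(9) by (simp add: levy_process_def)
  then interpret prob_space M .
  interpret cogarch_state M L B a l K C nrm m1 m2 "\<alpha> 0" \<nu>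
    by unfold_locales (use assms(3,9,10) K l log_moment in auto)
  show ?thesis
    using prob_space_limit_law sets_limit_law state_converges[OF assms(12)] state_stationary volatility_stationary
    by (intro exI[of _ limit_law]) blast
qed

end
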